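(* For every $\varepsilon>0$, $$\dim_H\left(\mathscr M(\mathbf H_4)\cap[0,2\sqrt2+\varepsilon)\right)\ \ge\ \dim_H\left(\mathscr L(\mathbf H_4)\cap[0,2\sqrt2+\varepsilon)\right)\ >\ 0,$$ where $\dim_H$ denotes Hausdorff dimension and $\mathscr M(\mathbf H_4)$, $\mathscr L(\mathbf H_4)$ are the Markoff and Lagrange spectra of the Hecke group $\mathbf H_4$.
   Context: $\mathbf H_4$ is the subgroup of $\mathrm{PSL}_2(\mathbb R)$ generated by $S=\begin{pmatrix}0&-1\\1&0\end{pmatrix}$ and $T=\begin{pmatrix}1&\sqrt2\\0&1\end{pmatrix}$. It acts on $\hat{\mathbb R}=\mathbb R\cup\{\infty\}$ by linear fractional transformations $\begin{pmatrix}a&b\\c&d\end{pmatrix}\cdot z=\frac{az+b}{cz+d}$. The orbit of $\infty$ is $\mathbb Q(\mathbf H_4)=\sqrt2\,\mathbb Q\cup\{\infty\}$. Markoff spectrum: $\mathscr M(\mathbf H_4)$ is the set of all finite values of $\sup_{M\in\mathbf H_4}|M^{-1}\cdot\xi-M^{-1}\cdot\eta|$ over all $\xi\neq\eta$ in $\hat{\mathbb R}$ (where $|x-y|=\infty$ if exactly one of $x,y$ is $\infty$). Lagrange spectrum: for $\xi\in\mathbb R\setminus\sqrt2\,\mathbb Q$, let $L_{\mathbf H_4}(\xi)$ be the supremum of all $L>0$ such that $\left|\xi-\frac ac\right|<\frac1{Lc^2}$ holds for infinitely many points $M\cdot\infty=\frac ac$ with $M=\begin{pmatrix}a&b\\c&d\end{pmatrix}\in\mathbf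 H_4$, $c\ne0$. Then $\mathscr L(\mathbf H_4)$ is the set of all finite values $L_{\mathbf H_4}(\xi)$, $\xi\in\mathbb R\setminus\sqrt2\,\mathbb Q$. *)

theory Defs
  imports "HOL-Analysis.Analysis" "HOL-Algebra.Generated_Groups"
begin

section \<open>Hausdorff dimension\<close>

text \<open>
  The size of a covering set for the s-dimensional Hausdorff measure: its diameter to the
  power \<open>s\<close>, where \<open>0\<^sup>0 = 1\<close> for a nonempty set (whereas \<open>0 powr 0 = 0\<close>) and the
  empty set always has size 0.
\<close>

definition hausdorff_gauge :: "real \<Rightarrow> 'a::metric_space set \<Rightarrow> ennreal" where
  "hausdorff_gauge s U =
     (if U = {} then 0 else if s = 0 then 1 else ennreal (diameter U powr s))"

text \<open>
  Boundedness of the covering sets is required explicitly because \<^const>\<open>diameter\<close> has no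
  meaningful value on unbounded sets.
\<close>

definition hausdorff_premeasure :: "real \<Rightarrow> real \<Rightarrow> 'a::metric_space set \<Rightarrow> ennreal" where
  "hausdorff_premeasure s \<delta> A =
     (INF U \<in> {U :: nat \<Rightarrow> 'a set. A \<subseteq> (\<Union>i. U i) \<and> (\<forall>i. bounded (U i) \<and> diameter (U i) \<le> \<delta>)}.
        \<Sum>i. hausdorff_gauge s (U i))"

definition hausdorff_measure :: "real \<Rightarrow> 'a::metric_space set \<Rightarrow> ennreal" where
  "hausdorff_measure s A = (SUP \<delta> \<in> {0<..}. hausdorff_premeasure s \<delta> A)"

definition hausdorff_dim :: "'a::metric_space set \<Rightarrow> ereal" where
  "hausdorff_dim A = (INF s \<in> {s::real. 0 \<le> s \<and> hausdorff_measure s A = 0}. ereal s)"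


section \<open>The Hecke group \<open>H\<^sub>4\<close>\<close>

definition SL2R :: "(real^2^2) monoid" where
  "SL2R = \<lparr>carrier = {A. det A = 1}, mult = (**), one = mat 1\<rparr>"

definition PSL2R :: "(real^2^2) set monoid" where
  "PSL2R = SL2R Mod {mat 1, - mat 1}"

definition psl_class :: "real^2^2 \<Rightarrow> (real^2^2) set" where
  "psl_class A = {mat 1, - mat 1} #>\<^bsub>SL2R\<^esub> A"

definition S_mat :: "real^2^2" where
  "S_mat = vector [vector [0, -1], vector [1, 0]]"

definition T_mat :: "real^2^2" where
  "T_mat = vector [vector [1, sqrt 2], vector [0, 1]]"

definition H4 :: "(real^2^2) set set" where
  "H4 = generate PSL2R {psl_class S_mat, psl_class T_mat}"

text \<open>
  Elements of \<^const>\<open>H4\<close> are classes \<open>{A, -A}\<close>, so \<open>\<Union>H4\<close> is the set of matrices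
  representing an element of the group. The notions below quantify over these representatives;
  all expressions involved are invariant under \<open>A \<mapsto> -A\<close>.
\<close>


section \<open>Action on the real projective line\<close>

datatype rhat = Fin real | Infty

fun moebius :: "real^2^2 \<Rightarrow> rhat \<Rightarrow> rhat" where
  "moebius A (Fin z) =
     (if A$2$1 * z + A$2$2 = 0 then Infty
      else Fin ((A$1$1 * z + A$1$2) / (A$2$1 * z + A$2$2)))"
| "moebius A Infty = (if A$2$1 = 0 then Infty else Fin (A$1$1 / A$2$1))"

text \<open>
  The value for two infinite arguments is irrelevant: below, the arguments are images of
  distinct points under a bijection.
\<close>

fun rhat_dist :: "rhat \<Rightarrow> rhat \<Rightarrow> ereal" where
  "rhat_dist (Fin x) (Fin y) = ereal \<bar>x - y\<bar>"
| "rhat_dist (Fin x) Infty = \<infinity>"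
| "rhat_dist Infty (Fin y) = \<infinity>"
| "rhat_dist Infty Infty = 0"


section \<open>Markoff and Lagrange spectra\<close>

definition markoff_value :: "rhat \<Rightarrow> rhat \<Rightarrow> ereal" where
  "markoff_value \<xi> \<eta> =
     (SUP M \<in> \<Union>H4. rhat_dist (moebius (matrix_inv M) \<xi>) (moebius (matrix_inv M) \<eta>))"

definition markoff_spectrum :: "real set" where
  "markoff_spectrum = {m. \<exists>\<xi> \<eta>. \<xi> \<noteq> \<eta> \<and> markoff_value \<xi> \<eta> = ereal m}"

definition sqrt2_rats :: "real set" where
  "sqrt2_rats = {sqrt 2 * q | q. q \<in> \<rat>}"

text \<open>
  The infinitude is that of the set of points \<open>a/c\<close>, not of the set of matrices: each point is
  represented by infinitely many matrices, which all have the same \<open>c\<^sup>2\<close>.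
\<close>

definition lagrange_value :: "real \<Rightarrow> ereal" where
  "lagrange_value \<xi> =
     (SUP L \<in> {L::real. L > 0 \<and>
        infinite {p. \<exists>M \<in> \<Union>H4. M$2$1 \<noteq> 0 \<and> p = M$1$1 / M$2$1 \<and>
                      \<bar>\<xi> - M$1$1 / M$2$1\<bar> < 1 / (L * (M$2$1)\<^sup>2)}}. ereal L)"

definition lagrange_spectrum :: "real set" where
  "lagrange_spectrum = {l. \<exists>\<xi>. \<xi> \<notin> sqrt2_rats \<and> lagrange_value \<xi> = ereal l}"


section \<open>Well-definedness\<close>

lemma group_SL2R: "group SL2R"
proof (rule groupI)
  fix A assume "A \<in> carrier SL2R"
  then have d: "det A = 1" by (simp add: SL2R_def)
  then obtain B where B: "A ** B = mat 1" "B ** A = mat 1"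
    using invertible_det_nz[of A] by (auto simp: invertible_def)
  have "det B = 1" using det_mul[of B A] B d by simp
  with B show "\<exists>y\<in>carrier SL2R. y \<otimes>\<^bsub>SL2R\<^esub> A = \<one>\<^bsub>SL2R\<^esub>"
    by (auto simp: SL2R_def)
qed (auto simp: SL2R_def det_mul matrix_mul_assoc)

lemma det_minus_2: "det (- A) = det (A :: real^2^2)"
  by (simp add: det_2)

lemma matrix_mult_minus_left: "(- A) ** B = - (A ** (B :: real^2^2))"
  by (simp add: vec_eq_iff matrix_matrix_mult_def sum_negf)

lemma matrix_mult_minus_right: "A ** (- B) = - (A ** (B :: real^2^2))"
  by (simp add: vec_eq_iff matrix_matrix_mult_def sum_negf)

lemma psl_class_eq: "psl_class A = {A, - A}"
  by (auto simp: psl_class_def r_coset_def SL2R_def matrix_mult_minus_left)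

lemma normal_pm1: "{mat 1, - mat 1} \<lhd> SL2R"
proof -
  interpret group SL2R by (rule group_SL2R)
  have "subgroup {mat 1, - mat 1} SL2R"
  proof (rule subgroupI)
    fix a :: "real^2^2" assume a: "a \<in> {mat 1, - mat 1}"
    then have "a \<in> carrier SL2R" "a \<otimes>\<^bsub>SL2R\<^esub> a = \<one>\<^bsub>SL2R\<^esub>"
      by (auto simp: SL2R_def det_minus_2 matrix_mult_minus_left matrix_mult_minus_right)
    then have "inv\<^bsub>SL2R\<^esub> a = a" by (simp add: inv_equality)
    with a show "inv\<^bsub>SL2R\<^esub> a \<in> {mat 1, - mat 1}" by simp
  qed (auto simp: SL2R_def det_minus_2 matrix_mult_minus_left matrix_mult_minus_right)
  then show ?thesis
    by (rule normalI)
      (auto simp: r_coset_def l_coset_def SL2R_def matrix_mult_minus_left matrix_mult_minus_right)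
qed

lemma group_PSL2R: "group PSL2R"
  unfolding PSL2R_def by (rule normal.factorgroup_is_group[OF normal_pm1])

lemma psl_class_in_PSL2R: "A \<in> carrier SL2R \<Longrightarrow> psl_class A \<in> carrier PSL2R"
  by (auto simp: PSL2R_def psl_class_def FactGroup_def RCOSETS_def)

lemma generators_in_PSL2R: "{psl_class S_mat, psl_class T_mat} \<subseteq> carrier PSL2R"
  by (auto intro!: psl_class_in_PSL2R simp: SL2R_def S_mat_def T_mat_def det_2)

lemma moebius_minus: "moebius (- A) z = moebius A z"
proof (cases z)
  case (Fin x)
  define n d where "n = A$1$1 * x + A$1$2" and "d = A$2$1 * x + A$2$2"
  have "(- A)$1$1 * x + (- A)$1$2 = - n" "(- A)$2$1 * x + (- A)$2$2 = - d"
    by (simp_all add: n_def d_def)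
  then show ?thesis
    unfolding Fin moebius.simps n_def[symmetric] d_def[symmetric] by simp
qed simp

end

theory Submission
  imports Defs
begin

text \<open>
  Every Lagrange value is a Markoff value (\<open>lagrange_spectrum_subset_markoff_spectrum\<close>), which gives
  the inequality between the two dimensions. If \<open>M\<^sub>n\<close> are group elements for which the cusps
  \<open>M\<^sub>n \<cdot> \<infinity>\<close> approximate \<open>\<xi>\<close> with the optimal constant, then the pairs \<open>(M\<^sub>n\<inverse> \<cdot> \<xi>, M\<^sub>n\<inverse> \<cdot> \<infinity>)\<close>,
  suitably translated, have a limit point, and the Markoff value of that limit is the Lagrange
  value of \<open>\<xi>\<close>.

  For the positivity of the dimension, write \<open>\<xi> = sqrt 2 * x\<close>. The cusps are the numbers
  \<open>sqrt 2 * p / q\<close> with \<open>p / q\<close> reduced, and the lower left entry \<open>c\<close> satisfies \<open>c\<^sup>2 = q\<^sup>2\<close> if \<open>q\<close> is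
  odd and \<open>c\<^sup>2 = q\<^sup>2 / 2\<close> if \<open>q\<close> is even. So the Lagrange value is \<open>sqrt 2\<close> times the upper limit of the
  numbers \<open>1 / (q * \<bar>q * x - p\<bar>)\<close>, halved for odd \<open>q\<close>. Weights above 2 belong to convergents of \<open>x\<close>,
  for which they are computed from the continued fraction read in both directions
  (\<open>lagrange_value_eq_limsup\<close>).

  Take digit sequences composed of blocks \<open>3, 2, \<dots>, 2, 1, 1\<close> with an even number \<open>2 * e i\<close> of digits 2
  in block \<open>i\<close>. The parity of the denominators repeats in each block, and only two weights per block
  can exceed 2: if \<open>f\<close> is the continued fraction that follows the digit 3 and \<open>1 - b\<close> the one that
  precedes it, read backwards, then they are \<open>2 + (f - b) / 2\<close> at the digit 3 and
  \<open>1 / (1 - b) + 1 / (3 + f)\<close> at the digit 1 in front of it. Both equal 2 if \<open>f\<close> and \<open>b\<close> are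
  \<open>sqrt 2 - 1 = [0; 2, 2, 2, \<dots>]\<close>, to which they are exponentially close when the exponents \<open>e\<close> are large.
  This is why an interval just above \<open>2 * sqrt 2\<close> contains many Lagrange values.

  The exponents run through \<open>k, K + w 0, \<dots>, K + w (m - 1), m\<close> for \<open>m = 0, 1, 2, \<dots>\<close>, where \<open>w\<close> is a
  sequence of bits and \<open>K\<close> is much larger than \<open>k\<close>. The blocks with exponent \<open>k\<close> have the largest
  weights. At these markers \<open>b\<close> tends to \<open>sqrt 2 - 1\<close>, because the preceding exponent \<open>m\<close> grows, and
  \<open>f\<close> tends to a limit \<open>f(w)\<close> because more and more of \<open>w\<close> follows. The one competitor is the weight at
  the end of the marker block. If the neighbouring blocks consisted of infinitely many digits 2, then a
  duality of the two formulas would make both weights equal; the free exponents after the marker decide the comparison in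
  favour of its start (\<open>after_marker_less\<close>). The Lagrange value is therefore
  \<open>sqrt 2 * (2 + (f(w) - (sqrt 2 - 1)) / 2)\<close> (\<open>limit_value_in_lagrange_spectrum\<close>).

  Distinct \<open>w\<close> that first differ at index \<open>j\<close> have values at distance at least a constant times
  \<open>c ^ j\<close> (\<open>free_tail_separation\<close>). The values thus form a set that a Hoelder map sends onto
  \<open>[0, 1)\<close>, and such a set has positive Hausdorff dimension (\<open>hausdorff_dim_positive_if_cantor_image\<close>).
\<close>

section \<open>The matrices of the Hecke group\<close>

definition mat2 :: "real \<Rightarrow> real \<Rightarrow> real \<Rightarrow> real \<Rightarrow> real^2^2" where
  "mat2 a b c d = vector [vector [a, b], vector [c, d]]"

lemma mat2_nth [simp]:
  "mat2 a b c d $ 1 $ 1 = a" "mat2 a b c d $ 1 $ 2 = b"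
  "mat2 a b c d $ 2 $ 1 = c" "mat2 a b c d $ 2 $ 2 = d"
  by (simp_all add: mat2_def)

lemma mat2_eta: "A = mat2 (A$1$1) (A$1$2) (A$2$1) (A$2$2)"
  by (simp add: vec_eq_iff forall_2)

lemma mat2_mult: "mat2 a b c d ** mat2 p q r s = mat2 (a * p+b * r) (a * q+b * s) (c * p+d * r) (c * q+d * s)"
  by (simp add: vec_eq_iff forall_2 matrix_matrix_mult_def sum_2)

lemma mat2_minus: "- mat2 a b c d = mat2 (-a) (-b) (-c) (-d)"
  by (simp add: vec_eq_iff forall_2)

lemma mat2_one: "mat 1 = mat2 1 0 0 1"
  by (simp add: vec_eq_iff forall_2 mat_def)

lemma det_mat2: "det (mat2 a b c d) = a * d - b * c"
  by (simp add: det_2)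

lemma psl_class_mult:
  assumes "det A = 1" "det B = 1"
  shows "psl_class A \<otimes>\<^bsub>PSL2R\<^esub> psl_class B = psl_class (A ** B)"
  using normal.rcos_sum[OF normal_pm1, of A B] assms
  by (simp add: PSL2R_def FactGroup_def psl_class_def SL2R_def)

lemma psl_class_one: "\<one>\<^bsub>PSL2R\<^esub> = psl_class (mat 1)"
  by (simp add: PSL2R_def FactGroup_def psl_class_eq)

lemma psl_class_inv:
  assumes "det A = 1" "det B = 1" "B ** A = mat 1"
  shows "inv\<^bsub>PSL2R\<^esub> (psl_class A) = psl_class B"
proof (rule group.inv_equality[OF group_PSL2R])
  show "psl_class B \<otimes>\<^bsub>PSL2R\<^esub> psl_class A = \<one>\<^bsub>PSL2R\<^esub>"
    using psl_class_mult[OF assms(2,1)] assms(3) by (simp add: psl_class_one)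
qed (use assms in \<open>auto intro!: psl_class_in_PSL2R simp: SL2R_def\<close>)

text \<open>
  Integral matrices of determinant 1 with the factor \<open>sqrt 2\<close> either on the antidiagonal or on the
  diagonal. Those of the first kind form a subgroup of index 2, and \<open>S\<close> is of the second kind.
\<close>

definition hecke4_entries :: "real^2^2 \<Rightarrow> bool" where
  "hecke4_entries A \<longleftrightarrow> (\<exists>(a::int) (b::int) (c::int) (d::int).
     (A = mat2 (of_int a) (sqrt 2 * of_int b) (sqrt 2 * of_int c) (of_int d) \<and> a * d - 2 * b * c = 1) \<or>
     (A = mat2 (sqrt 2 * of_int a) (of_int b) (of_int c) (sqrt 2 * of_int d) \<and> 2 * a * d - b * c = 1))"

lemma hecke4_entriesE:
  assumes "hecke4_entries A"
  obtains (diag) a b c d where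
      "A = mat2 (of_int a) (sqrt 2 * of_int b) (sqrt 2 * of_int c) (of_int d)" "a * d - 2 * b * c = 1"
  | (off) a b c d where
      "A = mat2 (sqrt 2 * of_int a) (of_int b) (of_int c) (sqrt 2 * of_int d)" "2 * a * d - b * c = 1"
  using assms unfolding hecke4_entries_def by blast

lemma hecke4_entries_diag:
  "A = mat2 (of_int a) (sqrt 2 * of_int b) (sqrt 2 * of_int c) (of_int d) \<Longrightarrow> a * d - 2 * b * c = 1 \<Longrightarrow> hecke4_entries A"
  unfolding hecke4_entries_def by blast

lemma hecke4_entries_off:
  "A = mat2 (sqrt 2 * of_int a) (of_int b) (of_int c) (sqrt 2 * of_int d) \<Longrightarrow> 2 * a * d - b * c = 1 \<Longrightarrow> hecke4_entries A"
  unfolding hecke4_entries_def by blast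

lemma sqrt2_mult_sqrt2: "sqrt 2 * (sqrt 2 * x) = 2 * (x::real)"
  by (simp add: mult.assoc[symmetric])

lemma hecke4_entries_mult:
  assumes "hecke4_entries A" "hecke4_entries B"
  shows "hecke4_entries (A ** B)"
  using assms(1)
proof (cases rule: hecke4_entriesE)
  case A: (diag a b c d)
  from assms(2) show ?thesis
  proof (cases rule: hecke4_entriesE)
    case B: (diag p q r s)
    show ?thesis
    proof (rule hecke4_entries_diag)
      show "A ** B = mat2 (of_int (a * p+2 * b * r)) (sqrt 2 * of_int (a * q+b * s)) (sqrt 2 * of_int (c * p+d * r)) (of_int (2 * c * q+d * s))"
        unfolding A(1) B(1) mat2_mult by (simp add: algebra_simps sqrt2_mult_sqrt2)
      have "(a * p+2 * b * r) * (2 * c * q+d * s) - 2 * (a * q+b * s) * (c * p+d * r) = (a * d-2 * b * c) * (p * s-2 * q * r)"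
        by algebra
      then show "(a * p+2 * b * r) * (2 * c * q+d * s) - 2 * (a * q+b * s) * (c * p+d * r) = 1" using A B by simp
    qed
  next
    case B: (off p q r s)
    show ?thesis
    proof (rule hecke4_entries_off)
      show "A ** B = mat2 (sqrt 2 * of_int (a * p+b * r)) (of_int (a * q+2 * b * s)) (of_int (2 * c * p+d * r)) (sqrt 2 * of_int (c * q+d * s))"
        unfolding A(1) B(1) mat2_mult by (simp add: algebra_simps sqrt2_mult_sqrt2)
      have "2 * (a * p+b * r) * (c * q+d * s) - (a * q+2 * b * s) * (2 * c * p+d * r) = (a * d-2 * b * c) * (2 * p * s-q * r)"
        by algebra
      then show "2 * (a * p+b * r) * (c * q+d * s) - (a * q+2 * b * s) * (2 * c * p+d * r) = 1" using A B by simp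
    qed
  qed
next
  case A: (off a b c d)
  from assms(2) show ?thesis
  proof (cases rule: hecke4_entriesE)
    case B: (diag p q r s)
    show ?thesis
    proof (rule hecke4_entries_off)
      show "A ** B = mat2 (sqrt 2 * of_int (a * p+b * r)) (of_int (2 * a * q+b * s)) (of_int (c * p+2 * d * r)) (sqrt 2 * of_int (c * q+d * s))"
        unfolding A(1) B(1) mat2_mult by (simp add: algebra_simps sqrt2_mult_sqrt2)
      have "2 * (a * p+b * r) * (c * q+d * s) - (2 * a * q+b * s) * (c * p+2 * d * r) = (2 * a * d-b * c) * (p * s-2 * q * r)"
        by algebra
      then show "2 * (a * p+b * r) * (c * q+d * s) - (2 * a * q+b * s) * (c * p+2 * d * r) = 1" using A B by simp
    qed
  next
    case B: (off p q r s)
    show ?thesis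
    proof (rule hecke4_entries_diag)
      show "A ** B = mat2 (of_int (2 * a * p+b * r)) (sqrt 2 * of_int (a * q+b * s)) (sqrt 2 * of_int (c * p+d * r)) (of_int (c * q+2 * d * s))"
        unfolding A(1) B(1) mat2_mult by (simp add: algebra_simps sqrt2_mult_sqrt2)
      have "(2 * a * p+b * r) * (c * q+2 * d * s) - 2 * (a * q+b * s) * (c * p+d * r) = (2 * a * d-b * c) * (2 * p * s-q * r)"
        by algebra
      then show "(2 * a * p+b * r) * (c * q+2 * d * s) - 2 * (a * q+b * s) * (c * p+d * r) = 1" using A B by simp
    qed
  qed
qed

lemma hecke4_entries_minus:
  assumes "hecke4_entries A"
  shows "hecke4_entries (- A)"
  using assms
proof (cases rule: hecke4_entriesE)
  case (diag a b c d)
  then show ?thesis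
    by (intro hecke4_entries_diag[of _ "-a" "-b" "-c" "-d"]) (auto simp: mat2_minus)
next
  case (off a b c d)
  then show ?thesis
    by (intro hecke4_entries_off[of _ "-a" "-b" "-c" "-d"]) (auto simp: mat2_minus)
qed

lemma hecke4_entries_det:
  assumes "hecke4_entries A"
  shows "det A = 1"
  using assms
proof (cases rule: hecke4_entriesE)
  case (diag a b c d)
  have "det A = of_int (a * d - 2 * b * c)"
    unfolding diag(1) det_mat2 by (simp add: algebra_simps sqrt2_mult_sqrt2)
  with diag(2) show ?thesis by simp
next
  case (off a b c d)
  have "det A = of_int (2 * a * d - b * c)"
    unfolding off(1) det_mat2 by (simp add: algebra_simps sqrt2_mult_sqrt2)
  with off(2) show ?thesis by simp
qed

lemma S_mat_eq: "S_mat = mat2 0 (-1) 1 0" and T_mat_eq: "T_mat = mat2 1 (sqrt 2) 0 1"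
  by (simp_all add: S_mat_def T_mat_def mat2_def)

lemma hecke4_entries_generators:
  "hecke4_entries (mat2 0 (-1) 1 0)" "hecke4_entries (mat2 0 1 (-1) 0)"
  "hecke4_entries (mat2 1 (sqrt 2) 0 1)" "hecke4_entries (mat2 1 (- sqrt 2) 0 1)" "hecke4_entries (mat 1)"
  using hecke4_entries_off[of _ 0 "-1" 1 0] hecke4_entries_off[of _ 0 1 "-1" 0]
    hecke4_entries_diag[of _ 1 1 0 1] hecke4_entries_diag[of _ 1 "-1" 0 1] hecke4_entries_diag[of _ 1 0 0 1]
  by (auto simp: mat2_one)

lemma inv_generators:
  "inv\<^bsub>PSL2R\<^esub> (psl_class S_mat) = psl_class (mat2 0 1 (-1) 0)"
  "inv\<^bsub>PSL2R\<^esub> (psl_class T_mat) = psl_class (mat2 1 (- sqrt 2) 0 1)"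
  by (rule psl_class_inv; simp add: S_mat_eq T_mat_eq det_mat2 mat2_mult mat2_one)+

lemma H4_class:
  assumes "X \<in> H4" shows "\<exists>A. hecke4_entries A \<and> X = psl_class A"
  using assms unfolding H4_def
proof (induction rule: generate.induct)
  case one
  then show ?case using hecke4_entries_generators psl_class_one by blast
next
  case (incl h)
  then show ?case using hecke4_entries_generators by (auto simp: S_mat_eq T_mat_eq)
next
  case (inv h)
  then show ?case using hecke4_entries_generators inv_generators by auto
next
  case (eng h1 h2)
  then obtain A B where "hecke4_entries A" "h1 = psl_class A" "hecke4_entries B" "h2 = psl_class B"
    by blast
  then show ?case using psl_class_mult[of A B] hecke4_entries_mult[of A B] hecke4_entries_det by blast
qed

text \<open>
  A class in \<^const>\<open>H4\<close> is \<open>{A, - A}\<close>, so each of its two elements can serve as its representative.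
\<close>

lemma H4_matrixE:
  assumes "A \<in> \<Union>H4"
  obtains "psl_class A \<in> H4" "hecke4_entries A"
proof -
  obtain X where X: "X \<in> H4" "A \<in> X" using assms by blast
  obtain B where B: "hecke4_entries B" "X = psl_class B" using H4_class[OF X(1)] by blast
  have "A = B \<or> A = - B" using X(2) B(2) by (simp add: psl_class_eq)
  then have "hecke4_entries A \<and> psl_class A = X"
    using B hecke4_entries_minus[of B] by (auto simp: psl_class_eq insert_commute)
  with X(1) show ?thesis using that by simp
qed

lemma psl_class_H4_in: "psl_class A \<in> H4 \<Longrightarrow> A \<in> \<Union>H4"
  by (rule UnionI[of "psl_class A"]) (auto simp: psl_class_eq)

lemma H4_matrix_entries: "A \<in> \<Union>H4 \<Longrightarrow> hecke4_entries A"
  by (erule H4_matrixE)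

lemma H4_matrix_class: "A \<in> \<Union>H4 \<Longrightarrow> psl_class A \<in> H4"
  by (erule H4_matrixE)

lemma H4_matrix_mult:
  assumes "A \<in> \<Union>H4" "B \<in> \<Union>H4"
  shows "A ** B \<in> \<Union>H4"
proof -
  have "det A = 1" "det B = 1"
    using assms H4_matrix_entries hecke4_entries_det by blast+
  then have "psl_class (A ** B) = psl_class A \<otimes>\<^bsub>PSL2R\<^esub> psl_class B" using psl_class_mult by simp
  also have "\<dots> \<in> H4"
    using assms[THEN H4_matrix_class] unfolding H4_def by (rule generate.eng)
  finally show ?thesis by (rule psl_class_H4_in)
qed

lemma H4_matrix_minus: "A \<in> \<Union>H4 \<Longrightarrow> - A \<in> \<Union>H4"
  using H4_matrix_class[of A] by (intro psl_class_H4_in) (simp add: psl_class_eq insert_commute)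

lemma H4_matrix_one: "mat2 1 0 0 1 \<in> \<Union>H4"
proof (rule psl_class_H4_in)
  have "\<one>\<^bsub>PSL2R\<^esub> \<in> H4" unfolding H4_def by (rule generate.one)
  then show "psl_class (mat2 1 0 0 1) \<in> H4" by (simp only: psl_class_one mat2_one)
qed

lemma H4_matrix_S: "mat2 0 (-1) 1 0 \<in> \<Union>H4"
  unfolding S_mat_eq[symmetric] H4_def[symmetric]
  by (rule psl_class_H4_in) (simp add: H4_def generate.incl)

lemma H4_matrix_T: "mat2 1 (sqrt 2) 0 1 \<in> \<Union>H4"
  unfolding T_mat_eq[symmetric]
  by (rule psl_class_H4_in) (simp add: H4_def generate.incl)

lemma H4_matrix_T_inv: "mat2 1 (- sqrt 2) 0 1 \<in> \<Union>H4"
  by (rule psl_class_H4_in) (simp only: H4_def inv_generators(2)[symmetric], rule generate.inv, simp)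

lemma H4_matrix_translation: "mat2 1 (sqrt 2 * of_int k) 0 1 \<in> \<Union>H4"
proof (cases k)
  case (nonneg n)
  have "mat2 1 (sqrt 2 * of_nat n) 0 1 \<in> \<Union>H4"
  proof (induction n)
    case 0
    then show ?case using H4_matrix_one by simp
  next
    case (Suc n)
    show ?case using H4_matrix_mult[OF Suc H4_matrix_T] by (simp add: mat2_mult algebra_simps del: Union_iff)
  qed
  then show ?thesis using nonneg by simp
next
  case (neg n)
  have "mat2 1 (- (sqrt 2 * of_nat n)) 0 1 \<in> \<Union>H4" for n
  proof (induction n)
    case 0
    then show ?case using H4_matrix_one by simp
  next
    case (Suc n)
    show ?case using H4_matrix_mult[OF Suc H4_matrix_T_inv] by (simp add: mat2_mult algebra_simps del: Union_iff)
  qed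
  moreover have "sqrt 2 * of_int k = - (sqrt 2 * of_nat (Suc n))" unfolding neg by (simp add: algebra_simps)
  ultimately show ?thesis by (simp only:)
qed

lemma coprime_add_multiple:
  fixes a b k :: int
  assumes "coprime a b"
  shows "coprime (a + k * b) b"
  using assms gcd_add_mult[of b k a] by (simp add: coprime_iff_gcd_eq_1 gcd.commute add.commute)

lemma exists_balanced_remainder:
  fixes p m :: int
  assumes "m > 0"
  shows "\<exists>k. 2 * \<bar>p + k * m\<bar> \<le> m"
proof -
  define r where "r = p mod m"
  have r: "0 \<le> r" "r < m" using assms by (simp_all add: r_def)
  have p: "p + - (p div m) * m = r" by (simp add: r_def minus_div_mult_eq_mod)
  show ?thesis
  proof (cases "2 * r \<le> m")
    case True
    then show ?thesis using p r by (intro exI[of _ "- (p div m)"]) simp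
  next
    case False
    have "p + (- (p div m) - 1) * m = r - m" using p by (simp add: algebra_simps)
    then show ?thesis using False r by (intro exI[of _ "- (p div m) - 1"]) simp
  qed
qed

text \<open>
  A first column \<open>(a, c)\<close> stands for the cusp \<open>a / c\<close> together with the size of its denominator.
\<close>

definition cusp_column :: "real \<Rightarrow> real \<Rightarrow> bool" where
  "cusp_column a c \<longleftrightarrow> (\<exists>M \<in> \<Union>H4. M$1$1 = a \<and> M$2$1 = c)"

lemma cusp_columnI: "mat2 a b c d \<in> \<Union>H4 \<Longrightarrow> cusp_column a c"
  unfolding cusp_column_def by (rule bexI[of _ "mat2 a b c d"]) (simp_all del: Union_iff)

lemma cusp_columnE:
  assumes "cusp_column a c"
  obtains b d where "mat2 a b c d \<in> \<Union>H4"
proof -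
  obtain M where M: "M \<in> \<Union>H4" "M$1$1 = a" "M$2$1 = c"
    using assms unfolding cusp_column_def by blast
  have "M = mat2 a (M$1$2) c (M$2$2)" using mat2_eta[of M] unfolding M(2,3) .
  with M(1) show ?thesis using that[of "M$1$2" "M$2$2"] by argo
qed

lemma cusp_column_minus:
  assumes "cusp_column (-a) (-c)"
  shows "cusp_column a c"
proof -
  obtain b d where "mat2 (-a) b (-c) d \<in> \<Union>H4" using assms by (rule cusp_columnE)
  then have "- mat2 (-a) b (-c) d \<in> \<Union>H4" by (rule H4_matrix_minus)
  then show ?thesis unfolding mat2_minus minus_minus by (rule cusp_columnI)
qed

lemma cusp_column_translate:
  assumes "cusp_column (a + sqrt 2 * of_int k * c) c"
  shows "cusp_column a c"
proof -
  obtain b d where M: "mat2 (a + sqrt 2 * of_int k * c) b c d \<in> \<Union>H4"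
    using assms by (rule cusp_columnE)
  have "mat2 1 (sqrt 2 * of_int (-k)) 0 1 ** mat2 (a + sqrt 2 * of_int k * c) b c d
      = mat2 a (b - sqrt 2 * of_int k * d) c d"
    by (simp add: mat2_mult)
  then show ?thesis
    using H4_matrix_mult[OF H4_matrix_translation[of "-k"] M] cusp_columnI by metis
qed

lemma cusp_column_S:
  assumes "cusp_column (-c) a"
  shows "cusp_column a c"
proof -
  obtain b d where M: "mat2 (-c) b a d \<in> \<Union>H4" using assms by (rule cusp_columnE)
  have "mat2 0 (-1) 1 0 ** mat2 (-c) b a d = mat2 (-a) (-d) (-c) b"
    by (simp add: mat2_mult)
  then have "cusp_column (-a) (-c)"
    using H4_matrix_mult[OF H4_matrix_S M] cusp_columnI by metis
  then show ?thesis by (rule cusp_column_minus)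
qed

text \<open>
  Euclid's algorithm. A translation reduces the upper entry modulo \<open>sqrt 2\<close> times the lower one, and
  \<open>S\<close> exchanges the entries. The two kinds of columns alternate, and the square of the lower entry
  is at least halved in each step.
\<close>

lemma cusp_columns:
  fixes p q s :: int
  shows "coprime p (2 * s) \<Longrightarrow> cusp_column p (sqrt 2 * s)"
    and "coprime (2 * p) q \<Longrightarrow> cusp_column (sqrt 2 * p) q"
proof -
  have main: "(\<forall>p s :: int. coprime p (2 * s) \<longrightarrow> nat (2 * s\<^sup>2) = n \<longrightarrow> cusp_column p (sqrt 2 * s)) \<and>
        (\<forall>p q :: int. coprime (2 * p) q \<longrightarrow> nat (q\<^sup>2) = n \<longrightarrow> cusp_column (sqrt 2 * p) q)" for n
  proof (induction n rule: less_induct)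
    case (less n)
    have IH1: "cusp_column p (sqrt 2 * s)" if "coprime p (2 * s)" "nat (2 * s\<^sup>2) < n" for p s :: int
      by (rule less.IH[OF that(2), THEN conjunct1, rule_format, OF that(1) refl])
    have IH2: "cusp_column (sqrt 2 * p) q" if "coprime (2 * p) q" "nat (q\<^sup>2) < n" for p q :: int
      by (rule less.IH[OF that(2), THEN conjunct2, rule_format, OF that(1) refl])
    show ?case
    proof (intro conjI allI impI)
      fix p s :: int
      assume cop: "coprime p (2 * s)" and n: "nat (2 * s\<^sup>2) = n"
      show "cusp_column p (sqrt 2 * s)"
      proof (cases "s = 0")
        case True
        then have "p = 1 \<or> p = -1" using cop by auto
        moreover have "cusp_column 1 0" using H4_matrix_one by (rule cusp_columnI)
        ultimately show ?thesis using True cusp_column_minus[of "-1" 0] by auto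
      next
        case False
        then obtain k where k: "2 * \<bar>p + k * (2 * \<bar>s\<bar>)\<bar> \<le> 2 * \<bar>s\<bar>"
          using exists_balanced_remainder[of "2 * \<bar>s\<bar>" p] by auto
        \<comment> \<open>The multiples were counted in units of \<open>\<bar>s\<bar>\<close>.\<close>
        define j where "j = k * sgn s"
        define p' where "p' = p + j * (2 * s)"
        have "p' = p + k * (2 * \<bar>s\<bar>)" by (simp add: p'_def j_def abs_sgn mult_ac)
        then have p': "\<bar>p'\<bar> \<le> \<bar>s\<bar>" using k by simp
        have cop': "coprime p' (2 * s)"
          unfolding p'_def using cop by (rule coprime_add_multiple)
        have "p'\<^sup>2 \<le> s\<^sup>2" using p' by (simp add: abs_le_square_iff)
        moreover have "s\<^sup>2 > 0" using False by simp
        ultimately have "p'\<^sup>2 < 2 * s\<^sup>2" by linarith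
        then have "nat (p'\<^sup>2) < n" unfolding n[symmetric] by (subst nat_less_eq_zless) simp_all
        moreover have "coprime (2 * (-s)) p'" using coprime_commute[THEN iffD1, OF cop'] by simp
        ultimately have "cusp_column (sqrt 2 * of_int (-s)) p'" by (rule IH2[rotated])
        then have "cusp_column p' (sqrt 2 * s)" using cusp_column_S by simp
        moreover have "real_of_int p' = p + sqrt 2 * j * (sqrt 2 * s)"
        proof -
          have "sqrt 2 * real_of_int j * (sqrt 2 * s) = (sqrt 2 * sqrt 2) * (j * s)"
            by (simp add: mult.assoc mult.left_commute)
          then show ?thesis unfolding p'_def by simp
        qed
        ultimately show ?thesis using cusp_column_translate[of p j "sqrt 2 * s"] by simp
      qed
    next
      fix p q :: int
      assume cop: "coprime (2 * p) q" and n: "nat (q\<^sup>2) = n"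
      have q: "q \<noteq> 0" using cop by auto
      then obtain k where k: "2 * \<bar>p + k * \<bar>q\<bar>\<bar> \<le> \<bar>q\<bar>"
        using exists_balanced_remainder[of "\<bar>q\<bar>" p] by auto
      define j where "j = k * sgn q"
      define p' where "p' = p + j * q"
      have "p' = p + k * \<bar>q\<bar>" by (simp add: p'_def j_def abs_sgn mult_ac)
      then have p': "\<bar>2 * p'\<bar> \<le> \<bar>q\<bar>" using k unfolding abs_mult by simp
      have "2 * p' = 2 * p + (2 * j) * q" by (simp add: p'_def algebra_simps)
      then have cop': "coprime (2 * p') q"
        using coprime_add_multiple[OF cop] by simp
      have "(2 * p')\<^sup>2 \<le> q\<^sup>2" using p' by (simp only: abs_le_square_iff)
      then have "4 * p'\<^sup>2 \<le> q\<^sup>2" by (simp add: power_mult_distrib)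
      moreover have "q\<^sup>2 > 0" using q by simp
      ultimately have "2 * p'\<^sup>2 < q\<^sup>2" by linarith
      then have "nat (2 * p'\<^sup>2) < n" unfolding n[symmetric] by (subst nat_less_eq_zless) simp_all
      moreover have "coprime (-q) (2 * p')" using coprime_commute[THEN iffD1, OF cop'] by simp
      ultimately have "cusp_column (of_int (-q)) (sqrt 2 * p')" by (rule IH1[rotated])
      then have "cusp_column (sqrt 2 * p') q" using cusp_column_S by simp
      moreover have "sqrt 2 * real_of_int p' = sqrt 2 * p + sqrt 2 * j * q"
        unfolding p'_def by (simp add: algebra_simps)
      ultimately show "cusp_column (sqrt 2 * p) q"
        using cusp_column_translate[of "sqrt 2 * p" j q] by simp
    qed
  qed
  show "cusp_column p (sqrt 2 * s)" if "coprime p (2 * s)"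
    by (rule main[THEN conjunct1, rule_format, OF that refl])
  show "cusp_column (sqrt 2 * p) q" if "coprime (2 * p) q"
    by (rule main[THEN conjunct2, rule_format, OF that refl])
qed


section \<open>Lagrange values are Markoff values\<close>

lemma matrix_inv_mat2:
  assumes "a * d - b * c = 1"
  shows "matrix_inv (mat2 a b c d) = mat2 d (-b) (-c) a"
proof -
  have inv1: "mat2 a b c d ** mat2 d (-b) (-c) a = mat 1" and inv2: "mat2 d (-b) (-c) a ** mat2 a b c d = mat 1"
    using assms by (simp_all add: mat2_mult mat2_one algebra_simps)
  then have "\<exists>B. mat2 a b c d ** B = mat 1 \<and> B ** mat2 a b c d = mat 1" by blast
  then have inv: "mat2 a b c d ** matrix_inv (mat2 a b c d) = mat 1"
    unfolding matrix_inv_def by (rule someI2_ex) simp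
  have "matrix_inv (mat2 a b c d) = (mat2 d (-b) (-c) a ** mat2 a b c d) ** matrix_inv (mat2 a b c d)"
    unfolding inv2 by simp
  also have "\<dots> = mat2 d (-b) (-c) a" unfolding matrix_mul_assoc[symmetric] inv by simp
  finally show ?thesis .
qed

lemma moebius_diff:
  assumes det: "p * s - r * q = 1" and nz: "p - q * x \<noteq> 0" "p - q * y \<noteq> 0"
  shows "rhat_dist (moebius (mat2 s (-r) (-q) p) (Fin x)) (moebius (mat2 s (-r) (-q) p) (Fin y))
    = ereal (\<bar>x - y\<bar> / (\<bar>p - q * x\<bar> * \<bar>p - q * y\<bar>))"
proof -
  have "(s * x - r) / (p - q * x) - (s * y - r) / (p - q * y)
      = ((p * s - r * q) * (x - y)) / ((p - q * x) * (p - q * y))"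
    using nz by (simp add: diff_frac_eq) (simp add: algebra_simps)
  then have "\<bar>(s * x - r) / (p - q * x) - (s * y - r) / (p - q * y)\<bar>
      = \<bar>x - y\<bar> / (\<bar>p - q * x\<bar> * \<bar>p - q * y\<bar>)"
    unfolding det by (simp add: abs_mult)
  moreover have "- q * z + p = p - q * z" "s * z + - r = s * z - r" for z by simp_all
  ultimately show ?thesis using nz by simp
qed

text \<open>
  This is the form in which the discreteness of the group is used.
\<close>

lemma hecke4_lower_left_ge_1:
  assumes "hecke4_entries M" "M$2$1 \<noteq> 0"
  shows "\<bar>M$2$1\<bar> \<ge> 1"
  using assms(1)
proof (cases rule: hecke4_entriesE)
  case (diag a b c d)
  with assms(2) have "\<bar>c\<bar> \<ge> 1" by auto
  then have "1 \<le> \<bar>real_of_int c\<bar>" by linarith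
  then have "1 * 1 \<le> sqrt 2 * \<bar>real_of_int c\<bar>" by (intro mult_mono) auto
  with diag show ?thesis by (simp add: abs_mult)
next
  case (off a b c d)
  with assms(2) have "\<bar>c\<bar> \<ge> 1" by auto
  then show ?thesis using off by (simp flip: of_int_abs)
qed

lemma hecke4_lower_right_if_lower_left_0:
  assumes "hecke4_entries M" "M$2$1 = 0"
  shows "\<bar>M$2$2\<bar> = 1"
  using assms(1)
proof (cases rule: hecke4_entriesE)
  case (diag a b c d)
  with assms(2) have "d * a = 1" by (simp add: mult.commute)
  then have "\<bar>d * a\<bar> = 1" by simp
  then have "\<bar>d\<bar> = 1" by (rule abs_zmult_eq_1)
  then show ?thesis using diag by (simp flip: of_int_abs)
next
  case (off a b c d)
  with assms(2) have "2 * (a * d) = 1" by (simp add: mult.assoc)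
  then have False by presburger
  then show ?thesis ..
qed

lemma hecke4_cusp_in_sqrt2_rats:
  assumes "hecke4_entries M"
  shows "M$1$1 / M$2$1 \<in> sqrt2_rats"
  using assms
proof (cases rule: hecke4_entriesE)
  case (diag a b c d)
  have "M$1$1 / M$2$1 = sqrt 2 * (of_int a / (2 * of_int c))"
  proof -
    have "sqrt 2 * (of_int a / (2 * of_int c)) = (sqrt 2 * of_int a) / (sqrt 2 * (sqrt 2 * real_of_int c))"
      unfolding sqrt2_mult_sqrt2 by simp
    also have "\<dots> = of_int a / (sqrt 2 * of_int c)" by (rule mult_divide_mult_cancel_left) simp
    finally show ?thesis unfolding diag(1) by simp
  qed
  moreover have "(of_int a / (2 * of_int c) :: real) \<in> \<rat>" by simp
  ultimately show ?thesis unfolding sqrt2_rats_def by blast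
next
  case (off a b c d)
  have "M$1$1 / M$2$1 = sqrt 2 * (of_int a / of_int c)" unfolding off(1) by simp
  moreover have "(of_int a / of_int c :: real) \<in> \<rat>" by simp
  ultimately show ?thesis unfolding sqrt2_rats_def by blast
qed

lemma finite_cusps_bounded:
  "finite {M$1$1 / M$2$1 | M. hecke4_entries M \<and> \<bar>M$1$1\<bar> \<le> B \<and> \<bar>M$2$1\<bar> \<le> B}"
proof -
  define N where "N = \<lceil>\<bar>B\<bar>\<rceil>"
  define F where "F = (\<lambda>(a, c). of_int a / (sqrt 2 * of_int c)) ` ({-N..N} \<times> {-N..N})
    \<union> (\<lambda>(a, c). (sqrt 2 * of_int a) / of_int c) ` ({-N..N} \<times> {-N..N})"
  have N: "z \<in> {-N..N}" if "\<bar>real_of_int z\<bar> \<le> B" for z :: int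
    using that unfolding N_def by auto linarith+
  have N': "z \<in> {-N..N}" if "\<bar>sqrt 2 * real_of_int z\<bar> \<le> B" for z :: int
  proof (rule N)
    have "1 * \<bar>real_of_int z\<bar> \<le> sqrt 2 * \<bar>real_of_int z\<bar>" by (intro mult_right_mono) auto
    then show "\<bar>real_of_int z\<bar> \<le> B" using that by (simp add: abs_mult)
  qed
  have "M$1$1 / M$2$1 \<in> F" if "hecke4_entries M" "\<bar>M$1$1\<bar> \<le> B" "\<bar>M$2$1\<bar> \<le> B" for M
    using that(1)
  proof (cases rule: hecke4_entriesE)
    case (diag a b c d)
    then have "(a, c) \<in> {-N..N} \<times> {-N..N}" using N[of a] N'[of c] that(2,3) by simp
    then show ?thesis unfolding F_def diag(1) mat2_nth by (intro UnI1 image_eqI[of _ _ "(a, c)"]) simp_all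
  next
    case (off a b c d)
    then have "(a, c) \<in> {-N..N} \<times> {-N..N}" using N'[of a] N[of c] that(2,3) by simp
    then show ?thesis unfolding F_def off(1) mat2_nth by (intro UnI2 image_eqI[of _ _ "(a, c)"]) simp_all
  qed
  then have "{M$1$1 / M$2$1 | M. hecke4_entries M \<and> \<bar>M$1$1\<bar> \<le> B \<and> \<bar>M$2$1\<bar> \<le> B} \<subseteq> F" by blast
  moreover have "finite F" unfolding F_def by simp
  ultimately show ?thesis by (rule finite_subset)
qed

text \<open>
  The condition \<open>\<bar>\<xi> - a / c\<bar> < 1 / (L * c\<^sup>2)\<close> with the denominators cleared.
\<close>

definition good_cusps :: "real \<Rightarrow> real \<Rightarrow> real set" where
  "good_cusps \<xi> L = {p. \<exists>M \<in> \<Union>H4. M$2$1 \<noteq> 0 \<and> p = M$1$1 / M$2$1 \<and>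
     L * (\<bar>M$2$1\<bar> * \<bar>M$1$1 - M$2$1 * \<xi>\<bar>) < 1}"

lemma approximation_iff:
  fixes \<xi> a c L :: real
  assumes "c \<noteq> 0" "L > 0"
  shows "\<bar>\<xi> - a / c\<bar> < 1 / (L * c\<^sup>2) \<longleftrightarrow> L * (\<bar>c\<bar> * \<bar>a - c * \<xi>\<bar>) < 1"
proof -
  have 1: "\<bar>\<xi> - a / c\<bar> = \<bar>a - c * \<xi>\<bar> / \<bar>c\<bar>"
  proof -
    have "\<xi> - a / c = - ((a - c * \<xi>) / c)" using assms by (simp add: field_simps)
    then show ?thesis by (simp only: abs_minus_cancel abs_divide)
  qed
  have 2: "c\<^sup>2 = \<bar>c\<bar> * \<bar>c\<bar>" by (simp add: power2_eq_square)
  have 3: "t / u < 1 / (L * (u * u)) \<longleftrightarrow> L * (u * t) < 1" if "u > 0" for t u :: real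
  proof -
    have "t / u < 1 / (L * (u * u)) \<longleftrightarrow> t / u * (L * (u * u)) < 1"
      using that assms(2) by (intro pos_less_divide_eq) simp
    also have "t / u * (L * (u * u)) = L * (u * t)" using that by simp
    finally show ?thesis .
  qed
  show ?thesis unfolding 1 2 by (rule 3) (use assms(1) in simp)
qed

lemma lagrange_value_eq:
  "lagrange_value \<xi> = (SUP L \<in> {L. L > 0 \<and> infinite (good_cusps \<xi> L)}. ereal L)"
proof -
  have "{p. \<exists>M \<in> \<Union>H4. M$2$1 \<noteq> 0 \<and> p = M$1$1 / M$2$1 \<and> \<bar>\<xi> - M$1$1 / M$2$1\<bar> < 1 / (L * (M$2$1)\<^sup>2)}
      = good_cusps \<xi> L" if "L > 0" for L
    unfolding good_cusps_def
    by (intro Collect_cong bex_cong refl conj_cong approximation_iff that)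
  then show ?thesis unfolding lagrange_value_def by (simp cong: conj_cong)
qed

lemma good_cusps_antimono: "L \<le> L' \<Longrightarrow> good_cusps \<xi> L' \<subseteq> good_cusps \<xi> L"
proof
  fix p assume L: "L \<le> L'" and "p \<in> good_cusps \<xi> L'"
  then obtain M where M: "M \<in> \<Union>H4" "M$2$1 \<noteq> 0" "p = M$1$1 / M$2$1"
    "L' * (\<bar>M$2$1\<bar> * \<bar>M$1$1 - M$2$1 * \<xi>\<bar>) < 1" unfolding good_cusps_def by blast
  have "L * (\<bar>M$2$1\<bar> * \<bar>M$1$1 - M$2$1 * \<xi>\<bar>) \<le> L' * (\<bar>M$2$1\<bar> * \<bar>M$1$1 - M$2$1 * \<xi>\<bar>)"
    using L by (intro mult_right_mono) auto
  then have "L * (\<bar>M$2$1\<bar> * \<bar>M$1$1 - M$2$1 * \<xi>\<bar>) < 1" using M(4) by (rule order.strict_trans1)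
  with M(1-3) show "p \<in> good_cusps \<xi> L" unfolding good_cusps_def by blast
qed

text \<open>
  The set of good cusps shrinks as \<open>L\<close> grows, so the Lagrange value is the threshold at which it
  becomes finite.
\<close>

lemma lagrange_value_finiteD:
  assumes "lagrange_value \<xi> = ereal l"
  shows "l > 0" "0 < L \<Longrightarrow> L < l \<Longrightarrow> infinite (good_cusps \<xi> L)" "L > l \<Longrightarrow> finite (good_cusps \<xi> L)"
proof -
  define S where "S = {L. L > 0 \<and> infinite (good_cusps \<xi> L)}"
  have l: "(SUP L\<in>S. ereal L) = ereal l" using assms unfolding lagrange_value_eq S_def .
  have "S \<noteq> {}" using l by (auto simp: bot_ereal_def)
  then obtain L0 where "L0 \<in> S" by blast
  moreover from this have "ereal L0 \<le> ereal l" unfolding l[symmetric] by (rule SUP_upper)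
  ultimately show pos: "l > 0" by (simp add: S_def)
  show "infinite (good_cusps \<xi> L)" if "0 < L" "L < l"
  proof -
    have "ereal L < (SUP L\<in>S. ereal L)" using l that by simp
    then obtain L' where "L' \<in> S" "L < L'" unfolding less_SUP_iff by auto
    then show ?thesis using good_cusps_antimono[of L L' \<xi>] finite_subset unfolding S_def by auto
  qed
  show "finite (good_cusps \<xi> L)" if "L > l"
  proof (rule ccontr)
    assume "infinite (good_cusps \<xi> L)"
    then have "L \<in> S" using that pos by (simp add: S_def)
    then have "ereal L \<le> ereal l" unfolding l[symmetric] by (rule SUP_upper)
    with that show False by simp
  qed
qed

text \<open>
  Infinitely many cusps are good for a constant just below \<open>l\<close>, but only finitely many are good for
  one just above \<open>l\<close> or have a lower entry of size at most \<open>n\<close>; so one of the former avoids the latter. A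
  translation on the right changes \<open>d\<close> only by multiples of \<open>sqrt 2 * c\<close> and keeps the cusp, so
  \<open>- d / c\<close>, the image of \<open>\<infinity>\<close> under the inverse, can be moved into one period.
\<close>

lemma exists_extremal_matrix:
  assumes \<xi>: "\<xi> \<notin> sqrt2_rats" and l: "lagrange_value \<xi> = ereal l"
  shows "\<exists>a b c d. mat2 a b c d \<in> \<Union>H4 \<and> real n < \<bar>c\<bar> \<and> - d / c \<in> {0..sqrt 2} \<and>
    l * (1 - inverse (Suc (Suc n))) \<le> 1 / (\<bar>c\<bar> * \<bar>a - c * \<xi>\<bar>) \<and> 1 / (\<bar>c\<bar> * \<bar>a - c * \<xi>\<bar>) \<le> l + inverse (Suc n)"
proof -
  note ld = lagrange_value_finiteD[OF l]
  define L1 where "L1 = l * (1 - inverse (Suc (Suc n)))"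
  define L2 where "L2 = l + inverse (Suc n)"
  have "l * (1 - inverse (Suc (Suc n))) < l * 1" using ld(1) by (intro mult_strict_left_mono) auto
  moreover have "0 < l * (1 - inverse (Suc (Suc n)))"
    using ld(1) by (intro mult_pos_pos) (simp_all add: field_simps)
  ultimately have L1: "0 < L1" "L1 < l" by (simp_all only: L1_def mult_1_right)
  have L2: "l < L2" by (simp add: L2_def)
  \<comment> \<open>A cusp that is good for \<open>L1\<close> and has \<open>\<bar>c\<bar> \<le> n\<close> lies in the finite set \<open>R\<close>.\<close>
  define B where "B = (real n + 1) * (\<bar>\<xi>\<bar> + 1 / L1 + 1)"
  define R where "R = {M$1$1 / M$2$1 | M. hecke4_entries M \<and> \<bar>M$1$1\<bar> \<le> B \<and> \<bar>M$2$1\<bar> \<le> B}"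
  have "infinite (good_cusps \<xi> L1 - good_cusps \<xi> L2 - R)"
    unfolding R_def using ld(2)[OF L1] ld(3)[OF L2] finite_cusps_bounded
    by (intro Diff_infinite_finite) auto
  then have "good_cusps \<xi> L1 - good_cusps \<xi> L2 - R \<noteq> {}" by (rule infinite_imp_nonempty)
  then obtain p where p: "p \<in> good_cusps \<xi> L1" "p \<notin> good_cusps \<xi> L2" "p \<notin> R" by blast
  then obtain M where M: "M \<in> \<Union>H4" "M$2$1 \<noteq> 0" "p = M$1$1 / M$2$1"
    "L1 * (\<bar>M$2$1\<bar> * \<bar>M$1$1 - M$2$1 * \<xi>\<bar>) < 1" unfolding good_cusps_def by blast
  define a b c d where "a = M$1$1" and "b = M$1$2" and "c = M$2$1" and "d = M$2$2"
  have Meq: "M = mat2 a b c d" using mat2_eta[of M] by (simp add: a_def b_def c_def d_def)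
  have ent: "hecke4_entries M" using M(1) by (rule H4_matrix_entries)
  have c: "c \<noteq> 0" "\<bar>c\<bar> \<ge> 1" using M(2) hecke4_lower_left_ge_1[OF ent] by (auto simp: c_def)
  have h: "\<not> L2 * (\<bar>c\<bar> * \<bar>a - c * \<xi>\<bar>) < 1" "L1 * (\<bar>c\<bar> * \<bar>a - c * \<xi>\<bar>) < 1"
    using p(2) M unfolding good_cusps_def a_def c_def by blast+
  have "a / c \<noteq> \<xi>" using \<xi> hecke4_cusp_in_sqrt2_rats[OF ent] by (auto simp: a_def c_def)
  then have nz: "a - c * \<xi> \<noteq> 0" using c by (simp add: field_simps)
  define h where "h = \<bar>c\<bar> * \<bar>a - c * \<xi>\<bar>"
  have hpos: "h > 0" using c nz by (simp add: h_def)
  have bounds: "L1 \<le> 1 / h" "1 / h \<le> L2"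
  proof -
    have "\<not> L2 * h < 1" "L1 * h < 1" unfolding h_def by (rule h)+
    then show "L1 \<le> 1 / h" "1 / h \<le> L2"
      using hpos by (simp_all add: pos_le_divide_eq pos_divide_le_eq)
  qed
  have big: "real n < \<bar>c\<bar>"
  proof (rule ccontr)
    assume "\<not> real n < \<bar>c\<bar>"
    then have cn: "\<bar>c\<bar> \<le> real n" by simp
    have "1 * \<bar>a - c * \<xi>\<bar> \<le> h" unfolding h_def using c by (intro mult_right_mono) auto
    also have "h \<le> 1 / L1" using h(2) L1 by (simp add: h_def field_simps)
    finally have "\<bar>a\<bar> \<le> 1 / L1 + \<bar>c\<bar> * \<bar>\<xi>\<bar>" by (simp add: abs_mult[symmetric])
    also have "\<dots> \<le> (real n + 1) * (1 / L1) + (real n + 1) * \<bar>\<xi>\<bar>"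
      using cn L1 by (intro add_mono mult_right_mono) (auto simp: field_simps)
    finally have "\<bar>a\<bar> \<le> B" by (simp add: B_def algebra_simps)
    moreover have "(real n + 1) * 1 \<le> B" unfolding B_def using L1 by (intro mult_left_mono) auto
    then have "\<bar>c\<bar> \<le> B" using cn by simp
    ultimately have "p \<in> R" unfolding R_def M(3) using ent by (auto simp: a_def c_def)
    with p(3) show False ..
  qed
  define k where "k = \<lfloor>(- d / c) / sqrt 2\<rfloor>"
  have k1: "of_int k \<le> (- d / c) / sqrt 2" "(- d / c) / sqrt 2 < of_int k + 1"
    unfolding k_def by linarith+
  have k: "sqrt 2 * of_int k \<le> - d / c" "- d / c \<le> sqrt 2 * (of_int k + 1)"
  proof -
    have "of_int k * sqrt 2 \<le> - d / c" by (rule pos_le_divide_eq[THEN iffD1, OF _ k1(1)]) simp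
    then show "sqrt 2 * of_int k \<le> - d / c" by (simp only: mult.commute)
    have "- d / c < (of_int k + 1) * sqrt 2" by (rule pos_divide_less_eq[THEN iffD1, OF _ k1(2)]) simp
    then show "- d / c \<le> sqrt 2 * (of_int k + 1)" by (simp only: mult.commute less_imp_le)
  qed
  have tr: "mat2 a b c d ** mat2 1 (sqrt 2 * of_int k) 0 1 = mat2 a (a * (sqrt 2 * of_int k) + b) c (c * (sqrt 2 * of_int k) + d)"
    by (simp add: mat2_mult)
  have "mat2 a (a * (sqrt 2 * of_int k) + b) c (c * (sqrt 2 * of_int k) + d) \<in> \<Union>H4"
    unfolding tr[symmetric] using M(1) H4_matrix_translation by (intro H4_matrix_mult) (auto simp only: Meq)
  moreover have "- (c * (sqrt 2 * of_int k) + d) / c = - d / c - sqrt 2 * of_int k"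
    using c by (simp add: field_simps)
  then have "- (c * (sqrt 2 * of_int k) + d) / c \<in> {0..sqrt 2}" using k by (simp add: algebra_simps)
  ultimately show ?thesis using big bounds unfolding L1_def L2_def h_def by blast
qed

text \<open>
  With \<open>x n\<close> and \<open>y n\<close> the images of \<open>\<xi>\<close> and \<open>\<infinity>\<close> under the inverses of the extremal matrices,
  \<open>\<bar>x n - y n\<bar>\<close> is the reciprocal of \<open>\<bar>c\<bar> * \<bar>a - c * \<xi>\<bar>\<close> and tends to \<open>l\<close>. A limit point
  \<open>(\<xi>', \<eta>')\<close> therefore has distance \<open>l\<close>. No group element \<open>N\<close> can increase this distance: the cusps
  \<open>M\<^sub>n N \<cdot> \<infinity>\<close> also converge to \<open>\<xi>\<close>, hence for each \<open>L > l\<close> they are eventually not good, and the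
  limit of this statement bounds the distance of the images of \<open>\<xi>'\<close> and \<open>\<eta>'\<close>.
\<close>

lemma lagrange_spectrum_subset_markoff_spectrum: "lagrange_spectrum \<subseteq> markoff_spectrum"
proof
  fix l assume "l \<in> lagrange_spectrum"
  then obtain \<xi> where \<xi>: "\<xi> \<notin> sqrt2_rats" and l: "lagrange_value \<xi> = ereal l"
    unfolding lagrange_spectrum_def by blast
  note ld = lagrange_value_finiteD[OF l]
  obtain a b c d where M: "\<And>n::nat. mat2 (a n) (b n) (c n) (d n) \<in> \<Union>H4"
    and cn: "\<And>n. real n < \<bar>c n\<bar>" and y0: "\<And>n. - d n / c n \<in> {0..sqrt 2}"
    and lo: "\<And>n. l * (1 - inverse (Suc (Suc n))) \<le> 1 / (\<bar>c n\<bar> * \<bar>a n - c n * \<xi>\<bar>)"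
    and up: "\<And>n. 1 / (\<bar>c n\<bar> * \<bar>a n - c n * \<xi>\<bar>) \<le> l + inverse (Suc n)"
    using exists_extremal_matrix[OF \<xi> l] by metis
  have det: "a n * d n - b n * c n = 1" for n
    using hecke4_entries_det[OF H4_matrix_entries[OF M[of n]]] by (simp add: det_mat2)
  have c0: "c n \<noteq> 0" for n using cn[of n] by auto
  have nz: "a n - c n * \<xi> \<noteq> 0" for n
    using \<xi> hecke4_cusp_in_sqrt2_rats[OF H4_matrix_entries[OF M[of n]]] c0[of n]
    by (auto simp: field_simps)
  define x where "x n = (d n * \<xi> - b n) / (a n - c n * \<xi>)" for n
  define y where "y n = - d n / c n" for n
  have "x n - y n = 1 / (c n * (a n - c n * \<xi>))" for n
  proof -
    have "x n - y n = (c n * (d n * \<xi> - b n) + d n * (a n - c n * \<xi>)) / (c n * (a n - c n * \<xi>))"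
      unfolding x_def y_def using c0[of n] nz[of n] by (simp add: field_simps)
    also have "c n * (d n * \<xi> - b n) + d n * (a n - c n * \<xi>) = 1"
      using det[of n] by (simp add: algebra_simps)
    finally show ?thesis .
  qed
  then have xy: "\<bar>x n - y n\<bar> = 1 / (\<bar>c n\<bar> * \<bar>a n - c n * \<xi>\<bar>)" for n
    by (simp add: abs_mult)
  have lim: "(\<lambda>n. \<bar>x n - y n\<bar>) \<longlonglongrightarrow> l"
  proof (rule tendsto_sandwich)
    have "(\<lambda>n. l * (1 - inverse (Suc (Suc n)))) \<longlonglongrightarrow> l * (1 - 0)"
      by (intro tendsto_intros LIMSEQ_Suc[OF LIMSEQ_inverse_real_of_nat])
    then show "(\<lambda>n. l * (1 - inverse (Suc (Suc n)))) \<longlonglongrightarrow> l" by simp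
    have "(\<lambda>n. l + inverse (Suc n)) \<longlonglongrightarrow> l + 0"
      by (intro tendsto_intros LIMSEQ_inverse_real_of_nat)
    then show "(\<lambda>n. l + inverse (Suc n)) \<longlonglongrightarrow> l" by simp
  qed (use lo up xy in auto)
  have "bounded (range (\<lambda>n. (x n, y n)))"
  proof -
    have d: "\<bar>x n - y n\<bar> \<le> l + 1" for n
      unfolding xy using up[of n] by (rule order_trans) (simp add: field_simps)
    have y': "\<bar>y n\<bar> \<le> sqrt 2" for n using y0[of n] by (auto simp: y_def)
    have "\<bar>x n\<bar> + \<bar>y n\<bar> \<le> l + 1 + 2 * sqrt 2" for n using d[of n] y'[of n] by linarith
    moreover have "norm (x n, y n) \<le> \<bar>x n\<bar> + \<bar>y n\<bar>" for n
      using norm_Pair_le[of "x n" "y n"] by simp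
    ultimately have "norm (x n, y n) \<le> l + 1 + 2 * sqrt 2" for n by (rule order_trans[rotated])
    then show ?thesis unfolding bounded_iff by blast
  qed
  then obtain z r where r: "strict_mono r" and z: "((\<lambda>n. (x n, y n)) \<circ> r) \<longlonglongrightarrow> z"
    using bounded_imp_convergent_subsequence by blast
  define \<xi>' \<eta>' where "\<xi>' = fst z" and "\<eta>' = snd z"
  have x: "(\<lambda>n. x (r n)) \<longlonglongrightarrow> \<xi>'" and y: "(\<lambda>n. y (r n)) \<longlonglongrightarrow> \<eta>'"
    using tendsto_fst[OF z] tendsto_snd[OF z] by (simp_all add: o_def \<xi>'_def \<eta>'_def)
  have limr: "(\<lambda>n. \<bar>x (r n) - y (r n)\<bar>) \<longlonglongrightarrow> l"
    using LIMSEQ_subseq_LIMSEQ[OF lim r] by (simp add: o_def)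
  have dist: "\<bar>\<xi>' - \<eta>'\<bar> = l"
    using LIMSEQ_unique[OF _ limr] tendsto_rabs[OF tendsto_diff[OF x y]] by blast
  have cr: "real n < \<bar>c (r n)\<bar>" for n
    using cn[of "r n"] seq_suble[OF r, of n] by linarith
  have small: "(\<lambda>n. \<bar>a (r n) - c (r n) * \<xi>\<bar>) \<longlonglongrightarrow> 0"
  proof -
    have "(\<lambda>n. 1 / \<bar>c (r n)\<bar>) \<longlonglongrightarrow> 0"
    proof (rule tendsto_sandwich[where f = "\<lambda>_. 0" and h = "\<lambda>n. 1 / real n"])
      show "\<forall>\<^sub>F n in sequentially. 1 / \<bar>c (r n)\<bar> \<le> 1 / real n"
        using eventually_gt_at_top[of 0]
      proof eventually_elim
        case (elim n)
        then have "0 < real n" by simp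
        with cr[of n] show ?case by (intro divide_left_mono mult_pos_pos) linarith+
      qed
      show "(\<lambda>n. 1 / real n) \<longlonglongrightarrow> 0" by (rule lim_1_over_n)
    qed auto
    then have "(\<lambda>n. (1 / \<bar>c (r n)\<bar>) / \<bar>x (r n) - y (r n)\<bar>) \<longlonglongrightarrow> 0 / l"
      using limr ld(1) by (intro tendsto_divide) auto
    moreover have "(1 / \<bar>c n\<bar>) / \<bar>x n - y n\<bar> = \<bar>a n - c n * \<xi>\<bar>" for n
      unfolding xy using c0[of n] nz[of n] by simp
    ultimately show ?thesis by simp
  qed
  \<comment> \<open>The inverse of \<open>N\<close> divides the distance of \<open>\<xi>'\<close> and \<open>\<eta>'\<close> by this product; in particular
    it does not move them to infinity.\<close>
  have key: "1 \<le> \<bar>p - q * \<xi>'\<bar> * \<bar>p - q * \<eta>'\<bar>" if N: "mat2 p u q v \<in> \<Union>H4" for p q u v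
  proof -
    have detN: "p * v - u * q = 1"
      using hecke4_entries_det[OF H4_matrix_entries[OF N]] by (simp add: det_mat2)
    define a' where "a' n = a (r n) * p + b (r n) * q" for n
    define c' where "c' n = c (r n) * p + d (r n) * q" for n
    define d' where "d' n = c (r n) * u + d (r n) * v" for n
    have MN: "mat2 (a' n) (a (r n) * u + b (r n) * v) (c' n) (d' n) \<in> \<Union>H4" for n
      using H4_matrix_mult[OF M[of "r n"] N] by (simp only: mat2_mult a'_def c'_def d'_def)
    have c': "c' n = c (r n) * (p - q * y (r n))" for n
      using c0[of "r n"] by (simp add: c'_def y_def field_simps)
    have a': "a' n - c' n * \<xi> = (a (r n) - c (r n) * \<xi>) * (p - q * x (r n))" for n
    proof -
      have x': "(a (r n) - c (r n) * \<xi>) * x (r n) = d (r n) * \<xi> - b (r n)"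
        using nz[of "r n"] by (simp add: x_def)
      have "a' n - c' n * \<xi> = (a (r n) - c (r n) * \<xi>) * p - q * (d (r n) * \<xi> - b (r n))"
        by (simp add: a'_def c'_def algebra_simps)
      also have "\<dots> = (a (r n) - c (r n) * \<xi>) * (p - q * x (r n))"
        unfolding x'[symmetric] by (simp add: algebra_simps)
      finally show ?thesis .
    qed
    have ent: "hecke4_entries (mat2 (a' n) (a (r n) * u + b (r n) * v) (c' n) (d' n))" for n
      using MN by (rule H4_matrix_entries)
    \<comment> \<open>Otherwise \<open>M\<^sub>n N\<close> would be a translation up to sign, and \<open>c (r n)\<close> would be as small as \<open>q\<close>.\<close>
    have c'1: "\<bar>c' n\<bar> \<ge> 1" if n: "\<bar>q\<bar> \<le> real n" for n
    proof -
      have "c' n \<noteq> 0"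
      proof
        assume z: "c' n = 0"
        then have "\<bar>d' n\<bar> = 1" using hecke4_lower_right_if_lower_left_0[OF ent[of n]] by simp
        moreover have "c (r n) * (p * v - u * q) = v * c' n - q * d' n"
          by (simp add: c'_def d'_def algebra_simps)
        then have "c (r n) = - (q * d' n)" unfolding detN z by simp
        ultimately have "\<bar>c (r n)\<bar> = \<bar>q\<bar>" by (simp add: abs_mult)
        with cr[of n] n show False by simp
      qed
      then show ?thesis using hecke4_lower_left_ge_1[OF ent[of n]] by simp
    qed
    have cusp_lim: "(\<lambda>n. \<bar>a' n - c' n * \<xi>\<bar>) \<longlonglongrightarrow> 0"
    proof -
      have "(\<lambda>n. \<bar>a (r n) - c (r n) * \<xi>\<bar> * \<bar>p - q * x (r n)\<bar>) \<longlonglongrightarrow> 0 * \<bar>p - q * \<xi>'\<bar>"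
        using small x by (intro tendsto_intros)
      then show ?thesis by (simp add: a' abs_mult)
    qed
    have ineq: "l \<le> L * (\<bar>p - q * \<xi>'\<bar> * \<bar>p - q * \<eta>'\<bar>)" if L: "L > l" for L
    proof -
      have fin: "finite (good_cusps \<xi> L)" using ld(3)[OF L] .
      have "\<xi> \<notin> good_cusps \<xi> L"
        using \<xi> hecke4_cusp_in_sqrt2_rats H4_matrix_entries unfolding good_cusps_def by blast
      then obtain \<delta> where \<delta>: "\<delta> > 0" "\<And>t. t \<in> good_cusps \<xi> L \<Longrightarrow> \<delta> \<le> dist \<xi> t"
        using finite_set_avoid[OF fin, of \<xi>] by metis
      have "\<forall>\<^sub>F n in sequentially. \<bar>a' n - c' n * \<xi>\<bar> < \<delta>"
        using order_tendstoD(2)[OF cusp_lim \<delta>(1)] .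
      then have "\<forall>\<^sub>F n in sequentially. \<bar>x (r n) - y (r n)\<bar> \<le> L * (\<bar>p - q * x (r n)\<bar> * \<bar>p - q * y (r n)\<bar>)"
        using eventually_ge_at_top[of "nat \<lceil>\<bar>q\<bar>\<rceil>"]
      proof eventually_elim
        case (elim n)
        have cge: "\<bar>c' n\<bar> \<ge> 1" by (rule c'1) (use elim(2) in linarith)
        have "a' n / c' n \<notin> good_cusps \<xi> L"
        proof
          assume "a' n / c' n \<in> good_cusps \<xi> L"
          then have "\<delta> \<le> \<bar>\<xi> - a' n / c' n\<bar>" using \<delta>(2) by (simp add: dist_real_def)
          also have "\<xi> - a' n / c' n = - ((a' n - c' n * \<xi>) / c' n)" using cge by (auto simp: field_simps)
          also have "\<bar>\<dots>\<bar> \<le> \<bar>a' n - c' n * \<xi>\<bar> / 1"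
            unfolding abs_minus_cancel abs_divide using cge by (intro divide_left_mono) auto
          finally show False using elim(1) by simp
        qed
        then have "\<not> L * (\<bar>c' n\<bar> * \<bar>a' n - c' n * \<xi>\<bar>) < 1"
          using MN[of n] cge unfolding good_cusps_def by fastforce
        then have "1 \<le> L * (\<bar>p - q * x (r n)\<bar> * \<bar>p - q * y (r n)\<bar>) * (\<bar>c (r n)\<bar> * \<bar>a (r n) - c (r n) * \<xi>\<bar>)"
          unfolding a' unfolding c' abs_mult by (simp add: mult_ac)
        moreover have "0 < \<bar>c (r n)\<bar> * \<bar>a (r n) - c (r n) * \<xi>\<bar>" using c0[of "r n"] nz[of "r n"] by simp
        ultimately show ?case unfolding xy by (simp only: divide_le_eq) simp
      qed
      moreover have "(\<lambda>n. L * (\<bar>p - q * x (r n)\<bar> * \<bar>p - q * y (r n)\<bar>)) \<longlonglongrightarrow> L * (\<bar>p - q * \<xi>'\<bar> * \<bar>p - q * \<eta>'\<bar>)"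
        using x y by (intro tendsto_intros)
      ultimately show ?thesis using limr by (intro tendsto_le[OF sequentially_bot]) auto
    qed
    have "l \<le> l * (\<bar>p - q * \<xi>'\<bar> * \<bar>p - q * \<eta>'\<bar>)"
    proof (rule tendsto_lowerbound)
      show "((\<lambda>L. L * (\<bar>p - q * \<xi>'\<bar> * \<bar>p - q * \<eta>'\<bar>)) \<longlongrightarrow> l * (\<bar>p - q * \<xi>'\<bar> * \<bar>p - q * \<eta>'\<bar>)) (at_right l)"
        by (intro tendsto_intros)
      show "\<forall>\<^sub>F L in at_right l. l \<le> L * (\<bar>p - q * \<xi>'\<bar> * \<bar>p - q * \<eta>'\<bar>)"
        using eventually_at_right_less[of l] by eventually_elim (rule ineq)
    qed simp
    then show ?thesis using ld(1) by simp
  qed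
  have le: "rhat_dist (moebius (matrix_inv N) (Fin \<xi>')) (moebius (matrix_inv N) (Fin \<eta>')) \<le> ereal l"
    if N: "N \<in> \<Union>H4" for N
  proof -
    define p u q v where "p = N$1$1" and "u = N$1$2" and "q = N$2$1" and "v = N$2$2"
    have Neq: "N = mat2 p u q v" using mat2_eta[of N] by (simp add: p_def u_def q_def v_def)
    have detN: "p * v - u * q = 1"
      using hecke4_entries_det[OF H4_matrix_entries[OF N]] by (simp add: Neq det_mat2)
    have k: "1 \<le> \<bar>p - q * \<xi>'\<bar> * \<bar>p - q * \<eta>'\<bar>" using key N unfolding Neq .
    then have "p - q * \<xi>' \<noteq> 0" "p - q * \<eta>' \<noteq> 0" by auto
    from moebius_diff[OF detN this] show ?thesis
      unfolding Neq matrix_inv_mat2[OF detN] dist using k ld(1)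
      by (simp add: divide_le_eq mult_le_cancel_left1)
  qed
  have "markoff_value (Fin \<xi>') (Fin \<eta>') = ereal l"
  proof (rule antisym)
    show "markoff_value (Fin \<xi>') (Fin \<eta>') \<le> ereal l"
      unfolding markoff_value_def by (rule SUP_least) (rule le)
    have "ereal l = rhat_dist (moebius (matrix_inv (mat2 1 0 0 1)) (Fin \<xi>')) (moebius (matrix_inv (mat2 1 0 0 1)) (Fin \<eta>'))"
      by (subst (1 2) matrix_inv_mat2) (simp_all add: dist)
    also have "\<dots> \<le> markoff_value (Fin \<xi>') (Fin \<eta>')"
      unfolding markoff_value_def by (rule SUP_upper[OF H4_matrix_one])
    finally show "ereal l \<le> markoff_value (Fin \<xi>') (Fin \<eta>')" .
  qed
  moreover have "Fin \<xi>' \<noteq> Fin \<eta>'" using dist ld(1) by auto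
  ultimately show "l \<in> markoff_spectrum" unfolding markoff_spectrum_def by blast
qed


section \<open>Continued fractions and best approximations\<close>

text \<open>
  Here \<open>x n = [0; a n, a (n + 1), \<dots>]\<close>. The tails are given together with the digits and are
  characterised by their recursion.
\<close>

locale continued_fraction =
  fixes a :: "nat \<Rightarrow> nat" and x :: "nat \<Rightarrow> real"
  assumes digit_pos: "\<And>n. a n \<ge> 1"
    and tail: "\<And>n. 0 < x n" "\<And>n. x n < 1"
    and tail_rec: "\<And>n. x n * (a n + x (Suc n)) = 1"
begin

text \<open>
  The index is shifted by one: \<open>cp 0 / cq 0 = 1 / 0\<close>, and \<open>cp (n + 1) / cq (n + 1)\<close> is the
  convergent made of the digits \<open>a 0, \<dots>, a (n - 1)\<close>.
\<close>

fun cq :: "nat \<Rightarrow> int" where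
  "cq 0 = 0"
| "cq (Suc 0) = 1"
| "cq (Suc (Suc n)) = int (a n) * cq (Suc n) + cq n"

fun cp :: "nat \<Rightarrow> int" where
  "cp 0 = 1"
| "cp (Suc 0) = 0"
| "cp (Suc (Suc n)) = int (a n) * cp (Suc n) + cp n"

definition err :: "nat \<Rightarrow> real" where
  "err n = of_int (cq n) * x 0 - of_int (cp n)"

text \<open>
  This is \<open>[0; a (n - 1), \<dots>, a 0]\<close>, the digits read backwards.
\<close>

definition backward :: "nat \<Rightarrow> real" where
  "backward n = of_int (cq n) / of_int (cq (Suc n))"

lemma cq_nonneg: "cq n \<ge> 0"
  by (induction n rule: cq.induct) auto

lemma cq_Suc_mono: "cq n \<le> cq (Suc (Suc n))" "cq (Suc n) \<le> cq (Suc (Suc n))"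
proof -
  have "1 * cq (Suc n) \<le> int (a n) * cq (Suc n)"
    using digit_pos[of n] cq_nonneg by (intro mult_right_mono) auto
  then show "cq (Suc n) \<le> cq (Suc (Suc n))" using cq_nonneg[of n] by simp
  show "cq n \<le> cq (Suc (Suc n))" using cq_nonneg[of "Suc n"] by simp
qed

lemma cq_Suc_pos: "cq (Suc n) \<ge> 1"
proof (induction n)
  case (Suc n)
  then show ?case using cq_Suc_mono(2)[of n] by linarith
qed simp

lemma cq_Suc_ge: "cq (Suc n) \<ge> int n"
proof (induction n)
  case (Suc n)
  show ?case
  proof (cases n)
    case 0
    then show ?thesis using cq_Suc_pos[of "Suc 0"] by simp
  next
    case (Suc m)
    have "1 * cq (Suc n) \<le> int (a n) * cq (Suc n)"
      using digit_pos[of n] cq_nonneg by (intro mult_right_mono) auto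
    moreover have "cq (Suc (Suc n)) = int (a n) * cq (Suc n) + cq (Suc m)" by (simp only: cq.simps Suc)
    ultimately show ?thesis using Suc.IH cq_Suc_pos[of m] by simp
  qed
qed simp

lemma cp_cq_det: "cp n * cq (Suc n) - cp (Suc n) * cq n = (-1) ^ n"
proof (induction n)
  case (Suc n)
  have "cp (Suc n) * cq (Suc (Suc n)) - cp (Suc (Suc n)) * cq (Suc n)
      = - (cp n * cq (Suc n) - cp (Suc n) * cq n)"
    by (simp add: algebra_simps)
  with Suc show ?case by simp
qed simp

lemma coprime_cp_cq: "coprime (cp n) (cq n)"
proof (rule coprimeI)
  fix d assume "d dvd cp n" "d dvd cq n"
  then have "d dvd cp n * cq (Suc n) - cp (Suc n) * cq n" by simp
  then have "d dvd (-1) ^ n" unfolding cp_cq_det .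
  then show "is_unit d" by (rule dvd_trans) (simp add: is_unit_power_iff)
qed

lemma err_rec: "err (Suc (Suc n)) = a n * err (Suc n) + err n"
  by (simp add: err_def algebra_simps)

lemma err_Suc: "err (Suc n) = - x n * err n"
proof (induction n)
  case 0
  then show ?case by (simp add: err_def)
next
  case (Suc n)
  have xn: "x n * (a n + x (Suc n)) = 1" by (rule tail_rec)
  have "err n = - (x n * (a n + x (Suc n))) * - err n" unfolding xn by simp
  also have "\<dots> = - (a n + x (Suc n)) * err (Suc n)" unfolding Suc by (simp add: algebra_simps)
  finally show ?case unfolding err_rec by (simp add: algebra_simps)
qed

lemma err_nonzero: "err n \<noteq> 0"
proof (induction n)
  case (Suc n)
  then show ?case unfolding err_Suc using tail(1)[of n] by simp
qed (simp add: err_def)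

text \<open>
  The determinant of two consecutive convergents, expressed by their errors, which alternate in sign.
\<close>

lemma err_cq_sum: "\<bar>err n\<bar> * (cq (Suc n) + x n * cq n) = 1"
proof -
  have "err n * cq (Suc n) - err (Suc n) * cq n = - of_int (cp n * cq (Suc n) - cp (Suc n) * cq n)"
    by (simp add: err_def algebra_simps)
  then have "err n * (cq (Suc n) + x n * cq n) = - ((-1) ^ n)"
    unfolding cp_cq_det err_Suc by (simp add: algebra_simps)
  then have "\<bar>err n * (cq (Suc n) + x n * cq n)\<bar> = 1" by (simp add: power_abs)
  moreover have "0 \<le> cq (Suc n) + x n * cq n"
    using cq_nonneg[of n] cq_nonneg[of "Suc n"] tail(1)[of n] by simp
  ultimately show ?thesis by (simp add: abs_mult)
qed

lemma backward_0: "backward 0 = 0"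
  by (simp add: backward_def)

lemma backward_Suc: "backward (Suc n) = 1 / (a n + backward n)"
proof -
  have pos: "real_of_int (cq (Suc n)) > 0" using cq_Suc_pos[of n] by simp
  have "(a n + backward n) * cq (Suc n) = cq (Suc (Suc n))"
    unfolding backward_def using pos by (simp add: field_simps)
  then show ?thesis unfolding backward_def[of "Suc n"]
    using pos by (metis divide_divide_eq_left' div_self less_irrefl mult.commute)
qed

lemma backward_bounds: "0 \<le> backward n" "backward n \<le> 1"
proof -
  show "0 \<le> backward n" unfolding backward_def using cq_nonneg by simp
  have "cq n \<le> cq (Suc n)"
    by (cases n) (use cq_Suc_mono in auto)
  then show "backward n \<le> 1" unfolding backward_def using cq_Suc_pos[of n] by (simp add: divide_le_eq)
qed

text \<open>
  The quality \<open>1 / (q * \<bar>q * x 0 - p\<bar>)\<close> of a convergent is the next digit plus the continued fractions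
  to both sides of that digit.
\<close>

lemma convergent_quality:
  "(cq (Suc n) * \<bar>err (Suc n)\<bar>) * (a n + x (Suc n) + backward n) = 1"
proof -
  have pos: "real_of_int (cq (Suc n)) > 0" using cq_Suc_pos[of n] by simp
  have "(cq (Suc n) * \<bar>err (Suc n)\<bar>) * (a n + x (Suc n) + backward n)
      = \<bar>err n\<bar> * (x n * (a n + x (Suc n)) * cq (Suc n) + x n * (cq (Suc n) * backward n))"
    unfolding err_Suc abs_mult using tail(1)[of n] by (simp add: algebra_simps)
  also have "cq (Suc n) * backward n = cq n" unfolding backward_def using pos by simp
  also have "\<bar>err n\<bar> * (x n * (a n + x (Suc n)) * cq (Suc n) + x n * cq n) = 1"
    unfolding tail_rec using err_cq_sum[of n] by simp
  finally show ?thesis .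
qed

text \<open>
  Legendre's criterion. Write \<open>(p, q)\<close> as an integral combination of the two consecutive convergents
  whose denominators enclose \<open>q\<close>. If the second one took part, then the coefficients would have
  opposite signs, as have the errors, so that the errors could not cancel and \<open>p / q\<close> would be no
  better than the first convergent. But then the two fractions would be closer to each other than
  distinct fractions with these denominators can be.
\<close>

lemma good_approximation_is_convergent:
  fixes p q :: int
  assumes "q > 0" "coprime p q" and good: "q * \<bar>q * x 0 - p\<bar> < 1 / 2"
  shows "\<exists>n. p = cp (Suc n) \<and> q = cq (Suc n)"
proof -
  define S where "S = {n. cq (Suc n) \<le> q}"
  have "S \<subseteq> {..nat q}"
  proof
    fix m assume "m \<in> S"
    then have "int m \<le> q" using cq_Suc_ge[of m] by (simp add: S_def)
    then show "m \<in> {..nat q}" by simp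
  qed
  then have fin: "finite S" by (rule finite_subset) simp
  have "0 \<in> S" using assms(1) by (simp add: S_def)
  define n where "n = Max S"
  have "n \<in> S" unfolding n_def by (rule Max_in[OF fin]) (use \<open>0 \<in> S\<close> in blast)
  then have n1: "cq (Suc n) \<le> q" by (simp add: S_def)
  have n2: "q < cq (Suc (Suc n))"
  proof (rule ccontr)
    assume "\<not> q < cq (Suc (Suc n))"
    then have "Suc n \<in> S" by (simp add: S_def)
    then have "Suc n \<le> n" unfolding n_def by (rule Max_ge[OF fin])
    then show False by simp
  qed
  define P Q P' Q' where "P = cp (Suc n)" and "Q = cq (Suc n)" and "P' = cp (Suc (Suc n))" and "Q' = cq (Suc (Suc n))"
  define s where "s = P * Q' - P' * Q"
  have s: "s * s = 1"
    unfolding s_def P_def Q_def P'_def Q'_def cp_cq_det by (simp flip: power_mult_distrib)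
  \<comment> \<open>Cramer's rule; the determinant \<open>s\<close> is its own inverse.\<close>
  define u v where "u = s * (p * Q' - P' * q)" and "v = s * (P * q - p * Q)"
  have pu: "p = u * P + v * P'" and qu: "q = u * Q + v * Q'"
  proof -
    have "u * P + v * P' = s * s * p" "u * Q + v * Q' = s * s * q"
      unfolding u_def v_def s_def by (simp_all add: algebra_simps)
    then show "p = u * P + v * P'" "q = u * Q + v * Q'" using s by simp_all
  qed
  have Qpos: "Q \<ge> 1" unfolding Q_def by (rule cq_Suc_pos)
  have Q': "Q' > q" "Q \<le> q" using n1 n2 by (simp_all add: Q_def Q'_def)
  define E where "E = q * x 0 - p"
  have E: "E = u * err (Suc n) + v * err (Suc (Suc n))"
    unfolding E_def pu qu err_def P_def Q_def P'_def Q'_def by (simp add: algebra_simps)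
  have "v = 0"
  proof (rule ccontr)
    assume v: "v \<noteq> 0"
    have opp: "u * v < 0"
    proof (cases "v > 0")
      case True
      then have "1 * Q' \<le> v * Q'" using Q' assms(1) by (intro mult_right_mono) auto
      then have "u * Q < 0" using qu Q' by linarith
      then have "u < 0" using Qpos by (simp add: mult_less_0_iff)
      then show ?thesis using True by (simp add: mult_neg_pos)
    next
      case False
      with v have "v < 0" by simp
      then have "v * Q' < 0" using Q' assms(1) by (simp add: mult_neg_pos)
      then have "u * Q > 0" using qu assms(1) by linarith
      then have "u > 0" using Qpos by (simp add: zero_less_mult_iff)
      then show ?thesis using \<open>v < 0\<close> by (simp add: mult_pos_neg)
    qed
    have "\<bar>err (Suc n)\<bar> \<le> \<bar>E\<bar>"
    proof -
      have "E = (u - v * x (Suc n)) * err (Suc n)"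
        unfolding E err_Suc[of "Suc n"] by (simp add: algebra_simps)
      moreover have "1 \<le> \<bar>u - v * x (Suc n)\<bar>"
      proof (cases "u > 0")
        case True
        then have "v < 0" using opp by (simp add: mult_less_0_iff)
        then have "real_of_int v * x (Suc n) \<le> 0" using tail(1)[of "Suc n"] by (simp add: mult_nonpos_nonneg)
        moreover have "1 \<le> real_of_int u" using True by simp
        ultimately show ?thesis by linarith
      next
        case False
        then have "u < 0" "v > 0" using opp by (auto simp: mult_less_0_iff)
        then have "real_of_int v * x (Suc n) \<ge> 0" using tail(1)[of "Suc n"] by simp
        moreover have "real_of_int u \<le> -1" using \<open>u < 0\<close> by simp
        ultimately show ?thesis by linarith
      qed
      then have "1 * \<bar>err (Suc n)\<bar> \<le> \<bar>u - v * x (Suc n)\<bar> * \<bar>err (Suc n)\<bar>"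
        by (intro mult_right_mono) auto
      ultimately show ?thesis by (simp add: abs_mult)
    qed
    moreover have "P * q - p * Q \<noteq> 0" using v by (auto simp: v_def)
    then have "1 \<le> \<bar>P * q - p * Q\<bar>" by linarith
    then have "1 \<le> real_of_int \<bar>P * q - p * Q\<bar>" by linarith
    moreover have "real_of_int (P * q - p * Q) = Q * E - q * err (Suc n)"
      unfolding E_def err_def P_def Q_def by (simp add: algebra_simps)
    then have "real_of_int \<bar>P * q - p * Q\<bar> = \<bar>Q * E - q * err (Suc n)\<bar>" by simp
    moreover have "\<bar>Q * E - q * err (Suc n)\<bar> \<le> Q * \<bar>E\<bar> + q * \<bar>err (Suc n)\<bar>"
    proof -
      have "\<bar>Q * E - q * err (Suc n)\<bar> \<le> \<bar>Q * E\<bar> + \<bar>q * err (Suc n)\<bar>" by (rule abs_triangle_ineq4)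
      then show ?thesis using Qpos assms(1) by (simp add: abs_mult)
    qed
    moreover have "Q * \<bar>E\<bar> \<le> q * \<bar>E\<bar>" using Q' by (intro mult_right_mono) auto
    moreover have "q * \<bar>err (Suc n)\<bar> \<le> q * \<bar>E\<bar>"
      using calculation(1) assms(1) by (intro mult_left_mono) auto
    ultimately have "1 \<le> q * \<bar>E\<bar> + q * \<bar>E\<bar>" by linarith
    then show False using good by (simp add: E_def)
  qed
  then have *: "p = u * P" "q = u * Q" using pu qu by simp_all
  then have "u dvd 1" using assms(2) by (intro coprime_common_divisor[of p q]) simp_all
  moreover have "u > 0" using *(2) assms(1) Qpos by (simp add: zero_less_mult_iff)
  ultimately have "u = 1" by simp
  with * show ?thesis unfolding P_def Q_def by (intro exI[of _ n]) simp
qed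

text \<open>
  For a rational number with denominator \<open>q\<close>, all errors would be multiples of \<open>1 / q\<close>, but they are
  nonzero and tend to 0.
\<close>

lemma tail_irrational: "x 0 \<notin> \<rat>"
proof
  assume "x 0 \<in> \<rat>"
  then obtain p q :: int where q: "q > 0" and x0: "x 0 = of_int p / of_int q"
    by (metis Rats_cases')
  define n where "n = nat q"
  define N where "N = cq (Suc n) * p - cp (Suc n) * q"
  have N: "real_of_int N = q * err (Suc n)" unfolding N_def err_def x0 using q by (simp add: field_simps)
  then have "N \<noteq> 0" using err_nonzero[of "Suc n"] q by auto
  then have "1 \<le> \<bar>real_of_int N\<bar>" by linarith
  then have A: "1 \<le> q * \<bar>err (Suc n)\<bar>" unfolding N using q by (simp add: abs_mult)
  have le: "real_of_int q \<le> cq (Suc n)" using cq_Suc_ge[of n] q by (simp add: n_def)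
  have "a n + x (Suc n) + backward n > 1"
    using digit_pos[of n] tail(1)[of "Suc n"] backward_bounds(1)[of n] by linarith
  moreover have pos: "0 < cq (Suc n) * \<bar>err (Suc n)\<bar>" using cq_Suc_pos[of n] err_nonzero[of "Suc n"] by simp
  ultimately have "cq (Suc n) * \<bar>err (Suc n)\<bar> * 1 < 1"
    using convergent_quality[of n] by (metis mult_strict_left_mono)
  moreover have "q * \<bar>err (Suc n)\<bar> \<le> cq (Suc n) * \<bar>err (Suc n)\<bar>" using le by (intro mult_right_mono) auto
  ultimately show False using A by simp
qed

section \<open>Lagrange values from continued fractions\<close>

text \<open>
  The factor accounts for the denominator \<open>c\<close> of the cusp \<open>sqrt 2 * p / q\<close>: \<open>c\<^sup>2\<close> is \<open>q\<^sup>2 / 2\<close> for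
  even \<open>q\<close> and \<open>q\<^sup>2\<close> for odd \<open>q\<close>.
\<close>

definition weight :: "nat \<Rightarrow> real" where
  "weight n = (if even (cq (Suc n)) then 1 else 1 / 2) * (a n + x (Suc n) + backward n)"

definition cusp :: "nat \<Rightarrow> real" where
  "cusp n = sqrt 2 * (of_int (cp (Suc n)) / of_int (cq (Suc n)))"

text \<open>
  Equal cusps come from equal reduced fractions, hence from equal errors, but the errors decrease
  strictly in size.
\<close>

lemma inj_cusp: "inj cusp"
proof -
  have inc: "cp (Suc m) = cp (Suc n) \<and> cq (Suc m) = cq (Suc n)" if "cusp m = cusp n" for m n
  proof -
    have pos: "cq (Suc m) > 0" "cq (Suc n) > 0" using cq_Suc_pos[of m] cq_Suc_pos[of n] by simp_all
    have "real_of_int (cp (Suc m)) / cq (Suc m) = real_of_int (cp (Suc n)) / cq (Suc n)"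
      using that unfolding cusp_def by (simp only: mult_cancel_left) simp
    then have "real_of_int (cp (Suc m) * cq (Suc n)) = real_of_int (cp (Suc n) * cq (Suc m))"
      using pos by (simp add: field_simps)
    then have eq: "cp (Suc m) * cq (Suc n) = cp (Suc n) * cq (Suc m)" by linarith
    then have d1: "cq (Suc m) dvd cp (Suc m) * cq (Suc n)" by simp
    have d2: "cq (Suc n) dvd cp (Suc n) * cq (Suc m)" unfolding eq[symmetric] by simp
    have "coprime (cq (Suc m)) (cp (Suc m))" "coprime (cq (Suc n)) (cp (Suc n))"
      using coprime_cp_cq coprime_commute by blast+
    then have "cq (Suc m) dvd cq (Suc n)" "cq (Suc n) dvd cq (Suc m)"
      using d1 d2 by (simp_all add: coprime_dvd_mult_right_iff)
    then have "cq (Suc m) = cq (Suc n)" using pos by (simp add: zdvd_antisym_nonneg)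
    with eq pos show ?thesis by simp
  qed
  have dec: "\<bar>err (Suc n)\<bar> < \<bar>err n\<bar>" for n
    unfolding err_Suc abs_mult using tail[of n] err_nonzero[of n] by simp
  then have mono: "strict_mono (\<lambda>n. - \<bar>err n\<bar>)" by (intro strict_mono_Suc_iff[THEN iffD2]) simp
  have "m = n" if "err (Suc m) = err (Suc n)" for m n
    using strict_mono_eq[OF mono, of "Suc m" "Suc n"] that by simp
  moreover have "err (Suc m) = err (Suc n)" if "cusp m = cusp n" for m n
    using inc[OF that] by (simp only: err_def)
  ultimately show ?thesis by (intro injI) blast
qed

text \<open>
  For even \<open>q = 2 * s\<close> the cusp has the column \<open>(p, sqrt 2 * s)\<close>, for odd \<open>q\<close> the column
  \<open>(sqrt 2 * p, q)\<close>.
\<close>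

lemma cusp_in_good_cusps:
  assumes L: "L > 0" and w: "L / sqrt 2 < weight n"
  shows "cusp n \<in> good_cusps (sqrt 2 * x 0) L"
proof -
  define p q where "p = cp (Suc n)" and "q = cq (Suc n)"
  define l where "l = a n + x (Suc n) + backward n"
  have q: "q > 0" using cq_Suc_pos[of n] by (simp add: q_def)
  have cop: "coprime p q" using coprime_cp_cq by (simp add: p_def q_def)
  have lam: "(q * \<bar>q * x 0 - p\<bar>) * l = 1"
    using convergent_quality[of n] by (simp add: err_def p_def q_def l_def)
  have lpos: "l > 0" using digit_pos[of n] tail(1)[of "Suc n"] backward_bounds(1)[of n] by (simp add: l_def)
  have qv: "q * \<bar>q * x 0 - p\<bar> = 1 / l" using lam lpos by (simp add: field_simps)
  have qv': "\<bar>p - q * x 0\<bar> = \<bar>q * x 0 - p\<bar>" by simp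
  have s2: "sqrt 2 * sqrt 2 = (2::real)" by simp
  show ?thesis
  proof (cases "even q")
    case True
    then obtain s where s: "q = 2 * s" by (elim evenE)
    have "cusp_column p (sqrt 2 * s)" using cop s by (intro cusp_columns) simp
    then obtain M where M: "M \<in> \<Union>H4" "M$1$1 = p" "M$2$1 = sqrt 2 * s" unfolding cusp_column_def by blast
    have "\<bar>M$2$1\<bar> * \<bar>M$1$1 - M$2$1 * (sqrt 2 * x 0)\<bar> = sqrt 2 * s * \<bar>p - q * x 0\<bar>"
    proof -
      have "sqrt 2 * s * (sqrt 2 * x 0) = q * x 0" unfolding s by (simp add: mult_ac sqrt2_mult_sqrt2)
      then show ?thesis unfolding M(2,3) using q s by (simp only: abs_mult) simp
    qed
    also have "\<dots> = sqrt 2 / 2 * (q * \<bar>q * x 0 - p\<bar>)" unfolding qv' by (simp add: s)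
    finally have v: "\<bar>M$2$1\<bar> * \<bar>M$1$1 - M$2$1 * (sqrt 2 * x 0)\<bar> = sqrt 2 / 2 * (1 / l)" unfolding qv .
    have "L / sqrt 2 < l" using w True by (simp add: weight_def q_def l_def)
    then have "L / sqrt 2 / l < 1" using lpos by (simp only: divide_less_eq_1_pos)
    moreover have "L * (sqrt 2 / 2 * (1 / l)) = L / sqrt 2 / l"
    proof -
      have half: "sqrt 2 / 2 = 1 / sqrt (2::real)" by (rule frac_eq_eq[THEN iffD2]) simp_all
      show ?thesis unfolding half by simp
    qed
    ultimately have "L * (sqrt 2 / 2 * (1 / l)) < 1" by simp
    then have "L * (\<bar>M$2$1\<bar> * \<bar>M$1$1 - M$2$1 * (sqrt 2 * x 0)\<bar>) < 1" unfolding v .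
    moreover have "cusp n = M$1$1 / M$2$1"
      proof -
      have "cusp n = (sqrt 2 * p) / (sqrt 2 * (sqrt 2 * s))"
        unfolding cusp_def p_def[symmetric] q_def[symmetric] s sqrt2_mult_sqrt2 by simp
      also have "\<dots> = p / (sqrt 2 * s)" by (rule mult_divide_mult_cancel_left) simp
      finally show ?thesis unfolding M(2,3) .
    qed
    moreover have "M$2$1 \<noteq> 0" unfolding M(3) using q s by simp
    ultimately show ?thesis
      unfolding good_cusps_def by (intro CollectI bexI[OF _ M(1)] conjI)
  next
    case False
    have "cusp_column (sqrt 2 * p) q" using cop False by (intro cusp_columns) simp
    then obtain M where M: "M \<in> \<Union>H4" "M$1$1 = sqrt 2 * p" "M$2$1 = q" unfolding cusp_column_def by blast
    have "sqrt 2 * p - q * (sqrt 2 * x 0) = sqrt 2 * (p - q * x 0)" by (simp add: algebra_simps)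
    then have "\<bar>M$2$1\<bar> * \<bar>M$1$1 - M$2$1 * (sqrt 2 * x 0)\<bar> = q * (sqrt 2 * \<bar>p - q * x 0\<bar>)"
      unfolding M(2,3) using q by (simp add: abs_mult)
    also have "\<dots> = sqrt 2 * (q * \<bar>q * x 0 - p\<bar>)" unfolding qv' by simp
    finally have v: "\<bar>M$2$1\<bar> * \<bar>M$1$1 - M$2$1 * (sqrt 2 * x 0)\<bar> = sqrt 2 * (1 / l)" unfolding qv .
    have "L / sqrt 2 < l / 2" using w False by (simp add: weight_def q_def l_def)
    moreover have "L * (2 / sqrt 2) = 2 * (L / sqrt 2)" by simp
    ultimately have "L * (2 / sqrt 2) < l" by linarith
    then have "L * (2 / sqrt 2) / l < 1" using lpos by (simp only: divide_less_eq_1_pos)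
    moreover have "2 / sqrt 2 = sqrt (2::real)" by (rule real_div_sqrt) simp
    ultimately have "L * (sqrt 2 * (1 / l)) < 1" by simp
    then have "L * (\<bar>M$2$1\<bar> * \<bar>M$1$1 - M$2$1 * (sqrt 2 * x 0)\<bar>) < 1" unfolding v .
    moreover have "cusp n = M$1$1 / M$2$1"
      unfolding M(2,3) cusp_def p_def[symmetric] q_def[symmetric] by simp
    moreover have "M$2$1 \<noteq> 0" unfolding M(3) using q by simp
    ultimately show ?thesis
      unfolding good_cusps_def by (intro CollectI bexI[OF _ M(1)] conjI)
  qed
qed

text \<open>
  For \<open>L > 2 * sqrt 2\<close> the cusp condition is stronger than Legendre's criterion: it says
  \<open>q * \<bar>q * x 0 - p\<bar> < sqrt 2 / L\<close> for even \<open>q\<close>, and half of that for odd \<open>q\<close>.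
\<close>

lemma good_cusps_subset:
  assumes L: "L / sqrt 2 > 2"
  shows "good_cusps (sqrt 2 * x 0) L \<subseteq> cusp ` {n. L / sqrt 2 < weight n}"
proof
  fix t assume "t \<in> good_cusps (sqrt 2 * x 0) L"
  then obtain M0 where M0: "M0 \<in> \<Union>H4" "M0$2$1 \<noteq> 0" "t = M0$1$1 / M0$2$1"
    "L * (\<bar>M0$2$1\<bar> * \<bar>M0$1$1 - M0$2$1 * (sqrt 2 * x 0)\<bar>) < 1" unfolding good_cusps_def by blast
  \<comment> \<open>The sign is chosen such that the denominator of the approximation is positive.\<close>
  define M where "M = (if M0$2$1 > 0 then M0 else - M0)"
  have M: "M \<in> \<Union>H4" "M$2$1 > 0" "t = M$1$1 / M$2$1"
    using M0(1-3) H4_matrix_minus[OF M0(1)] by (simp_all add: M_def del: Union_iff)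
  have "\<bar>M$2$1\<bar> * \<bar>M$1$1 - M$2$1 * (sqrt 2 * x 0)\<bar> = \<bar>M0$2$1\<bar> * \<bar>M0$1$1 - M0$2$1 * (sqrt 2 * x 0)\<bar>"
    by (simp add: M_def abs_if)
  then have q0: "L * (M$2$1 * \<bar>M$1$1 - M$2$1 * (sqrt 2 * x 0)\<bar>) < 1" using M0(4) M(2) by simp
  have Lpos: "L > 2 * sqrt 2" using L by (simp add: pos_less_divide_eq)
  have convergent: "\<exists>n. p = cp (Suc n) \<and> q = cq (Suc n) \<and> B < a n + x (Suc n) + backward n"
    if pq: "q > 0" "coprime p q" and B: "B \<ge> 2" and small: "B * (q * \<bar>q * x 0 - p\<bar>) < 1" for p q :: int and B
  proof -
    have "2 * (q * \<bar>q * x 0 - p\<bar>) \<le> B * (q * \<bar>q * x 0 - p\<bar>)"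
      using pq(1) B by (intro mult_right_mono) auto
    then have "q * \<bar>q * x 0 - p\<bar> < 1 / 2" using small by simp
    then obtain n where n: "p = cp (Suc n)" "q = cq (Suc n)"
      using good_approximation_is_convergent[OF pq] by blast
    define l where "l = a n + x (Suc n) + backward n"
    have "q * \<bar>q * x 0 - p\<bar> * l = 1"
      using convergent_quality[of n] by (simp add: err_def n l_def)
    then have l: "l * (q * \<bar>q * x 0 - p\<bar>) = 1" by (simp only: mult.commute)
    then have "B * (q * \<bar>q * x 0 - p\<bar>) < l * (q * \<bar>q * x 0 - p\<bar>)" using small by simp
    moreover have "0 \<le> q * \<bar>q * x 0 - p\<bar>" using pq(1) by simp
    ultimately have "B < l" by (rule mult_right_less_imp_less)
    with n show ?thesis unfolding l_def by blast
  qed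
  from M(1) have "hecke4_entries M" by (rule H4_matrix_entries)
  then show "t \<in> cusp ` {n. L / sqrt 2 < weight n}"
  proof (cases rule: hecke4_entriesE)
    case (diag p b c d)
    have c: "c > 0" using M(2) unfolding diag(1) by (simp add: zero_less_mult_iff)
    have "coprime p (2 * c)"
    proof (rule coprimeI)
      fix e assume "e dvd p" "e dvd 2 * c"
      then have "e dvd p * d - b * (2 * c)" by simp
      then show "is_unit e" using diag(2) by (simp add: mult_ac)
    qed
    moreover have "L / sqrt 2 * (of_int (2 * c) * \<bar>of_int (2 * c) * x 0 - p\<bar>) < 1"
    proof -
      have e: "sqrt 2 * c * (sqrt 2 * x 0) = of_int (2 * c) * x 0" by (simp add: mult_ac sqrt2_mult_sqrt2)
      have "L * (sqrt 2 * c * \<bar>p - of_int (2 * c) * x 0\<bar>) < 1"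
        using q0 unfolding diag(1) mat2_nth e .
      moreover have "L / sqrt 2 * (of_int (2 * c) * z) = L * (sqrt 2 * c * z)" for z :: real
      proof -
        have "L / sqrt 2 * (of_int (2 * c) * z) = L * (2 / sqrt 2) * (c * z)" by simp
        also have "2 / sqrt 2 = sqrt 2" by (rule real_div_sqrt) simp
        finally show ?thesis by simp
      qed
      ultimately show ?thesis by (simp only: abs_minus_commute)
    qed
    ultimately obtain n where n: "p = cp (Suc n)" "2 * c = cq (Suc n)" "L / sqrt 2 < a n + x (Suc n) + backward n"
      using convergent[of "2 * c" p "L / sqrt 2"] c L by auto
    have "even (cq (Suc n))" unfolding n(2)[symmetric] by simp
    then have "L / sqrt 2 < weight n" using n(3) by (simp add: weight_def)
    moreover have "t = cusp n"
    proof -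
      have "cusp n = (sqrt 2 * p) / (sqrt 2 * (sqrt 2 * c))"
        unfolding cusp_def n(1,2)[symmetric] sqrt2_mult_sqrt2 by simp
      also have "\<dots> = p / (sqrt 2 * c)" by (rule mult_divide_mult_cancel_left) simp
      finally show ?thesis unfolding M(3) diag(1) by simp
    qed
    ultimately show ?thesis by blast
  next
    case (off p b c d)
    have c: "c > 0" using M(2) unfolding off(1) by simp
    have "coprime p c"
    proof (rule coprimeI)
      fix e assume "e dvd p" "e dvd c"
      then have "e dvd 2 * d * p - b * c" by simp
      then show "is_unit e" using off(2) by (simp add: mult_ac)
    qed
    moreover have "odd c"
    proof
      assume "even c"
      then have "even (2 * p * d - b * c)" by simp
      then show False unfolding off(2) by simp
    qed
    moreover have "sqrt 2 * L * (of_int c * \<bar>of_int c * x 0 - p\<bar>) < 1"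
    proof -
      have "sqrt 2 * p - c * (sqrt 2 * x 0) = sqrt 2 * (p - c * x 0)" by (simp add: algebra_simps)
      then have "L * (c * (sqrt 2 * \<bar>p - c * x 0\<bar>)) < 1"
        using q0 unfolding off(1) mat2_nth by (simp add: abs_mult)
      then show ?thesis by (simp add: mult_ac abs_minus_commute)
    qed
    moreover have "2 \<le> sqrt 2 * L"
    proof -
      have "sqrt 2 * (2 * sqrt 2) \<le> sqrt 2 * L" using Lpos by (intro mult_left_mono) auto
      moreover have "sqrt 2 * (2 * sqrt 2) = (4::real)" by simp
      ultimately show ?thesis by linarith
    qed
    ultimately obtain n where n: "p = cp (Suc n)" "c = cq (Suc n)" "sqrt 2 * L < a n + x (Suc n) + backward n"
      and odd: "odd c" using convergent[of c p "sqrt 2 * L"] c by blast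
    have "odd (cq (Suc n))" using odd n(2) by simp
    moreover have "L / sqrt 2 = sqrt 2 * L / 2"
      using real_div_sqrt[of 2] by (simp add: field_simps)
    ultimately have "L / sqrt 2 < weight n" using n(3) by (simp add: weight_def)
    moreover have "t = cusp n"
      unfolding M(3) off(1) cusp_def n(1,2)[symmetric] by simp
    ultimately show ?thesis by blast
  qed
qed

text \<open>
  The hypotheses \<open>up\<close> and \<open>lo\<close> say that \<open>V\<close> is the upper limit of the weights; because of
  \<open>V \<ge> 2\<close>, cusps that are not convergents do not affect the Lagrange value.
\<close>

lemma lagrange_value_eq_limsup:
  assumes V: "V \<ge> 2"
    and up: "\<And>W. V < W \<Longrightarrow> finite {n. W < weight n}"
    and lo: "\<And>W. W < V \<Longrightarrow> infinite {n. W < weight n}"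
  shows "lagrange_value (sqrt 2 * x 0) = ereal (sqrt 2 * V)"
proof -
  define S where "S = {L. L > 0 \<and> infinite (good_cusps (sqrt 2 * x 0) L)}"
  have in_S: "L \<in> S" if L: "0 < L" "L < sqrt 2 * V" for L
  proof -
    have "L / sqrt 2 < V" using L by (simp add: pos_divide_less_eq mult.commute)
    then have "infinite (cusp ` {n. L / sqrt 2 < weight n})"
      using lo inj_cusp by (simp add: finite_image_iff inj_on_subset)
    moreover have "cusp ` {n. L / sqrt 2 < weight n} \<subseteq> good_cusps (sqrt 2 * x 0) L"
      using cusp_in_good_cusps[OF L(1)] by blast
    ultimately show ?thesis using L(1) finite_subset unfolding S_def by blast
  qed
  have S_le: "L \<le> sqrt 2 * V" if "L \<in> S" for L
  proof (rule ccontr)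
    assume "\<not> L \<le> sqrt 2 * V"
    then have L: "L / sqrt 2 > V" by (simp add: pos_less_divide_eq mult.commute)
    then have "finite (good_cusps (sqrt 2 * x 0) L)"
      using good_cusps_subset[of L] up[OF L] V finite_subset by (meson finite_imageI le_less_trans)
    then show False using that by (simp add: S_def)
  qed
  have "(SUP L\<in>S. ereal L) = ereal (sqrt 2 * V)"
  proof (rule antisym)
    show "(SUP L\<in>S. ereal L) \<le> ereal (sqrt 2 * V)" by (rule SUP_least) (simp add: S_le)
    show "ereal (sqrt 2 * V) \<le> (SUP L\<in>S. ereal L)"
    proof (rule dense_le)
      fix y assume y: "y < ereal (sqrt 2 * V)"
      have "1 * 2 < sqrt 2 * V" using V by (intro mult_less_le_imp_less) auto
      show "y \<le> (SUP L\<in>S. ereal L)"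
      proof (cases y)
        case (real r)
        have "max r 1 \<in> S" using y real \<open>1 * 2 < sqrt 2 * V\<close> by (intro in_S) auto
        then have "ereal (max r 1) \<le> (SUP L\<in>S. ereal L)" by (rule SUP_upper)
        then show ?thesis using real by (intro order_trans[OF _ \<open>ereal (max r 1) \<le> _\<close>]) simp
      qed (use y in auto)
    qed
  qed
  then show ?thesis unfolding lagrange_value_eq S_def .
qed

lemma sqrt2_tail_notin_sqrt2_rats: "sqrt 2 * x 0 \<notin> sqrt2_rats"
  using tail_irrational unfolding sqrt2_rats_def by auto

end


section \<open>Digit blocks as contractions\<close>

text \<open>
  The functions below act on continued fractions by prepending digits: \<open>step2\<close> prepends the digit 2,
  \<open>pair2\<close> two digits 2, and \<open>enter_right\<close> the digits 1, 1, 3. The number \<open>fixpt\<close> is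
  \<open>[0; 2, 2, 2, \<dots>]\<close>.
  
  The function \<open>enter_left\<close> serves the fractions that are read backwards. If such a fraction is
  \<open>1 - y\<close> in front of a digit 3, then it is \<open>1 / (4 - y)\<close> after this digit. After an even number of
  digits 2 and the digits 1, 1 it has again the form \<open>1 - y'\<close>, and because of
  \<open>1 / (1 + 1 / (1 + z)) = 1 - step2 z\<close> the new \<open>y'\<close> arises from \<open>step2 (1 / (4 - y)) = enter_left y\<close> by
  powers of \<open>pair2\<close>.
\<close>

definition fixpt :: real where "fixpt = sqrt 2 - 1"
definition step2 :: "real \<Rightarrow> real" where "step2 x = 1 / (2 + x)"
definition pair2 :: "real \<Rightarrow> real" where "pair2 x = (2 + x) / (5 + 2 * x)"
definition enter_right :: "real \<Rightarrow> real" where "enter_right x = (4 + x) / (7 + 2 * x)"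
definition enter_left :: "real \<Rightarrow> real" where "enter_left y = (4 - y) / (9 - 2 * y)"

lemma fixpt_bounds: "2 / 5 < fixpt" "fixpt < 3 / 7"
proof -
  have "7 / 5 < sqrt (2::real)" by (rule real_less_rsqrt) (simp add: power2_eq_square)
  then show "2 / 5 < fixpt" by (simp add: fixpt_def)
  have "sqrt 2 < 10 / (7::real)" by (rule real_less_lsqrt) (simp_all add: power2_eq_square)
  then show "fixpt < 3 / 7" by (simp add: fixpt_def)
qed

lemma fixpt_square: "fixpt * fixpt = 1 - 2 * fixpt"
  by (simp add: fixpt_def algebra_simps)

lemma pair2_fixpt: "pair2 fixpt = fixpt"
proof -
  have "fixpt * (5 + 2 * fixpt) = 2 + fixpt" using fixpt_square by (simp add: algebra_simps)
  then show ?thesis unfolding pair2_def using fixpt_bounds by (simp add: divide_eq_eq)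
qed

lemma step2_step2: "x \<ge> 0 \<Longrightarrow> step2 (step2 x) = pair2 x"
  by (simp add: step2_def pair2_def field_simps)

lemma step2_unit: "0 < x \<Longrightarrow> x < 1 \<Longrightarrow> 0 < step2 x \<and> step2 x < 1"
  by (simp add: step2_def)

lemma step2_power_unit: "0 < x \<Longrightarrow> x < 1 \<Longrightarrow> 0 < (step2 ^^ n) x \<and> (step2 ^^ n) x < 1"
  by (induction n) (use step2_unit in auto)

lemma pair2_unit: "0 \<le> x \<Longrightarrow> x \<le> 1 \<Longrightarrow> 0 \<le> pair2 x \<and> pair2 x \<le> 1"
  by (simp add: pair2_def divide_le_eq)

lemma pair2_power_unit: "0 \<le> x \<Longrightarrow> x \<le> 1 \<Longrightarrow> 0 \<le> (pair2 ^^ n) x \<and> (pair2 ^^ n) x \<le> 1"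
  by (induction n) (use pair2_unit in auto)

lemma step2_power_even: "0 \<le> x \<Longrightarrow> x \<le> 1 \<Longrightarrow> (step2 ^^ (2 * n)) x = (pair2 ^^ n) x"
proof (induction n)
  case (Suc n)
  have "(step2 ^^ (2 * Suc n)) x = step2 (step2 ((step2 ^^ (2 * n)) x))" by simp
  also have "\<dots> = pair2 ((pair2 ^^ n) x)"
    unfolding Suc.IH[OF Suc.prems] using pair2_power_unit[OF Suc.prems] by (intro step2_step2) simp
  finally show ?case by simp
qed simp

lemma enter_right_bounds: "0 \<le> x \<Longrightarrow> x \<le> 1 \<Longrightarrow> 5 / 9 \<le> enter_right x \<and> enter_right x \<le> 4 / 7"
  by (simp add: enter_right_def divide_simps)

lemma enter_left_bounds: "0 \<le> y \<Longrightarrow> y \<le> 1 \<Longrightarrow> 3 / 7 \<le> enter_left y \<and> enter_left y \<le> 4 / 9"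
  by (simp add: enter_left_def divide_simps)

lemma pair2_diff:
  assumes "0 \<le> x" "0 \<le> y"
  shows "pair2 x - pair2 y = (x - y) / ((5 + 2 * x) * (5 + 2 * y))"
  unfolding pair2_def using assms by (subst diff_frac_eq) (simp_all add: algebra_simps)

lemma enter_right_diff:
  assumes "0 \<le> x" "0 \<le> y"
  shows "enter_right x - enter_right y = (y - x) / ((7 + 2 * x) * (7 + 2 * y))"
  unfolding enter_right_def using assms by (subst diff_frac_eq) (simp_all add: algebra_simps)

lemma enter_left_diff:
  assumes "x \<le> 1" "y \<le> 1"
  shows "enter_left x - enter_left y = (y - x) / ((9 - 2 * x) * (9 - 2 * y))"
  unfolding enter_left_def using assms by (subst diff_frac_eq) (simp_all add: algebra_simps)

lemma le_of_le_divide: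
  fixes s t c :: real
  assumes "t \<le> s / c" "0 \<le> s" "1 \<le> c"
  shows "t \<le> s"
proof -
  have "s / c \<le> s / 1" using assms(2,3) by (intro divide_left_mono) auto
  with assms(1) show ?thesis by simp
qed

lemma fraction_between:
  fixes d m M :: real
  assumes "0 < m" "m \<le> D" "D \<le> M"
  shows "\<bar>d\<bar> / M \<le> \<bar>d / D\<bar>" "\<bar>d / D\<bar> \<le> \<bar>d\<bar> / m"
  using assms by (auto simp: abs_divide intro!: divide_left_mono mult_pos_pos)

lemma pair2_lipschitz:
  assumes "0 \<le> x" "x \<le> 1" "0 \<le> y" "y \<le> 1"
  shows "\<bar>pair2 x - pair2 y\<bar> \<le> \<bar>x - y\<bar> / 25" "\<bar>x - y\<bar> / 49 \<le> \<bar>pair2 x - pair2 y\<bar>"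
proof -
  have "5 * 5 \<le> (5 + 2 * x) * (5 + 2 * y)" "(5 + 2 * x) * (5 + 2 * y) \<le> 7 * 7"
    using assms by (intro mult_mono; simp)+
  then show "\<bar>pair2 x - pair2 y\<bar> \<le> \<bar>x - y\<bar> / 25" "\<bar>x - y\<bar> / 49 \<le> \<bar>pair2 x - pair2 y\<bar>"
    unfolding pair2_diff[OF assms(1,3)] by (intro fraction_between; simp)+
qed

lemma enter_right_lipschitz:
  assumes "0 \<le> x" "x \<le> 1" "0 \<le> y" "y \<le> 1"
  shows "\<bar>enter_right x - enter_right y\<bar> \<le> \<bar>x - y\<bar> / 49" "\<bar>x - y\<bar> / 81 \<le> \<bar>enter_right x - enter_right y\<bar>"
proof -
  have "7 * 7 \<le> (7 + 2 * x) * (7 + 2 * y)" "(7 + 2 * x) * (7 + 2 * y) \<le> 9 * 9"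
    using assms by (intro mult_mono; simp)+
  then show "\<bar>enter_right x - enter_right y\<bar> \<le> \<bar>x - y\<bar> / 49" "\<bar>x - y\<bar> / 81 \<le> \<bar>enter_right x - enter_right y\<bar>"
    unfolding enter_right_diff[OF assms(1,3)] abs_minus_commute[of x y] by (intro fraction_between; simp)+
qed

lemma enter_left_lipschitz:
  assumes "0 \<le> x" "x \<le> 1" "0 \<le> y" "y \<le> 1"
  shows "\<bar>enter_left x - enter_left y\<bar> \<le> \<bar>x - y\<bar>"
proof -
  have "7 * 7 \<le> (9 - 2 * x) * (9 - 2 * y)" "(9 - 2 * x) * (9 - 2 * y) \<le> 9 * 9"
    using assms by (intro mult_mono; simp)+
  then have "\<bar>enter_left x - enter_left y\<bar> \<le> \<bar>x - y\<bar> / 49"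
    unfolding enter_left_diff[OF assms(2,4)] abs_minus_commute[of x y]
    by (intro fraction_between(2)[where M = 81]) simp_all
  then show ?thesis by (rule le_of_le_divide) simp_all
qed

lemma pair2_power_lipschitz:
  assumes "0 \<le> x" "x \<le> 1" "0 \<le> y" "y \<le> 1"
  shows "\<bar>(pair2 ^^ n) x - (pair2 ^^ n) y\<bar> \<le> \<bar>x - y\<bar> * (1 / 25) ^ n"
    and "\<bar>x - y\<bar> * (1 / 49) ^ n \<le> \<bar>(pair2 ^^ n) x - (pair2 ^^ n) y\<bar>"
proof (induction n)
  case (Suc n)
  note u = pair2_power_unit[OF assms(1,2), of n] pair2_power_unit[OF assms(3,4), of n]
  note l = pair2_lipschitz[of "(pair2 ^^ n) x" "(pair2 ^^ n) y"]
  { case 1 show ?case using Suc(1) l(1) u by simp }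
  { case 2 show ?case using Suc(2) l(2) u by simp }
qed simp_all

lemma pair2_power_contract:
  assumes "0 \<le> x" "x \<le> 1" "0 \<le> y" "y \<le> 1"
  shows "\<bar>(pair2 ^^ n) x - (pair2 ^^ n) y\<bar> \<le> \<bar>x - y\<bar>"
proof -
  have "\<bar>x - y\<bar> * (1 / 25) ^ n \<le> \<bar>x - y\<bar> * 1" by (intro mult_left_mono power_le_one) auto
  with pair2_power_lipschitz(1)[OF assms, of n] show ?thesis by (simp only: mult_1_right)
qed

lemma pair2_strict_mono: "0 \<le> x \<Longrightarrow> x < y \<Longrightarrow> pair2 x < pair2 y"
proof -
  assume xy: "0 \<le> x" "x < y"
  then have "0 < (y - x) / ((5 + 2 * y) * (5 + 2 * x))" by (intro divide_pos_pos mult_pos_pos) auto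
  also have "\<dots> = pair2 y - pair2 x" by (rule pair2_diff[symmetric]) (use xy in auto)
  finally show ?thesis by simp
qed

lemma pair2_power_strict_mono: "0 \<le> x \<Longrightarrow> x < y \<Longrightarrow> y \<le> 1 \<Longrightarrow> (pair2 ^^ n) x < (pair2 ^^ n) y"
proof (induction n)
  case (Suc n)
  then show ?case using pair2_strict_mono pair2_power_unit[of x n] by simp
qed simp

lemma pair2_power_mono: "0 \<le> x \<Longrightarrow> x \<le> y \<Longrightarrow> y \<le> 1 \<Longrightarrow> (pair2 ^^ n) x \<le> (pair2 ^^ n) y"
  using pair2_power_strict_mono[of x y n] by (cases "x = y") auto

lemma pair2_power_fixpt: "(pair2 ^^ n) fixpt = fixpt"
  by (induction n) (simp_all add: pair2_fixpt)

lemma pair2_power_gt_fixpt: "fixpt < x \<Longrightarrow> x \<le> 1 \<Longrightarrow> fixpt < (pair2 ^^ n) x"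
  using pair2_power_strict_mono[of fixpt x n] fixpt_bounds by (simp add: pair2_power_fixpt)

lemma pair2_power_le_power_1:
  assumes "0 \<le> x" "x \<le> 1" "m \<le> n"
  shows "(pair2 ^^ n) x \<le> (pair2 ^^ m) 1"
proof -
  have "(pair2 ^^ n) x = (pair2 ^^ m) ((pair2 ^^ (n - m)) x)"
    using assms(3) by (simp flip: funpow_add comp_apply[of "pair2 ^^ m"])
  also have "\<dots> \<le> (pair2 ^^ m) 1" using pair2_power_unit[OF assms(1,2)] by (intro pair2_power_mono) auto
  finally show ?thesis .
qed

lemma pair2_power_1_tendsto: "(\<lambda>n. (pair2 ^^ n) 1) \<longlonglongrightarrow> fixpt"
proof (rule LIMSEQ_I)
  fix r :: real assume "r > 0"
  then obtain N where N: "(1 / 25) ^ N < r" using real_arch_pow_inv[of r "1 / 25"] by auto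
  have "norm ((pair2 ^^ n) 1 - fixpt) < r" if "n \<ge> N" for n
  proof -
    have "\<bar>(pair2 ^^ n) 1 - (pair2 ^^ n) fixpt\<bar> \<le> \<bar>1 - fixpt\<bar> * (1 / 25) ^ n"
      using fixpt_bounds by (intro pair2_power_lipschitz) auto
    also have "\<dots> \<le> 1 * (1 / 25) ^ n" using fixpt_bounds by (intro mult_right_mono) auto
    also have "\<dots> \<le> (1 / 25) ^ N" using power_decreasing[OF that, of "1 / 25 :: real"] by simp
    finally show ?thesis using N by (simp add: pair2_power_fixpt)
  qed
  then show "\<exists>no. \<forall>n\<ge>no. norm ((pair2 ^^ n) 1 - fixpt) < r" by blast
qed

section \<open>Tails of block sequences\<close>

text \<open>
  Prepends \<open>2 * n\<close> digits 2 and then, further inside, the digits 1, 1, 3.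
\<close>

definition block :: "nat \<Rightarrow> real \<Rightarrow> real" where
  "block n x = (pair2 ^^ n) (enter_right x)"

lemma block_unit: "0 \<le> x \<Longrightarrow> x \<le> 1 \<Longrightarrow> 0 \<le> block n x \<and> block n x \<le> 1"
  unfolding block_def using enter_right_bounds[of x] by (intro pair2_power_unit) auto

lemma block_gt_fixpt: "0 \<le> x \<Longrightarrow> x \<le> 1 \<Longrightarrow> fixpt < block n x"
  unfolding block_def using enter_right_bounds[of x] fixpt_bounds by (intro pair2_power_gt_fixpt) auto

lemma block_contract:
  assumes "0 \<le> x" "x \<le> 1" "0 \<le> y" "y \<le> 1"
  shows "\<bar>block n x - block n y\<bar> \<le> \<bar>x - y\<bar> / 2"
proof -
  have "\<bar>block n x - block n y\<bar> \<le> \<bar>enter_right x - enter_right y\<bar>"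
    unfolding block_def using enter_right_bounds[of x] enter_right_bounds[of y] assms
    by (intro pair2_power_contract) auto
  also have "\<dots> \<le> \<bar>x - y\<bar> / 49" by (rule enter_right_lipschitz(1)[OF assms])
  also have "\<dots> \<le> \<bar>x - y\<bar> / 2" by (intro divide_left_mono) auto
  finally show ?thesis .
qed

lemma block_expand:
  assumes "0 \<le> x" "x \<le> 1" "0 \<le> y" "y \<le> 1"
  shows "\<bar>x - y\<bar> * ((1 / 49) ^ n / 81) \<le> \<bar>block n x - block n y\<bar>"
proof -
  have "\<bar>x - y\<bar> / 81 * (1 / 49) ^ n \<le> \<bar>enter_right x - enter_right y\<bar> * (1 / 49) ^ n"
    by (intro mult_right_mono enter_right_lipschitz(2)[OF assms]) simp
  also have "\<dots> \<le> \<bar>block n x - block n y\<bar>"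
    unfolding block_def using enter_right_bounds[of x] enter_right_bounds[of y] assms
    by (intro pair2_power_lipschitz) auto
  finally show ?thesis by simp
qed

fun finite_tail :: "(nat \<Rightarrow> nat) \<Rightarrow> nat \<Rightarrow> real" where
  "finite_tail e 0 = 0"
| "finite_tail e (Suc n) = block (e 0) (finite_tail (\<lambda>i. e (Suc i)) n)"

text \<open>
  The infinite composition of the contractions \<open>block (e 0), block (e 1), \<dots>\<close>.
\<close>

definition tail_of :: "(nat \<Rightarrow> nat) \<Rightarrow> real" where
  "tail_of e = lim (finite_tail e)"

lemma finite_tail_unit: "0 \<le> finite_tail e n \<and> finite_tail e n \<le> 1"
  by (induction e n rule: finite_tail.induct) (use block_unit in auto)

lemma finite_tail_close: "N \<le> m \<Longrightarrow> N \<le> n \<Longrightarrow> \<bar>finite_tail e m - finite_tail e n\<bar> \<le> (1 / 2) ^ N"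
proof (induction N arbitrary: e m n)
  case 0
  have "\<bar>finite_tail e m - finite_tail e n\<bar> \<le> 1"
    using finite_tail_unit[of e m] finite_tail_unit[of e n] by linarith
  then show ?case by simp
next
  case (Suc N)
  obtain m' n' where mn: "m = Suc m'" "n = Suc n'" "N \<le> m'" "N \<le> n'"
    using Suc.prems by (metis Suc_le_D Suc_le_mono)
  let ?e = "\<lambda>i. e (Suc i)"
  have "\<bar>finite_tail e m - finite_tail e n\<bar> \<le> \<bar>finite_tail ?e m' - finite_tail ?e n'\<bar> / 2"
    unfolding mn finite_tail.simps using finite_tail_unit by (intro block_contract) auto
  also have "\<dots> \<le> (1 / 2) ^ N / 2" using Suc.IH[OF mn(3,4), of ?e] by simp
  finally show ?case by simp
qed

lemma finite_tail_tendsto: "finite_tail e \<longlonglongrightarrow> tail_of e"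
proof -
  have "Cauchy (finite_tail e)"
  proof (rule CauchyI)
    fix r :: real assume "r > 0"
    then obtain N where N: "(1 / 2) ^ N < r" using real_arch_pow_inv[of r "1 / 2"] by auto
    then show "\<exists>M. \<forall>m\<ge>M. \<forall>n\<ge>M. norm (finite_tail e m - finite_tail e n) < r"
      using finite_tail_close[of N] by (intro exI[of _ N]) (auto intro: le_less_trans)
  qed
  then show ?thesis unfolding tail_of_def by (simp add: Cauchy_convergent_iff convergent_LIMSEQ_iff)
qed

lemma tail_of_unit: "0 \<le> tail_of e" "tail_of e \<le> 1"
  using finite_tail_unit[of e]
  by (auto intro!: LIMSEQ_le_const[OF finite_tail_tendsto] LIMSEQ_le_const2[OF finite_tail_tendsto])

text \<open>
  The recursion of the finite compositions passes to the limit because a block is a contraction.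
\<close>

lemma tail_of_rec: "tail_of e = block (e 0) (tail_of (\<lambda>i. e (Suc i)))"
proof (rule LIMSEQ_unique)
  show "(\<lambda>n. finite_tail e (Suc n)) \<longlonglongrightarrow> tail_of e"
    using finite_tail_tendsto by (rule LIMSEQ_Suc)
  let ?e = "\<lambda>i. e (Suc i)"
  have "(\<lambda>n. finite_tail ?e n - tail_of ?e) \<longlonglongrightarrow> 0"
    using finite_tail_tendsto[of ?e] by (simp add: LIM_zero_iff)
  then have "(\<lambda>n. block (e 0) (finite_tail ?e n) - block (e 0) (tail_of ?e)) \<longlonglongrightarrow> 0"
  proof (rule Lim_null_comparison[rotated, OF tendsto_rabs_zero], intro always_eventually allI)
    fix n
    show "norm (block (e 0) (finite_tail ?e n) - block (e 0) (tail_of ?e)) \<le> \<bar>finite_tail ?e n - tail_of ?e\<bar>"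
      unfolding real_norm_def using finite_tail_unit[of ?e n] tail_of_unit[of ?e]
      by (intro le_of_le_divide[OF block_contract]) auto
  qed
  then show "(\<lambda>n. finite_tail e (Suc n)) \<longlonglongrightarrow> block (e 0) (tail_of ?e)"
    by (simp add: LIM_zero_iff)
qed

lemma tail_of_gt_fixpt: "fixpt < tail_of e"
  by (subst tail_of_rec) (intro block_gt_fixpt tail_of_unit)

lemma tail_of_close: "(\<And>i. i < n \<Longrightarrow> e i = e' i) \<Longrightarrow> \<bar>tail_of e - tail_of e'\<bar> \<le> (1 / 2) ^ n"
proof (induction n arbitrary: e e')
  case 0
  have "\<bar>tail_of e - tail_of e'\<bar> \<le> 1"
    using tail_of_unit[of e] tail_of_unit[of e'] by linarith
  then show ?case by simp
next
  case (Suc n)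
  let ?e = "\<lambda>i. e (Suc i)" and ?e' = "\<lambda>i. e' (Suc i)"
  have "\<bar>tail_of e - tail_of e'\<bar> = \<bar>block (e 0) (tail_of ?e) - block (e 0) (tail_of ?e')\<bar>"
    using tail_of_rec[of e] tail_of_rec[of e'] Suc.prems[of 0] by simp
  also have "\<dots> \<le> \<bar>tail_of ?e - tail_of ?e'\<bar> / 2"
    by (intro block_contract tail_of_unit)
  also have "\<dots> \<le> (1 / 2) ^ n / 2" using Suc.IH[of ?e ?e'] Suc.prems by simp
  finally show ?case by simp
qed

section \<open>Concatenating blocks\<close>

text \<open>
  The walk through consecutive segments of lengths \<open>len 0, len 1, \<dots>\<close>: after \<open>n\<close> steps it is at
  place \<open>j\<close> of segment \<open>i\<close> if \<open>position len n = (i, j)\<close>.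
\<close>

fun position :: "(nat \<Rightarrow> nat) \<Rightarrow> nat \<Rightarrow> nat \<times> nat" where
  "position len 0 = (0, 0)"
| "position len (Suc n) = (case position len n of (i, j) \<Rightarrow> if Suc j < len i then (i, Suc j) else (Suc i, 0))"

lemma position_Suc:
  "position len n = (i, j) \<Longrightarrow> position len (Suc n) = (if Suc j < len i then (i, Suc j) else (Suc i, 0))"
  by simp

lemma position_bound:
  assumes "\<And>i. len i > 0" "position len n = (i, j)"
  shows "j < len i"
  using assms(2)
proof (induction n arbitrary: i j)
  case 0
  then show ?case using assms(1) by auto
next
  case (Suc n)
  then show ?case using assms(1) by (auto split: prod.splits if_splits)
qed

lemma position_block:
  assumes "position len n = (i, 0)" "j < len i"
  shows "position len (n + j) = (i, j)"
  using assms(2) by (induction j) (auto simp: assms(1))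

lemma position_start:
  assumes "\<And>i. len i > 0"
  shows "\<exists>n. position len n = (i, 0)"
proof (induction i)
  case 0
  then show ?case by (intro exI[of _ 0]) simp
next
  case (Suc i)
  then obtain n where "position len n = (i, 0)" by blast
  then have "position len (n + (len i - 1)) = (i, len i - 1)"
    using assms[of i] by (intro position_block) auto
  then have "position len (Suc (n + (len i - 1))) = (Suc i, 0)"
    using assms[of i] position_Suc by fastforce
  then show ?case by blast
qed

lemma position_mono: "m \<le> n \<Longrightarrow> fst (position len m) \<le> fst (position len n)"
  by (induction n rule: dec_induct) (auto split: prod.splits)

lemma position_fst_le: "fst (position len n) \<le> n"
  by (induction n) (auto split: prod.splits)

lemma position_eventually:
  assumes "\<And>i. len i > 0" "n \<ge> N" "position len N = (I, 0)" "position len n = (i, j)"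
  shows "i \<ge> I"
  using position_mono[OF assms(2), of len] assms(3,4) by simp


section \<open>Lagrange values of block sequences\<close>

text \<open>
  Block \<open>i\<close> consists of the digit 3, of \<open>2 * e i\<close> digits 2 and of two digits 1. The continued
  fraction after its digit 3 is \<open>fwd i\<close>, and the one before it, read backwards, is \<open>1 - bwd i\<close>. The
  value \<open>bwd 0 = 1\<close> says that nothing precedes block 0.
\<close>

locale block_sequence =
  fixes e :: "nat \<Rightarrow> nat"
begin

abbreviation len :: "nat \<Rightarrow> nat" where "len i \<equiv> 2 * e i + 3"

definition fwd :: "nat \<Rightarrow> real" where "fwd i = tail_of (\<lambda>j. e (i + j))"

fun bwd :: "nat \<Rightarrow> real" where
  "bwd 0 = 1"
| "bwd (Suc i) = (pair2 ^^ e i) (enter_left (bwd i))"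

fun digit_at :: "nat \<times> nat \<Rightarrow> nat" where
  "digit_at (i, j) = (if j = 0 then 3 else if j \<le> 2 * e i then 2 else 1)"

fun tail_at :: "nat \<times> nat \<Rightarrow> real" where
  "tail_at (i, j) = (if j = 0 then 1 / (3 + fwd i)
     else if j = 2 * e i + 2 then (3 + fwd (Suc i)) / (4 + fwd (Suc i))
     else (step2 ^^ (2 * e i + 1 - j)) (enter_right (fwd (Suc i))))"

lemma fwd_unit: "0 \<le> fwd i" "fwd i \<le> 1"
  unfolding fwd_def by (rule tail_of_unit)+

lemma fwd_rec: "fwd i = block (e i) (fwd (Suc i))"
  unfolding fwd_def using tail_of_rec[of "\<lambda>j. e (i + j)"] by simp

lemma bwd_unit: "0 \<le> bwd i \<and> bwd i \<le> 1"
proof (induction i)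
  case (Suc i)
  then show ?case unfolding bwd.simps using enter_left_bounds[of "bwd i"] by (intro pair2_power_unit) auto
qed simp

lemma tail_at_1: "tail_at (i, 1) = fwd i"
proof -
  have "tail_at (i, 1) = (step2 ^^ (2 * e i)) (enter_right (fwd (Suc i)))" by simp
  also have "\<dots> = fwd i" unfolding fwd_rec[of i] block_def
    using enter_right_bounds[OF fwd_unit, of "Suc i"] by (intro step2_power_even) auto
  finally show ?thesis .
qed

lemma tail_at_unit: "0 < tail_at s \<and> tail_at s < 1"
proof (cases s)
  case (Pair i j)
  have "0 < enter_right (fwd (Suc i))" "enter_right (fwd (Suc i)) < 1"
    using enter_right_bounds[OF fwd_unit, of "Suc i"] by auto
  then show ?thesis unfolding Pair
    using step2_power_unit[of "enter_right (fwd (Suc i))"] fwd_unit(1)[of i] fwd_unit(1)[of "Suc i"] by simp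
qed

lemma tail_at_rec:
  assumes "j < len i"
  shows "tail_at (i, j) * (digit_at (i, j) + tail_at (if Suc j < len i then (i, Suc j) else (Suc i, 0))) = 1"
proof -
  consider "j = 0" | "1 \<le> j" "j \<le> 2 * e i" | "j = 2 * e i + 1" | "j = 2 * e i + 2" using assms by linarith
  then show ?thesis
  proof cases
    case 1
    have "tail_at (i, Suc 0) = fwd i" using tail_at_1[of i] by simp
    then have "tail_at (i, j) * (digit_at (i, j) + tail_at (if Suc j < len i then (i, Suc j) else (Suc i, 0)))
        = 1 / (3 + fwd i) * (3 + fwd i)" using 1 by (simp del: tail_at.simps) simp
    then show ?thesis using fwd_unit(1)[of i] by simp
  next
    case 2
    define z where "z = tail_at (i, Suc j)"
    have z: "0 < z" using tail_at_unit unfolding z_def by blast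
    have "2 * e i + 1 - j = Suc (2 * e i + 1 - Suc j)" using 2 by simp
    then have "tail_at (i, j) = step2 z" unfolding z_def using 2 by simp
    moreover have "digit_at (i, j) = 2" using 2 by simp
    ultimately have "tail_at (i, j) * (digit_at (i, j) + tail_at (if Suc j < len i then (i, Suc j) else (Suc i, 0)))
        = step2 z * (2 + z)" using 2 by (simp add: z_def del: tail_at.simps digit_at.simps)
    then show ?thesis using z by (simp add: step2_def)
  next
    case 3
    have "enter_right y * (1 + (3 + y) / (4 + y)) = 1" if "y \<ge> 0" for y
      using that by (simp add: enter_right_def divide_simps)
    then show ?thesis using 3 fwd_unit(1)[of "Suc i"] by simp
  next
    case 4
    have "tail_at (i, j) = (3 + fwd (Suc i)) / (4 + fwd (Suc i))" "digit_at (i, j) = 1" using 4 by simp_all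
    moreover have "tail_at (if Suc j < len i then (i, Suc j) else (Suc i, 0)) = 1 / (3 + fwd (Suc i))"
      using 4 by simp
    moreover have "(3 + y) / (4 + y) * (1 + 1 / (3 + y)) = 1" if "y \<ge> 0" for y :: real
    proof -
      have "1 + 1 / (3 + y) = (4 + y) / (3 + y)" using that by (simp add: field_simps)
      then show ?thesis using that by simp
    qed
    ultimately show ?thesis using fwd_unit(1)[of "Suc i"] by (simp only: of_nat_1)
  qed
qed

definition digit :: "nat \<Rightarrow> nat" where "digit n = digit_at (position len n)"
definition xtail :: "nat \<Rightarrow> real" where "xtail n = tail_at (position len n)"

lemma position_less_len: "position len n = (i, j) \<Longrightarrow> j < len i"
  by (rule position_bound[of len]) simp_all

sublocale cf: continued_fraction digit xtail
proof
  fix n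
  obtain i j where p: "position len n = (i, j)" by fastforce
  show "1 \<le> digit n" unfolding digit_def p by simp
  show "0 < xtail n" "xtail n < 1" unfolding xtail_def using tail_at_unit by blast+
  show "xtail n * (real (digit n) + xtail (Suc n)) = 1"
    unfolding xtail_def digit_def position_Suc[OF p] p by (rule tail_at_rec[OF position_less_len[OF p]])
qed

definition bwd_at :: "nat \<Rightarrow> nat \<Rightarrow> real" where
  "bwd_at i j = (step2 ^^ (j - 1)) (1 / (4 - bwd i))"

lemma bwd_at_unit: "0 < bwd_at i j" "bwd_at i j < 1"
  unfolding bwd_at_def using step2_power_unit[of "1 / (4 - bwd i)"] bwd_unit[of i] by (simp_all add: divide_less_eq)

lemma step2_bwd_at: "1 \<le> j \<Longrightarrow> step2 (bwd_at i j) = bwd_at i (Suc j)"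
  by (cases j) (simp_all add: bwd_at_def)

lemma bwd_eq: "bwd (Suc i) = step2 (bwd_at i (2 * e i + 1))"
proof -
  have b: "0 \<le> bwd i" "bwd i \<le> 1" using bwd_unit by auto
  have "step2 (1 / (4 - bwd i)) = enter_left (bwd i)"
    using b by (simp add: step2_def enter_left_def divide_simps)
  then have "bwd (Suc i) = (step2 ^^ (2 * e i)) (step2 (1 / (4 - bwd i)))"
    using enter_left_bounds[OF b] by (simp add: step2_power_even)
  also have "\<dots> = step2 (bwd_at i (2 * e i + 1))"
    by (simp add: bwd_at_def funpow_swap1)
  finally show ?thesis .
qed

text \<open>
  The parities of the last two denominators, with \<open>q\<close> even in front of exactly the last digit of each
  block, and the backward fraction, as functions of the place within the block. All three are determined by
  their predecessors and the digit read.
\<close>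

lemma denominator_state:
  "case position len n of (i, j) \<Rightarrow>
     (if j = 0 then even (cf.cq n) \<and> odd (cf.cq (Suc n)) \<and> cf.backward n = 1 - bwd i
      else if j = 2 * e i + 2 then odd (cf.cq n) \<and> even (cf.cq (Suc n)) \<and>
        cf.backward n = 1 / (1 + bwd_at i (2 * e i + 1))
      else odd (cf.cq n) \<and> odd (cf.cq (Suc n)) \<and> cf.backward n = bwd_at i j)"
proof (induction n)
  case 0
  then show ?case by (simp add: cf.backward_0)
next
  case (Suc n)
  obtain i j where p: "position len n = (i, j)" by fastforce
  have pS: "position len (Suc n) = (if Suc j < len i then (i, Suc j) else (Suc i, 0))"
    by (rule position_Suc[OF p])
  have cqS: "even (cf.cq (Suc (Suc n))) \<longleftrightarrow> (even (digit n) \<or> even (cf.cq (Suc n))) = even (cf.cq n)"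
    by simp
  have d: "digit n = digit_at (i, j)" by (simp only: digit_def p)
  have bS: "cf.backward (Suc n) = 1 / (real (digit n) + cf.backward n)" by (rule cf.backward_Suc)
  consider "j = 0" | "1 \<le> j" "j \<le> 2 * e i" | "j = 2 * e i + 1" | "j = 2 * e i + 2"
    using position_less_len[OF p] by linarith
  then show ?case
  proof cases
    case 1
    have IH: "even (cf.cq n)" "odd (cf.cq (Suc n))" "cf.backward n = 1 - bwd i"
      using Suc.IH unfolding p using 1 by auto
    have dn: "digit n = 3" unfolding d using 1 by simp
    have P: "position len (Suc n) = (i, 1)" unfolding pS using 1 by simp
    have "odd (cf.cq (Suc (Suc n)))" using cqS IH dn by simp
    moreover have "cf.backward (Suc n) = bwd_at i 1" unfolding bS dn IH(3) by (simp add: bwd_at_def)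
    ultimately show ?thesis unfolding P using IH by (simp del: cf.cq.simps)
  next
    case 2
    have IH: "odd (cf.cq n)" "odd (cf.cq (Suc n))" "cf.backward n = bwd_at i j"
      using Suc.IH unfolding p using 2 by (auto split: if_splits)
    have dn: "digit n = 2" unfolding d using 2 by simp
    have P: "position len (Suc n) = (i, Suc j)" unfolding pS using 2 by simp
    have "odd (cf.cq (Suc (Suc n)))" using cqS IH dn by simp
    moreover have "cf.backward (Suc n) = bwd_at i (Suc j)"
      unfolding bS dn IH(3) step2_bwd_at[OF 2(1), symmetric] by (simp add: step2_def)
    ultimately show ?thesis unfolding P using IH 2 by (simp del: cf.cq.simps)
  next
    case 3
    have IH: "odd (cf.cq n)" "odd (cf.cq (Suc n))" "cf.backward n = bwd_at i (2 * e i + 1)"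
      using Suc.IH unfolding p using 3 by (auto split: if_splits)
    have dn: "digit n = 1" unfolding d using 3 by simp
    have P: "position len (Suc n) = (i, 2 * e i + 2)" unfolding pS using 3 by simp
    have "even (cf.cq (Suc (Suc n)))" using cqS IH dn by simp
    moreover have "cf.backward (Suc n) = 1 / (1 + bwd_at i (2 * e i + 1))" unfolding bS dn IH(3) by simp
    ultimately show ?thesis unfolding P using IH by (simp del: cf.cq.simps)
  next
    case 4
    have IH: "odd (cf.cq n)" "even (cf.cq (Suc n))" "cf.backward n = 1 / (1 + bwd_at i (2 * e i + 1))"
      using Suc.IH unfolding p using 4 by (auto split: if_splits)
    have dn: "digit n = 1" unfolding d using 4 by simp
    have P: "position len (Suc n) = (Suc i, 0)" unfolding pS using 4 by simp
    have "odd (cf.cq (Suc (Suc n)))" using cqS IH dn by simp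
    moreover have "cf.backward (Suc n) = 1 - bwd (Suc i)"
    proof -
      have "1 / (1 + 1 / (1 + z)) = 1 - step2 z" if "z > 0" for z
        using that by (simp add: step2_def divide_simps)
      then show ?thesis unfolding bS dn IH(3) bwd_eq using bwd_at_unit(1) by simp
    qed
    ultimately show ?thesis unfolding P using IH by (simp del: cf.cq.simps bwd.simps)
  qed
qed

lemma weight_block_start:
  assumes p: "position len n = (i, 0)"
  shows "cf.weight n = 2 + (fwd i - bwd i) / 2"
proof -
  have s: "odd (cf.cq (Suc n))" "cf.backward n = 1 - bwd i" using denominator_state[of n] unfolding p by auto
  have "position len (Suc n) = (i, 1)" using position_Suc[OF p] by simp
  then have "xtail (Suc n) = fwd i" unfolding xtail_def using tail_at_1 by simp
  moreover have "digit n = 3" by (simp add: digit_def p)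
  ultimately show ?thesis unfolding cf.weight_def using s by (simp add: field_simps)
qed

lemma weight_block_end:
  assumes p: "position len n = (i, 2 * e i + 2)"
  shows "cf.weight n = 1 / (1 - bwd (Suc i)) + 1 / (3 + fwd (Suc i))"
proof -
  have s: "even (cf.cq (Suc n))" "cf.backward n = 1 / (1 + bwd_at i (2 * e i + 1))"
    using denominator_state[of n] unfolding p by auto
  have "position len (Suc n) = (Suc i, 0)" using position_Suc[OF p] by simp
  then have "xtail (Suc n) = 1 / (3 + fwd (Suc i))" unfolding xtail_def by simp
  moreover have "digit n = 1" by (simp add: digit_def p)
  moreover have "1 + 1 / (1 + z) = 1 / (1 - step2 z)" if "z > 0" for z
    using that by (simp add: step2_def divide_simps)
  then have "1 + 1 / (1 + bwd_at i (2 * e i + 1)) = 1 / (1 - bwd (Suc i))"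
    unfolding bwd_eq using bwd_at_unit(1) by blast
  ultimately show ?thesis unfolding cf.weight_def using s by (simp del: bwd.simps)
qed

text \<open>
  The denominator is odd, the digit is at most 2, and the two fractions are at most 1 each, so half
  of their sum is at most 2.
\<close>

lemma weight_inside_block:
  assumes p: "position len n = (i, j)" "j \<noteq> 0" "j \<noteq> 2 * e i + 2"
  shows "cf.weight n \<le> 2"
proof -
  have s: "odd (cf.cq (Suc n))" using denominator_state[of n] p by auto
  have "digit n \<le> 2" unfolding digit_def p(1) using p(2) by simp
  then have "real (digit n) + xtail (Suc n) + cf.backward n \<le> 2 + 1 + 1"
    using cf.tail(2)[of "Suc n"] cf.backward_bounds(2)[of n] by (intro add_mono) auto
  then show ?thesis unfolding cf.weight_def using s by simp
qed

text \<open>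
  Apart from weights of at most 2, the weights are those at the two ends of the blocks.
\<close>

lemma block_sequence_lagrange:
  assumes V: "V \<ge> 2"
    and up: "\<And>W. V < W \<Longrightarrow>
      \<forall>\<^sub>F i in sequentially. 2 + (fwd i - bwd i) / 2 \<le> W \<and> 1 / (1 - bwd i) + 1 / (3 + fwd i) \<le> W"
    and lo: "\<And>W. W < V \<Longrightarrow> \<exists>\<^sub>F i in sequentially. W < 2 + (fwd i - bwd i) / 2"
  shows "sqrt 2 * V \<in> lagrange_spectrum"
proof -
  have lenpos: "len i > 0" for i by simp
  have "finite {n. W < cf.weight n}" if W: "V < W" for W
  proof -
    obtain I where I: "\<And>i. i \<ge> I \<Longrightarrow> 2 + (fwd i - bwd i) / 2 \<le> W \<and> 1 / (1 - bwd i) + 1 / (3 + fwd i) \<le> W"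
      using up[OF W] unfolding eventually_sequentially by blast
    obtain N where N: "position len N = (I, 0)" using position_start[of len I] lenpos by blast
    have "cf.weight n \<le> W" if n: "n \<ge> N" for n
    proof -
      obtain i j where p: "position len n = (i, j)" by fastforce
      have i: "i \<ge> I" by (rule position_eventually[OF lenpos n N p])
      consider "j = 0" | "j = 2 * e i + 2" | "j \<noteq> 0" "j \<noteq> 2 * e i + 2" by blast
      then show ?thesis
      proof cases
        case 1
        then show ?thesis using weight_block_start[of n i] p I[OF i] by simp
      next
        case 2
        then show ?thesis using weight_block_end[of n i] p I[of "Suc i"] i by (simp del: bwd.simps)
      next
        case 3
        then show ?thesis using weight_inside_block[OF p] V W by simp
      qed
    qed
    then have "{n. W < cf.weight n} \<subseteq> {..<N}" by (force simp: not_le[symmetric])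
    then show ?thesis by (rule finite_subset) simp
  qed
  moreover have "infinite {n. W < cf.weight n}" if W: "W < V" for W
  proof -
    have "\<exists>n\<ge>m. W < cf.weight n" for m
    proof -
      obtain i where i: "i \<ge> m" "W < 2 + (fwd i - bwd i) / 2"
        using lo[OF W] unfolding frequently_sequentially by blast
      obtain n where n: "position len n = (i, 0)" using position_start[of len i] lenpos by blast
      have "n \<ge> i" using position_fst_le[of len n] n by simp
      then show ?thesis using i weight_block_start[OF n] by (intro exI[of _ n]) simp
    qed
    then show ?thesis unfolding infinite_nat_iff_unbounded_le by blast
  qed
  ultimately have "lagrange_value (sqrt 2 * xtail 0) = ereal (sqrt 2 * V)"
    by (intro cf.lagrange_value_eq_limsup V) auto
  then show ?thesis unfolding lagrange_spectrum_def using cf.sqrt2_tail_notin_sqrt2_rats by blast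
qed

end


section \<open>Hausdorff dimension\<close>

lemma hausdorff_premeasure_mono:
  assumes "A \<subseteq> B"
  shows "hausdorff_premeasure s \<delta> A \<le> hausdorff_premeasure s \<delta> B"
  unfolding hausdorff_premeasure_def by (rule INF_superset_mono) (use assms in auto)

lemma hausdorff_dim_mono:
  assumes "A \<subseteq> B"
  shows "hausdorff_dim A \<le> hausdorff_dim B"
proof -
  have m: "hausdorff_measure s A \<le> hausdorff_measure s B" for s
    unfolding hausdorff_measure_def by (intro SUP_mono) (use hausdorff_premeasure_mono[OF assms] in blast)
  have "hausdorff_measure s A = 0" if "hausdorff_measure s B = 0" for s
    using m[of s] that by simp
  then show ?thesis
    unfolding hausdorff_dim_def by (intro INF_superset_mono) auto
qed

text \<open>
  The preimage of a set of diameter \<open>d\<close> lies in an interval of length \<open>2 * C * d powr s\<close>. The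
  preimages of a cover of \<open>A\<close> cover the unit interval, whose Lebesgue measure therefore bounds the sum
  of the terms \<open>d powr s\<close> from below. For sets of diameter at most 1, the gauge with an exponent
  \<open>t \<le> s\<close> is at least as large.
\<close>

lemma hausdorff_dim_positive_if_expanding_image:
  fixes f :: "real \<Rightarrow> 'a::metric_space"
  assumes s: "s > 0" and C: "C > 0"
    and f: "\<And>x. x \<in> {0..<1} \<Longrightarrow> f x \<in> A"
    and expand: "\<And>x y. x \<in> {0..<1} \<Longrightarrow> y \<in> {0..<1} \<Longrightarrow> \<bar>x - y\<bar> \<le> C * dist (f x) (f y) powr s"
  shows "hausdorff_dim A > 0"
proof -
  have cover: "1 \<le> ennreal (2 * C) * (\<Sum>i. hausdorff_gauge t (U i))"
    if t: "0 \<le> t" "t \<le> s" and U: "A \<subseteq> (\<Union>i. U i)" "\<And>i. bounded (U i)" "\<And>i. diameter (U i) \<le> 1"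
    for t and U :: "nat \<Rightarrow> 'a set"
  proof -
    define B where "B i = {x \<in> {0..<1}. f x \<in> U i}" for i
    have "\<exists>a b. B i \<subseteq> {a..b} \<and> ennreal (b - a) \<le> ennreal (2 * C) * hausdorff_gauge t (U i) \<and> a \<le> b" for i
    proof (cases "B i = {}")
      case True
      then show ?thesis by (intro exI[of _ 0]) auto
    next
      case False
      then obtain z where z: "z \<in> B i" by auto
      define r where "r = C * diameter (U i) powr s"
      have d0: "diameter (U i) \<ge> 0" by (rule diameter_ge_0[OF U(2)])
      have r: "r \<ge> 0" using C by (simp add: r_def)
      have "\<bar>x - z\<bar> \<le> r" if "x \<in> B i" for x
      proof -
        have "dist (f x) (f z) \<le> diameter (U i)"
          using that z diameter_bounded_bound[OF U(2)] by (auto simp: B_def)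
        then have "C * dist (f x) (f z) powr s \<le> r"
          unfolding r_def using C s by (intro mult_left_mono powr_mono2) auto
        then show ?thesis using expand[of x z] that z by (auto simp: B_def)
      qed
      then have sub: "B i \<subseteq> {z - r..z + r}" by force
      have ne: "U i \<noteq> {}" using z by (auto simp: B_def)
      have g: "ennreal (diameter (U i) powr s) \<le> hausdorff_gauge t (U i)"
      proof (cases "t = 0")
        case True
        have "diameter (U i) powr s \<le> 1"
          using powr_mono2[OF _ d0 U(3)[of i], of s] s by simp
        then show ?thesis using True ne by (simp add: hausdorff_gauge_def)
      next
        case False
        have "diameter (U i) powr s \<le> diameter (U i) powr t"
          using powr_mono'[OF t(2) d0 U(3)] .
        then show ?thesis using False ne by (simp add: hausdorff_gauge_def ennreal_leI)
      qed
      have "ennreal (z + r - (z - r)) = ennreal (2 * C) * ennreal (diameter (U i) powr s)"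
        using C by (simp add: r_def ennreal_mult[symmetric] mult.assoc)
      also have "\<dots> \<le> ennreal (2 * C) * hausdorff_gauge t (U i)"
        by (rule mult_left_mono[OF g]) simp
      finally show ?thesis using sub r by (intro exI[of _ "z - r"] exI[of _ "z + r"]) auto
    qed
    then obtain a b where ab: "\<And>i. B i \<subseteq> {a i..b i}"
      "\<And>i. ennreal (b i - a i) \<le> ennreal (2 * C) * hausdorff_gauge t (U i)" "\<And>i. a i \<le> b i"
      by metis
    have "{0..<1} \<subseteq> (\<Union>i. {a i..b i})"
    proof
      fix x :: real assume x: "x \<in> {0..<1}"
      then obtain i where "f x \<in> U i" using f U(1) by blast
      with x have "x \<in> B i" by (simp add: B_def)
      then show "x \<in> (\<Union>i. {a i..b i})" using ab(1) by blast
    qed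
    then have "emeasure lborel {0..<1::real} \<le> emeasure lborel (\<Union>i. {a i..b i})"
      by (intro emeasure_mono) auto
    also have "\<dots> \<le> (\<Sum>i. emeasure lborel {a i..b i})"
      by (intro emeasure_subadditive_countably) auto
    also have "\<dots> = (\<Sum>i. ennreal (b i - a i))" using ab(3) by simp
    also have "\<dots> \<le> (\<Sum>i. ennreal (2 * C) * hausdorff_gauge t (U i))"
      by (intro suminf_le ab(2)) auto
    also have "\<dots> = ennreal (2 * C) * (\<Sum>i. hausdorff_gauge t (U i))" by simp
    finally show ?thesis by simp
  qed
  have pos: "hausdorff_measure t A \<noteq> 0" if t: "0 \<le> t" "t \<le> s" for t
  proof
    assume z: "hausdorff_measure t A = 0"
    have "hausdorff_premeasure t 1 A \<le> hausdorff_measure t A"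
      unfolding hausdorff_measure_def by (rule SUP_upper) simp
    then have "hausdorff_premeasure t 1 A < ennreal (1 / (2 * C))" using z C by simp
    then obtain U :: "nat \<Rightarrow> 'a set" where U: "A \<subseteq> (\<Union>i. U i)" "\<forall>i. bounded (U i) \<and> diameter (U i) \<le> 1"
      and small: "(\<Sum>i. hausdorff_gauge t (U i)) < ennreal (1 / (2 * C))"
      unfolding hausdorff_premeasure_def INF_less_iff by auto
    have "1 \<le> ennreal (2 * C) * (\<Sum>i. hausdorff_gauge t (U i))"
      using cover[OF t U(1)] U(2) by simp
    also have "\<dots> < ennreal (2 * C) * ennreal (1 / (2 * C))"
      using small C by (intro ennreal_mult_strict_left_mono) auto
    also have "\<dots> = 1" using C by (simp add: ennreal_mult[symmetric])
    finally show False by simp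
  qed
  have "ereal s \<le> hausdorff_dim A"
    unfolding hausdorff_dim_def
  proof (rule INF_greatest)
    fix t assume "t \<in> {t. 0 \<le> t \<and> hausdorff_measure t A = 0}"
    then show "ereal s \<le> ereal t" using pos[of t] by (cases "t \<le> s") auto
  qed
  with s show ?thesis using less_le_trans[of 0 "ereal s"] by simp
qed

text \<open>
  The number \<open>\<lfloor>2 ^ Suc i * x\<rfloor>\<close> is determined by its parity and its half \<open>\<lfloor>2 ^ i * x\<rfloor>\<close>.
\<close>

lemma floor_eq_if_binary_digits_eq:
  fixes x y :: real
  assumes "x \<in> {0..<1}" "y \<in> {0..<1}"
    and "\<And>i. i < j \<Longrightarrow> odd \<lfloor>2 ^ Suc i * x\<rfloor> = odd \<lfloor>2 ^ Suc i * y\<rfloor>"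
  shows "\<lfloor>2 ^ j * x\<rfloor> = \<lfloor>2 ^ j * y\<rfloor>"
  using assms(3)
proof (induction j)
  case 0
  have "\<lfloor>x\<rfloor> = 0" "\<lfloor>y\<rfloor> = 0" using assms(1,2) by (auto simp: floor_eq_iff)
  then show ?case by simp
next
  case (Suc j)
  have half: "\<lfloor>2 ^ Suc j * z\<rfloor> div 2 = \<lfloor>2 ^ j * z\<rfloor>" for z :: real
    using floor_divide_real_eq_div[of 2 "2 ^ Suc j * z"] by simp
  have "\<lfloor>2 ^ Suc j * x\<rfloor> div 2 = \<lfloor>2 ^ Suc j * y\<rfloor> div 2"
    unfolding half by (rule Suc.IH) (use Suc.prems in simp)
  moreover have "odd \<lfloor>2 ^ Suc j * x\<rfloor> = odd \<lfloor>2 ^ Suc j * y\<rfloor>" by (rule Suc.prems) simp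
  ultimately show ?case by presburger
qed

text \<open>
  Feed the binary digits of a number in the unit interval into \<open>val\<close>. Numbers whose digits first
  differ at index \<open>j\<close> are less than \<open>(1 / 2) ^ j\<close> apart, while their values are at least \<open>C * c ^ j\<close>
  apart. The exponent \<open>s\<close> with \<open>c powr s = 1 / 2\<close> compares the two distances.
\<close>

lemma hausdorff_dim_positive_if_cantor_image:
  fixes val :: "(nat \<Rightarrow> bool) \<Rightarrow> 'a::metric_space"
  assumes val: "\<And>w. val w \<in> A" and C: "C > 0" and c: "0 < c" "c < 1"
    and sep: "\<And>w w' j. (\<And>i. i < j \<Longrightarrow> w i = w' i) \<Longrightarrow> w j \<noteq> w' j \<Longrightarrow> C * c ^ j \<le> dist (val w) (val w')"
  shows "hausdorff_dim A > 0"
proof -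
  define bits where "bits x i \<longleftrightarrow> odd \<lfloor>2 ^ Suc i * x\<rfloor>" for x :: real and i
  define s where "s = log c (1/2)"
  have s: "s > 0" unfolding s_def using c by (simp add: log_def field_simps)
  have cs: "c powr s = 1/2" unfolding s_def using c by simp
  have "\<bar>x - y\<bar> \<le> C powr (-s) * dist (val (bits x)) (val (bits y)) powr s"
    if xy: "x \<in> {0..<1}" "y \<in> {0..<1}" for x y
  proof (cases "bits x = bits y")
    case True
    have near: "\<bar>x - y\<bar> < (1/2) ^ j" for j
    proof -
      have "\<lfloor>2 ^ j * x\<rfloor> = \<lfloor>2 ^ j * y\<rfloor>"
        by (rule floor_eq_if_binary_digits_eq[OF xy]) (use True in \<open>auto simp: bits_def fun_eq_iff\<close>)
      then have "\<bar>2 ^ j * x - 2 ^ j * y\<bar> < 1" by linarith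
      then have "2 ^ j * \<bar>x - y\<bar> < 1" by (simp add: abs_mult right_diff_distrib[symmetric])
      then show ?thesis by (simp add: field_simps)
    qed
    have "x = y"
    proof (rule ccontr)
      assume "x \<noteq> y"
      then obtain j where "(1/2::real) ^ j < \<bar>x - y\<bar>"
        using real_arch_pow_inv[of "\<bar>x - y\<bar>" "1/2"] by auto
      with near[of j] show False by simp
    qed
    then show ?thesis by simp
  next
    case False
    then obtain j0 where "bits x j0 \<noteq> bits y j0" by auto
    define j where "j = (LEAST j. bits x j \<noteq> bits y j)"
    have j: "bits x j \<noteq> bits y j" unfolding j_def by (rule LeastI) fact
    have lt: "bits x i = bits y i" if "i < j" for i
      using not_less_Least that unfolding j_def by blast
    have "\<lfloor>2 ^ j * x\<rfloor> = \<lfloor>2 ^ j * y\<rfloor>"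
      by (rule floor_eq_if_binary_digits_eq[OF xy]) (use lt in \<open>auto simp: bits_def\<close>)
    then have "\<bar>2 ^ j * x - 2 ^ j * y\<bar> < 1" by linarith
    then have "2 ^ j * \<bar>x - y\<bar> < 1" by (simp add: abs_mult right_diff_distrib[symmetric])
    then have "\<bar>x - y\<bar> \<le> (1/2) ^ j" by (simp add: field_simps)
    also have "(1/2) ^ j = (c ^ j) powr s"
      using c by (simp add: powr_power powr_realpow[symmetric] powr_powr cs[symmetric] mult.commute)
    also have "\<dots> = C powr (-s) * (C * c ^ j) powr s"
      using C c by (simp add: powr_mult powr_minus field_simps)
    also have "\<dots> \<le> C powr (-s) * dist (val (bits x)) (val (bits y)) powr s"
      using sep[of j "bits x" "bits y", OF lt j] C c s by (intro mult_left_mono powr_mono2) auto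
    finally show ?thesis .
  qed
  then show ?thesis
    by (intro hausdorff_dim_positive_if_expanding_image[OF s, of "C powr (-s)" "\<lambda>x. val (bits x)"])
      (use val C in auto)
qed


section \<open>Sequences with recurring markers\<close>

text \<open>
  This is the inverse of \<open>x \<mapsto> (1 + x) / (3 + x)\<close>, a Moebius map with the same fixed points as \<open>pair2\<close>;
  for this reason it commutes with \<open>pair2\<close>. Since \<open>1 / (1 - y) = (dual y + 3) / 2\<close>, it brings the weight at
  the end of a block into the form of the weight at the start of a block.
\<close>

definition dual :: "real \<Rightarrow> real" where "dual y = 2 / (1 - y) - 3"

lemma dual_pair2:
  assumes "0 \<le> y" "y < 1"
  shows "dual (pair2 y) = pair2 (dual y)"
proof -
  have "1 - pair2 y = (3 + y) / (5 + 2 * y)" using assms by (simp add: pair2_def field_simps)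
  then have "dual (pair2 y) = 2 * (5 + 2 * y) / (3 + y) - 3" by (simp add: dual_def)
  also have "\<dots> = (1 + y) / (3 + y)" using assms by (simp add: field_simps)
  finally have l: "dual (pair2 y) = (1 + y) / (3 + y)" .
  have "dual y = (3 * y - 1) / (1 - y)" using assms by (simp add: dual_def field_simps)
  then have "2 + dual y = (1 + y) / (1 - y)" "5 + 2 * dual y = (3 + y) / (1 - y)"
    using assms by (simp_all add: field_simps)
  then have "pair2 (dual y) = (1 + y) / (3 + y)" using assms by (simp add: pair2_def)
  with l show ?thesis by simp
qed

lemma dual_pair2_power:
  assumes "0 \<le> y" "y < 1"
  shows "dual ((pair2 ^^ n) y) = (pair2 ^^ n) (dual y)"
proof (induction n)
  case (Suc n)
  have "(pair2 ^^ n) y < (pair2 ^^ n) 1" using assms by (intro pair2_power_strict_mono) auto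
  also have "\<dots> \<le> 1" using pair2_power_unit[of 1] by simp
  finally have "dual (pair2 ((pair2 ^^ n) y)) = pair2 (dual ((pair2 ^^ n) y))"
    using pair2_power_unit[of y n] assms by (intro dual_pair2) auto
  with Suc show ?case by simp
qed simp

lemma dual_enter_left_fixpt: "dual (enter_left fixpt) = enter_right fixpt"
proof -
  have "1 - enter_left fixpt = (5 - fixpt) / (9 - 2 * fixpt)"
    using fixpt_bounds by (simp add: enter_left_def field_simps)
  then have "dual (enter_left fixpt) = 2 * (9 - 2 * fixpt) / (5 - fixpt) - 3" by (simp add: dual_def)
  also have "\<dots> = (3 - fixpt) / (5 - fixpt)" using fixpt_bounds by (simp add: field_simps)
  also have "\<dots> = enter_right fixpt"
    unfolding enter_right_def using fixpt_bounds fixpt_square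
    by (subst frac_eq_eq) (simp_all add: algebra_simps)
  finally show ?thesis .
qed

lemma inverse_fixpt: "1 / (3 + fixpt) = (1 - fixpt) / 2" "1 / (1 - fixpt) = (3 + fixpt) / 2"
proof -
  have "(1 - fixpt) * (3 + fixpt) = 2" using fixpt_square by (simp add: algebra_simps)
  then show "1 / (3 + fixpt) = (1 - fixpt) / 2" "1 / (1 - fixpt) = (3 + fixpt) / 2"
    using fixpt_bounds by (subst frac_eq_eq; simp add: mult.commute)+
qed

text \<open>
  The left side is the limit of the weights at the ends of the marker blocks, and the right side the
  limit of those at their starts. By duality the left side is
  \<open>(block k fixpt + 3) / 2 + 1 / (3 + X)\<close>, so both sides agree for \<open>X = fixpt\<close>. As \<open>X\<close>
  increases, the left side decreases with slope at least 1/16 in size and the right side with slope at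
  most 1/98, so the right side is larger for \<open>X > fixpt\<close>.
\<close>

lemma after_marker_less:
  assumes X: "fixpt < X" "X \<le> 1"
  shows "1 / (1 - (pair2 ^^ k) (enter_left fixpt)) + 1 / (3 + X) < 2 + (block k X - fixpt) / 2"
proof -
  have f: "0 \<le> fixpt" "fixpt \<le> 1" using fixpt_bounds by auto
  have "dual ((pair2 ^^ k) (enter_left fixpt)) = (pair2 ^^ k) (enter_right fixpt)"
    using enter_left_bounds[OF f] by (simp add: dual_pair2_power dual_enter_left_fixpt)
  then have "1 / (1 - (pair2 ^^ k) (enter_left fixpt)) = (block k fixpt + 3) / 2"
    by (simp add: dual_def block_def)
  moreover have "block k fixpt - block k X \<le> (X - fixpt) / 49"
  proof -
    have "\<bar>block k fixpt - block k X\<bar> \<le> \<bar>enter_right fixpt - enter_right X\<bar>"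
      unfolding block_def using enter_right_bounds[OF f] enter_right_bounds[of X] X f
      by (intro pair2_power_contract) auto
    also have "\<dots> \<le> \<bar>fixpt - X\<bar> / 49" using X f by (intro enter_right_lipschitz) auto
    also have "\<bar>fixpt - X\<bar> = X - fixpt" using X by simp
    finally show ?thesis by linarith
  qed
  moreover have "(X - fixpt) / 16 \<le> 1 / (3 + fixpt) - 1 / (3 + X)"
  proof -
    have "1 / (3 + fixpt) - 1 / (3 + X) = (X - fixpt) / ((3 + fixpt) * (3 + X))"
      using X f by (subst diff_frac_eq) simp_all
    moreover have "(3 + fixpt) * (3 + X) \<le> 4 * 4" using X f by (intro mult_mono) auto
    then have "(X - fixpt) / (4 * 4) \<le> (X - fixpt) / ((3 + fixpt) * (3 + X))"
      using X f by (intro divide_left_mono) auto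
    ultimately show ?thesis by simp
  qed
  ultimately show ?thesis using inverse_fixpt(1) X(1) by (simp add: field_simps)
qed

lemma position_pred_Suc: "position len (Suc i) = (m, Suc l) \<Longrightarrow> position len i = (m, l)"
  by (auto split: prod.splits if_splits)

lemma position_pred_0:
  assumes "\<And>i. len i > 0" "position len (Suc i) = (m, 0)"
  shows "\<exists>m'. m = Suc m' \<and> position len i = (m', len m' - 1)"
proof -
  obtain m' j where p: "position len i = (m', j)" by fastforce
  have "j < len m'" by (rule position_bound[OF assms(1) p])
  moreover have "\<not> Suc j < len m'" "m = Suc m'" using assms(2) p by (auto split: if_splits)
  ultimately show ?thesis using p by auto
qed

lemma position_fst_at_top:
  assumes "\<And>i. len i > 0"
  shows "filterlim (\<lambda>n. fst (position len n)) at_top sequentially"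
  unfolding filterlim_at_top
proof
  fix Z
  obtain N where N: "position len N = (Z, 0)" using position_start[of len Z] assms by blast
  have "Z \<le> fst (position len n)" if "n \<ge> N" for n using position_mono[OF that, of len] N by simp
  then show "\<forall>\<^sub>F n in sequentially. Z \<le> fst (position len n)" unfolding eventually_sequentially by blast
qed

text \<open>
  The exponents consist of the stretches \<open>k, K + w 0, \<dots>, K + w (m - 1), m\<close> for \<open>m = 0, 1, 2, \<dots>\<close>, whose
  first blocks are the markers. The assumptions make \<open>K\<close> so large compared to \<open>k\<close> that
  weights next to blocks with exponents at least \<open>K\<close> stay below those reached at the markers:
  \<open>K_fwd\<close> for the starts of blocks and \<open>K_bwd\<close> for their ends. The number 5/9 is the minimum of
  \<open>enter_right\<close> on the unit interval.
\<close>

locale marked_sequence =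
  fixes k K :: nat and w :: "nat \<Rightarrow> bool"
  assumes K_fwd: "(pair2 ^^ K) 1 \<le> (pair2 ^^ k) (5 / 9)"
    and K_bwd: "1 / (1 - (pair2 ^^ K) 1) + 1 / (3 + fixpt) \<le> 2 + ((pair2 ^^ k) (5 / 9) - fixpt) / 2"
begin

definition free :: "nat \<Rightarrow> nat" where "free i = K + of_bool (w i)"

definition pos :: "nat \<Rightarrow> nat \<times> nat" where "pos = position (\<lambda>m. m + 2)"

definition exps :: "nat \<Rightarrow> nat" where
  "exps i = (case pos i of (m, l) \<Rightarrow> if l = 0 then k else if l \<le> m then free (l - 1) else m)"

sublocale bs: block_sequence exps .

definition X :: real where "X = tail_of free"

definition limit_value :: real where "limit_value = 2 + (block k X - fixpt) / 2"

lemma X_bounds: "fixpt < X" "0 \<le> X" "X \<le> 1"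
  unfolding X_def by (rule tail_of_gt_fixpt tail_of_unit)+

lemma limit_value_ge: "2 + ((pair2 ^^ k) (5 / 9) - fixpt) / 2 \<le> limit_value"
  unfolding limit_value_def block_def using enter_right_bounds[OF X_bounds(2,3)]
  by (simp add: pair2_power_mono)

lemma limit_value_gt_2: "2 < limit_value"
proof -
  have "fixpt < (pair2 ^^ k) (5 / 9)" using fixpt_bounds by (intro pair2_power_gt_fixpt) auto
  then show ?thesis using limit_value_ge by (simp add: field_simps)
qed

lemma fwd_upper: "bs.fwd i \<le> (pair2 ^^ exps i) 1"
  unfolding bs.fwd_rec[of i] block_def
  using enter_right_bounds[OF bs.fwd_unit, of "Suc i"] by (intro pair2_power_mono) auto

lemma fwd_lower: "fixpt < bs.fwd i"
  unfolding bs.fwd_rec[of i] by (intro block_gt_fixpt bs.fwd_unit)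

lemma bwd_lower: "fixpt < bs.bwd (Suc i)"
  unfolding bs.bwd.simps using enter_left_bounds[of "bs.bwd i"] bs.bwd_unit[of i] fixpt_bounds
  by (intro pair2_power_gt_fixpt) auto

lemma bwd_upper: "bs.bwd (Suc i) \<le> (pair2 ^^ exps i) 1"
  unfolding bs.bwd.simps using enter_left_bounds[of "bs.bwd i"] bs.bwd_unit[of i]
  by (intro pair2_power_mono) auto

text \<open>
  Limits along this filter are limits over the starts of the marker blocks.
\<close>

definition markers :: "nat filter" where
  "markers = inf sequentially (principal {i. snd (pos i) = 0})"

lemma eventually_markers: "eventually P markers \<longleftrightarrow> (\<forall>\<^sub>F i in sequentially. snd (pos i) = 0 \<longrightarrow> P i)"
  unfolding markers_def eventually_inf_principal by simp

lemma pos_at_top: "filterlim (\<lambda>i. fst (pos i)) at_top markers"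
  unfolding pos_def markers_def
  by (rule filterlim_mono[OF position_fst_at_top order_refl]) simp_all

lemma fwd_Suc_marker:
  assumes "pos i = (m, 0)"
  shows "\<bar>bs.fwd (Suc i) - X\<bar> \<le> (1 / 2) ^ m"
  unfolding bs.fwd_def X_def
proof (rule tail_of_close)
  fix j assume j: "j < m"
  have "pos (i + Suc j) = (m, Suc j)"
    unfolding pos_def using assms j by (intro position_block) (simp_all add: pos_def)
  then show "exps (Suc i + j) = free j" unfolding exps_def using j by simp
qed

lemma fwd_Suc_tendsto: "((\<lambda>i. bs.fwd (Suc i)) \<longlongrightarrow> X) markers"
proof (rule LIM_zero_cancel, rule Lim_null_comparison)
  show "\<forall>\<^sub>F i in markers. norm (bs.fwd (Suc i) - X) \<le> (1 / 2) ^ fst (pos i)"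
    unfolding eventually_markers
  proof (intro always_eventually allI impI)
    fix i assume "snd (pos i) = 0"
    then have "pos i = (fst (pos i), 0)" by (metis prod.collapse)
    then show "norm (bs.fwd (Suc i) - X) \<le> (1 / 2) ^ fst (pos i)"
      using fwd_Suc_marker by simp
  qed
  have "(\<lambda>m. (1 / 2 :: real) ^ m) \<longlonglongrightarrow> 0" by (rule LIMSEQ_power_zero) simp
  then show "((\<lambda>i. (1 / 2 :: real) ^ fst (pos i)) \<longlongrightarrow> 0) markers"
    by (rule filterlim_compose[OF _ pos_at_top])
qed

lemma bwd_tendsto: "(bs.bwd \<longlongrightarrow> fixpt) markers"
proof (rule tendsto_sandwich[where f = "\<lambda>_. fixpt" and h = "\<lambda>i. (pair2 ^^ (fst (pos i) - 1)) 1"])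
  have *: "fixpt \<le> bs.bwd i \<and> bs.bwd i \<le> (pair2 ^^ (fst (pos i) - 1)) 1" if s: "snd (pos i) = 0" and nz: "i > 0" for i
  proof -
    obtain i' where i': "i = Suc i'" using nz gr0_implies_Suc by blast
    have "pos i = (fst (pos i), 0)" using s by (metis prod.collapse)
    then have "\<exists>m'. fst (pos i) = Suc m' \<and> pos i' = (m', m' + 2 - 1)"
      unfolding pos_def i' by (intro position_pred_0) simp_all
    then have "exps i' = fst (pos i) - 1" by (auto simp: exps_def)
    then show ?thesis using bwd_lower[of i'] bwd_upper[of i'] unfolding i' by simp
  qed
  show "\<forall>\<^sub>F i in markers. fixpt \<le> bs.bwd i"
    unfolding eventually_markers using eventually_gt_at_top[of 0] by eventually_elim (use * in blast)
  show "\<forall>\<^sub>F i in markers. bs.bwd i \<le> (pair2 ^^ (fst (pos i) - 1)) 1"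
    unfolding eventually_markers using eventually_gt_at_top[of 0] by eventually_elim (use * in blast)
  have "filterlim (\<lambda>m::nat. m - 1) at_top at_top" by (rule filterlim_minus_const_nat_at_top)
  then have "filterlim (\<lambda>i. fst (pos i) - 1) at_top markers" by (rule filterlim_compose[OF _ pos_at_top])
  then show "((\<lambda>i. (pair2 ^^ (fst (pos i) - 1)) 1) \<longlongrightarrow> fixpt) markers"
    by (rule filterlim_compose[OF pair2_power_1_tendsto])
qed simp

lemma continuous_from_contraction:
  fixes f g :: "_ \<Rightarrow> real"
  assumes "(g \<longlongrightarrow> l) F" "\<And>i. \<bar>f i - c\<bar> \<le> \<bar>g i - l\<bar>"
  shows "(f \<longlongrightarrow> c) F"
proof (rule LIM_zero_cancel, rule Lim_null_comparison)
  show "\<forall>\<^sub>F i in F. norm (f i - c) \<le> \<bar>g i - l\<bar>" using assms(2) by simp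
  show "((\<lambda>i. \<bar>g i - l\<bar>) \<longlongrightarrow> 0) F" using assms(1) by (intro tendsto_rabs_zero) (simp add: LIM_zero_iff)
qed

lemma fwd_tendsto: "(bs.fwd \<longlongrightarrow> block k X) markers"
proof -
  have "((\<lambda>i. block k (bs.fwd (Suc i))) \<longlongrightarrow> block k X) markers"
    using fwd_Suc_tendsto
  proof (rule continuous_from_contraction)
    show "\<bar>block k (bs.fwd (Suc i)) - block k X\<bar> \<le> \<bar>bs.fwd (Suc i) - X\<bar>" for i
      using bs.fwd_unit[of "Suc i"] X_bounds by (intro le_of_le_divide[OF block_contract]) auto
  qed
  moreover have "\<forall>\<^sub>F i in markers. block k (bs.fwd (Suc i)) = bs.fwd i"
    unfolding eventually_markers
  proof (intro always_eventually allI impI)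
    fix i assume "snd (pos i) = 0"
    then have "exps i = k" by (simp add: exps_def case_prod_beta)
    then show "block k (bs.fwd (Suc i)) = bs.fwd i" using bs.fwd_rec[of i] by simp
  qed
  ultimately show ?thesis by (rule Lim_transform_eventually)
qed

lemma bwd_Suc_tendsto: "((\<lambda>i. bs.bwd (Suc i)) \<longlongrightarrow> (pair2 ^^ k) (enter_left fixpt)) markers"
proof -
  have f: "0 \<le> fixpt" "fixpt \<le> 1" using fixpt_bounds by auto
  have "((\<lambda>i. (pair2 ^^ k) (enter_left (bs.bwd i))) \<longlongrightarrow> (pair2 ^^ k) (enter_left fixpt)) markers"
    using bwd_tendsto
  proof (rule continuous_from_contraction)
    fix i
    have b: "0 \<le> bs.bwd i" "bs.bwd i \<le> 1" using bs.bwd_unit by auto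
    have "\<bar>(pair2 ^^ k) (enter_left (bs.bwd i)) - (pair2 ^^ k) (enter_left fixpt)\<bar>
        \<le> \<bar>enter_left (bs.bwd i) - enter_left fixpt\<bar>"
      using enter_left_bounds[OF b] enter_left_bounds[OF f] by (intro pair2_power_contract) auto
    also have "\<dots> \<le> \<bar>bs.bwd i - fixpt\<bar>" using b f by (rule enter_left_lipschitz)
    finally show "\<bar>(pair2 ^^ k) (enter_left (bs.bwd i)) - (pair2 ^^ k) (enter_left fixpt)\<bar> \<le> \<bar>bs.bwd i - fixpt\<bar>" .
  qed
  moreover have "\<forall>\<^sub>F i in markers. (pair2 ^^ k) (enter_left (bs.bwd i)) = bs.bwd (Suc i)"
    unfolding eventually_markers
  proof (intro always_eventually allI impI)
    fix i assume "snd (pos i) = 0"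
    then have "exps i = k" by (simp add: exps_def case_prod_beta)
    then show "(pair2 ^^ k) (enter_left (bs.bwd i)) = bs.bwd (Suc i)" by simp
  qed
  ultimately show ?thesis by (rule Lim_transform_eventually)
qed

lemma marker_value_tendsto: "((\<lambda>i. 2 + (bs.fwd i - bs.bwd i) / 2) \<longlongrightarrow> limit_value) markers"
  unfolding limit_value_def by (intro tendsto_intros fwd_tendsto bwd_tendsto) simp

lemma eventually_marker_end_le:
  "\<forall>\<^sub>F i in markers. 1 / (1 - bs.bwd i) + 1 / (3 + bs.fwd i) < limit_value"
proof (rule order_tendstoD(2))
  show "((\<lambda>i. 1 / (1 - bs.bwd i) + 1 / (3 + bs.fwd i)) \<longlongrightarrow> 1 / (1 - fixpt) + 1 / (3 + block k X)) markers"
    using fixpt_bounds block_unit[OF X_bounds(2,3), of k] by (intro tendsto_intros fwd_tendsto bwd_tendsto) auto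
  have "1 / (3 + block k X) \<le> 1 / (3 + fixpt)"
    using block_gt_fixpt[OF X_bounds(2,3), of k] fixpt_bounds by (intro divide_left_mono) auto
  moreover have "1 / (1 - fixpt) + 1 / (3 + fixpt) = 2" unfolding inverse_fixpt by (simp add: field_simps)
  ultimately show "1 / (1 - fixpt) + 1 / (3 + block k X) < limit_value"
    using limit_value_gt_2 by linarith
qed

lemma eventually_after_marker_le:
  "\<forall>\<^sub>F i in markers. 1 / (1 - bs.bwd (Suc i)) + 1 / (3 + bs.fwd (Suc i)) < limit_value"
proof (rule order_tendstoD(2))
  have "fixpt \<le> 1" "0 \<le> fixpt" using fixpt_bounds by auto
  then have "(pair2 ^^ k) (enter_left fixpt) < (pair2 ^^ k) 1"
    using enter_left_bounds[of fixpt] by (intro pair2_power_strict_mono) auto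
  also have "\<dots> \<le> 1" using pair2_power_unit[of 1] by simp
  finally have "1 - (pair2 ^^ k) (enter_left fixpt) \<noteq> 0" by simp
  then show "((\<lambda>i. 1 / (1 - bs.bwd (Suc i)) + 1 / (3 + bs.fwd (Suc i)))
      \<longlongrightarrow> 1 / (1 - (pair2 ^^ k) (enter_left fixpt)) + 1 / (3 + X)) markers"
    using X_bounds by (intro tendsto_intros fwd_Suc_tendsto bwd_Suc_tendsto) auto
  show "1 / (1 - (pair2 ^^ k) (enter_left fixpt)) + 1 / (3 + X) < limit_value"
    unfolding limit_value_def by (rule after_marker_less[OF X_bounds(1,3)])
qed

lemma exps_ge_K:
  assumes "pos i = (m, l)" "l \<noteq> 0" "l \<le> m \<or> K \<le> m"
  shows "exps i \<ge> K"
  using assms by (auto simp: exps_def free_def)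

lemma pos_pred:
  assumes "pos i = (m, Suc l)"
  shows "\<exists>i'. i = Suc i' \<and> pos i' = (m, l)"
proof -
  have "i \<noteq> 0" using assms by (cases i) (simp_all add: pos_def)
  then obtain i' where "i = Suc i'" using not0_implies_Suc by blast
  then show ?thesis using position_pred_Suc[of "\<lambda>m. m + 2" i' m l] assms unfolding pos_def by blast
qed

text \<open>
  A block \<open>i\<close> is a marker, directly follows a marker, or is a later block of its stretch. Limits along
  the markers handle the first case, and the weight at the end of the marker in the second. In all other
  situations the exponents involved are at least \<open>K\<close>.
\<close>

lemma eventually_values_le:
  assumes W: "limit_value < W"
  shows "\<forall>\<^sub>F i in sequentially. 2 + (bs.fwd i - bs.bwd i) / 2 \<le> W \<and> 1 / (1 - bs.bwd i) + 1 / (3 + bs.fwd i) \<le> W"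
proof -
  have "\<forall>\<^sub>F i in markers. 2 + (bs.fwd i - bs.bwd i) / 2 < W"
    using order_tendstoD(2)[OF marker_value_tendsto W] .
  then obtain N1 where N1: "\<And>i. i \<ge> N1 \<Longrightarrow> snd (pos i) = 0 \<Longrightarrow> 2 + (bs.fwd i - bs.bwd i) / 2 < W"
    unfolding eventually_markers eventually_sequentially by blast
  obtain N2 where N2: "\<And>i. i \<ge> N2 \<Longrightarrow> snd (pos i) = 0 \<Longrightarrow> 1 / (1 - bs.bwd i) + 1 / (3 + bs.fwd i) < limit_value"
    using eventually_marker_end_le unfolding eventually_markers eventually_sequentially by blast
  obtain N3 where N3: "\<And>i. i \<ge> N3 \<Longrightarrow> snd (pos i) = 0 \<Longrightarrow>
      1 / (1 - bs.bwd (Suc i)) + 1 / (3 + bs.fwd (Suc i)) < limit_value"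
    using eventually_after_marker_le unfolding eventually_markers eventually_sequentially by blast
  obtain N4 where N4: "pos N4 = (K, 0)" using position_start[of "\<lambda>m. m + 2" K] unfolding pos_def by auto
  have "2 + (bs.fwd i - bs.bwd i) / 2 \<le> W \<and> 1 / (1 - bs.bwd i) + 1 / (3 + bs.fwd i) \<le> W"
    if i: "i \<ge> N1" "i \<ge> N2" "i \<ge> Suc N3" "i \<ge> N4" for i
  proof -
    obtain m l where p: "pos i = (m, l)" by fastforce
    have m: "m \<ge> K"
      using position_eventually[of "\<lambda>m. m + 2", OF _ i(4)] N4 p unfolding pos_def by auto
    show ?thesis
    proof (cases l)
      case 0
      then show ?thesis using N1[OF i(1)] N2[OF i(2)] p W by simp
    next
      case (Suc l')
      then obtain i' where i': "i = Suc i'" "pos i' = (m, l')" using pos_pred p by blast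
      have b: "fixpt < bs.bwd i" unfolding i'(1) by (rule bwd_lower)
      have "bs.fwd i \<le> (pair2 ^^ exps i) 1" by (rule fwd_upper)
      also have "\<dots> \<le> (pair2 ^^ K) 1"
        using exps_ge_K[OF p] Suc m by (intro pair2_power_le_power_1) auto
      finally have f: "bs.fwd i \<le> (pair2 ^^ k) (5 / 9)" using K_fwd by simp
      have "1 / (1 - bs.bwd i) + 1 / (3 + bs.fwd i) \<le> limit_value"
      proof (cases l')
        case 0
        then show ?thesis using N3[of i'] i(3) i' by simp
      next
        case (Suc l'')
        have "bs.bwd i \<le> (pair2 ^^ exps i') 1" unfolding i'(1) by (rule bwd_upper)
        also have "\<dots> \<le> (pair2 ^^ K) 1"
          using exps_ge_K[OF i'(2)] Suc m by (intro pair2_power_le_power_1) auto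
        finally have u: "bs.bwd i \<le> (pair2 ^^ K) 1" .
        have K1: "(pair2 ^^ K) 1 < 1"
          using pair2_power_strict_mono[of "5/9" 1 k] pair2_power_unit[of 1 k] K_fwd by simp
        have "1 / (1 - bs.bwd i) \<le> 1 / (1 - (pair2 ^^ K) 1)"
          using u K1 by (intro divide_left_mono mult_pos_pos) auto
        moreover have "1 / (3 + bs.fwd i) \<le> 1 / (3 + fixpt)"
          using fwd_lower[of i] fixpt_bounds by (intro divide_left_mono mult_pos_pos) auto
        ultimately show ?thesis using K_bwd limit_value_ge by linarith
      qed
      moreover have "2 + (bs.fwd i - bs.bwd i) / 2 \<le> limit_value"
        using f b limit_value_ge by (simp add: field_simps)
      ultimately show ?thesis using W by simp
    qed
  qed
  then show ?thesis unfolding eventually_sequentially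
    by (intro exI[of _ "max (max N1 N2) (max (Suc N3) N4)"]) simp
qed

lemma limit_value_in_lagrange_spectrum: "sqrt 2 * limit_value \<in> lagrange_spectrum"
proof (rule bs.block_sequence_lagrange)
  show "2 \<le> limit_value" using limit_value_gt_2 by simp
  show "\<exists>\<^sub>F i in sequentially. W < 2 + (bs.fwd i - bs.bwd i) / 2" if W: "W < limit_value" for W
  proof -
    obtain N where N: "\<And>i. i \<ge> N \<Longrightarrow> snd (pos i) = 0 \<Longrightarrow> W < 2 + (bs.fwd i - bs.bwd i) / 2"
      using order_tendstoD(1)[OF marker_value_tendsto W]
      unfolding eventually_markers eventually_sequentially by blast
    have "\<exists>i\<ge>n. W < 2 + (bs.fwd i - bs.bwd i) / 2" for n
    proof -
      obtain i where i: "pos i = (max n N, 0)"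
        using position_start[of "\<lambda>m. m + 2" "max n N"] unfolding pos_def by auto
      then have "max n N \<le> i" using position_fst_le[of "\<lambda>m. m + 2" i] by (simp add: pos_def)
      then show ?thesis using N[of i] i by (intro exI[of _ i]) simp
    qed
    then show ?thesis unfolding frequently_sequentially by blast
  qed
qed (rule eventually_values_le)

end

section \<open>A Cantor set of Lagrange values\<close>

text \<open>
  At the first difference the blocks with exponents \<open>K\<close> and \<open>K + 1\<close> separate the tails, because the
  additional \<open>pair2\<close> takes values up to 3/7 and \<open>enter_right\<close> takes values from 5/9 on. Each common block
  in front scales distances by a factor of at least \<open>c\<close>.
\<close>

lemma free_tail_separation:
  fixes K :: nat
  defines "c \<equiv> (1 / 49) ^ Suc K / (81::real)"
  shows "(\<And>i. i < j \<Longrightarrow> w i = w' i) \<Longrightarrow> w j \<noteq> w' j \<Longrightarrow>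
    (1 / 49) ^ K / 9 * c ^ j \<le> \<bar>tail_of (\<lambda>i. K + of_bool (w i)) - tail_of (\<lambda>i. K + of_bool (w' i))\<bar>"
proof (induction j arbitrary: w w')
  case 0
  have main: "(1 / 49) ^ K / 9 \<le> \<bar>block K x - block (Suc K) y\<bar>"
    if xy: "0 \<le> x" "x \<le> 1" "0 \<le> y" "y \<le> 1" for x y
  proof -
    have b: "0 \<le> enter_right y" "enter_right y \<le> 1" "5 / 9 \<le> enter_right x" "enter_right x \<le> 1"
      using enter_right_bounds[OF xy(1,2)] enter_right_bounds[OF xy(3,4)] by auto
    have "pair2 (enter_right y) \<le> pair2 1" using pair2_power_mono[of "enter_right y" 1 1] b by simp
    then have p: "pair2 (enter_right y) \<le> 3 / 7" by (simp add: pair2_def)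
    have "1 / 9 * (1 / 49) ^ K \<le> \<bar>enter_right x - pair2 (enter_right y)\<bar> * (1 / 49) ^ K"
      using p b by (intro mult_right_mono) auto
    also have "\<dots> \<le> \<bar>(pair2 ^^ K) (enter_right x) - (pair2 ^^ K) (pair2 (enter_right y))\<bar>"
      using b pair2_unit[of "enter_right y"] by (intro pair2_power_lipschitz) auto
    finally show ?thesis by (simp add: block_def funpow_swap1)
  qed
  let ?x = "tail_of (\<lambda>i. K + of_bool (w (Suc i)))" and ?y = "tail_of (\<lambda>i. K + of_bool (w' (Suc i)))"
  have r: "tail_of (\<lambda>i. K + of_bool (w i)) = block (K + of_bool (w 0)) ?x"
    "tail_of (\<lambda>i. K + of_bool (w' i)) = block (K + of_bool (w' 0)) ?y"
    by (subst tail_of_rec, simp)+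
  show ?case
  proof (cases "w 0")
    case True
    then have "\<not> w' 0" using 0 by simp
    then show ?thesis using True main[OF tail_of_unit tail_of_unit, of "\<lambda>i. K + of_bool (w' (Suc i))" "\<lambda>i. K + of_bool (w (Suc i))"]
      unfolding r by (simp add: abs_minus_commute)
  next
    case False
    then have "w' 0" using 0 by simp
    then show ?thesis using False main[OF tail_of_unit tail_of_unit, of "\<lambda>i. K + of_bool (w (Suc i))" "\<lambda>i. K + of_bool (w' (Suc i))"]
      unfolding r by simp
  qed
next
  case (Suc j)
  let ?x = "tail_of (\<lambda>i. K + of_bool (w (Suc i)))" and ?y = "tail_of (\<lambda>i. K + of_bool (w' (Suc i)))"
  define n where "n = K + of_bool (w 0)"
  have "w 0 = w' 0" using Suc.prems(1)[of 0] by simp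
  then have r: "tail_of (\<lambda>i. K + of_bool (w i)) = block n ?x" "tail_of (\<lambda>i. K + of_bool (w' i)) = block n ?y"
    unfolding n_def by (subst tail_of_rec, simp)+
  have IH: "(1 / 49) ^ K / 9 * c ^ j \<le> \<bar>?x - ?y\<bar>"
    using Suc.IH[of "\<lambda>i. w (Suc i)" "\<lambda>i. w' (Suc i)"] Suc.prems by simp
  have "(1 / 49 :: real) ^ Suc K \<le> (1 / 49) ^ n"
    by (rule power_decreasing) (auto simp: n_def)
  then have cn: "c \<le> (1 / 49) ^ n / 81" unfolding c_def by (rule divide_right_mono) simp
  have "(1 / 49) ^ K / 9 * c ^ Suc j = (1 / 49) ^ K / 9 * c ^ j * c" by simp
  also have "\<dots> \<le> \<bar>?x - ?y\<bar> * ((1 / 49) ^ n / 81)"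
    using IH cn by (intro mult_mono) (auto simp: c_def)
  also have "\<dots> \<le> \<bar>block n ?x - block n ?y\<bar>" by (intro block_expand tail_of_unit)
  finally show ?case unfolding r .
qed

text \<open>
  The exponent \<open>k\<close> brings the values within \<open>\<epsilon>\<close> of \<open>2 * sqrt 2\<close>, and \<open>K\<close> is then chosen for this \<open>k\<close>.
\<close>

lemma hausdorff_dim_lagrange_positive:
  fixes \<epsilon> :: real
  assumes "\<epsilon> > 0"
  shows "hausdorff_dim (lagrange_spectrum \<inter> {0..<2 * sqrt 2 + \<epsilon>}) > 0"
proof -
  have "\<forall>\<^sub>F n in sequentially. (pair2 ^^ n) 1 < fixpt + \<epsilon>"
    by (rule order_tendstoD(2)[OF pair2_power_1_tendsto]) (use assms in simp)
  then obtain k where k: "(pair2 ^^ k) 1 < fixpt + \<epsilon>" unfolding eventually_sequentially by blast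
  define v where "v = (pair2 ^^ k) (5 / 9)"
  have v: "fixpt < v" unfolding v_def using fixpt_bounds by (intro pair2_power_gt_fixpt) auto
  have "\<forall>\<^sub>F n in sequentially. (pair2 ^^ n) 1 < v"
    by (rule order_tendstoD(2)[OF pair2_power_1_tendsto v])
  moreover have "(\<lambda>n. 1 / (1 - (pair2 ^^ n) 1) + 1 / (3 + fixpt)) \<longlonglongrightarrow> 1 / (1 - fixpt) + 1 / (3 + fixpt)"
    using fixpt_bounds by (intro tendsto_intros pair2_power_1_tendsto) auto
  then have "\<forall>\<^sub>F n in sequentially. 1 / (1 - (pair2 ^^ n) 1) + 1 / (3 + fixpt) < 2 + (v - fixpt) / 2"
    by (rule order_tendstoD(2)) (unfold inverse_fixpt, use v in \<open>simp add: field_simps\<close>)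
  ultimately have "\<forall>\<^sub>F n in sequentially. (pair2 ^^ n) 1 < v \<and> 1 / (1 - (pair2 ^^ n) 1) + 1 / (3 + fixpt) < 2 + (v - fixpt) / 2"
    by (rule eventually_conj)
  then obtain K where K: "(pair2 ^^ K) 1 < v" "1 / (1 - (pair2 ^^ K) 1) + 1 / (3 + fixpt) < 2 + (v - fixpt) / 2"
    unfolding eventually_sequentially by blast
  have marked: "marked_sequence k K" unfolding marked_sequence_def using K by (simp add: v_def)
  define tl where "tl w = tail_of (\<lambda>i. K + of_bool (w i))" for w
  define val where "val w = sqrt 2 * (2 + (block k (tl w) - fixpt) / 2)" for w
  have tl: "0 \<le> tl w" "tl w \<le> 1" for w unfolding tl_def by (rule tail_of_unit)+
  show ?thesis
  proof (rule hausdorff_dim_positive_if_cantor_image)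
    fix w
    have "val w \<in> lagrange_spectrum"
      using marked_sequence.limit_value_in_lagrange_spectrum[OF marked, of w]
      by (simp add: val_def tl_def marked_sequence.limit_value_def[OF marked] marked_sequence.X_def[OF marked]
          marked_sequence.free_def[OF marked, abs_def])
    moreover have "0 \<le> val w \<and> val w < 2 * sqrt 2 + \<epsilon>"
    proof -
      have lo: "fixpt < block k (tl w)" by (intro block_gt_fixpt tl)
      have "block k (tl w) \<le> (pair2 ^^ k) 1"
        unfolding block_def using enter_right_bounds[OF tl, of w] by (intro pair2_power_mono) auto
      then have hi: "block k (tl w) - fixpt < \<epsilon>" using k by simp
      have "sqrt 2 \<le> (2::real)" by (rule real_le_lsqrt) simp_all
      then have "sqrt 2 * (block k (tl w) - fixpt) \<le> 2 * (block k (tl w) - fixpt)"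
        using lo by (intro mult_right_mono) auto
      moreover have "val w = 2 * sqrt 2 + sqrt 2 * (block k (tl w) - fixpt) / 2"
        by (simp add: val_def algebra_simps)
      moreover have "0 \<le> sqrt 2 * (block k (tl w) - fixpt)" using lo by simp
      ultimately show ?thesis using hi by simp
    qed
    ultimately show "val w \<in> lagrange_spectrum \<inter> {0..<2 * sqrt 2 + \<epsilon>}" by simp
  next
    fix w w' :: "nat \<Rightarrow> bool" and j
    assume ww: "\<And>i. i < j \<Longrightarrow> w i = w' i" "w j \<noteq> w' j"
    have "(1 / 49 :: real) ^ k / 81 / 2 * ((1 / 49) ^ K / 9) * ((1 / 49) ^ Suc K / 81) ^ j
        = ((1 / 49) ^ K / 9 * ((1 / 49) ^ Suc K / 81) ^ j) * ((1 / 49) ^ k / 81) / 2" by simp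
    also have "\<dots> \<le> \<bar>tl w - tl w'\<bar> * ((1 / 49) ^ k / 81) / 2"
      unfolding tl_def by (intro divide_right_mono mult_right_mono free_tail_separation ww) simp_all
    also have "\<dots> \<le> \<bar>block k (tl w) - block k (tl w')\<bar> / 2"
      by (intro divide_right_mono block_expand tl) simp
    also have "\<dots> = 1 * (\<bar>block k (tl w) - block k (tl w')\<bar> / 2)" by simp
    also have "\<dots> \<le> sqrt 2 * (\<bar>block k (tl w) - block k (tl w')\<bar> / 2)" by (intro mult_right_mono) simp_all
    also have "\<dots> = dist (val w) (val w')"
    proof -
      have "val w - val w' = sqrt 2 * ((block k (tl w) - block k (tl w')) / 2)"
        by (simp add: val_def field_simps)
      then show ?thesis by (simp only: dist_real_def abs_mult abs_divide) simp
    qed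
    finally show "(1 / 49) ^ k / 81 / 2 * ((1 / 49) ^ K / 9) * ((1 / 49) ^ Suc K / 81) ^ j \<le> dist (val w) (val w')" .
  next
    have "(1 / 49 :: real) ^ Suc K \<le> 1" by (rule power_le_one) auto
    then show "(1 / 49 :: real) ^ Suc K / 81 < 1" by simp
  qed simp_all
qed

theorem theorem1p2:
  fixes \<epsilon> :: real
  assumes "\<epsilon> > 0"
  shows "hausdorff_dim (markoff_spectrum \<inter> {0..<2 * sqrt 2 + \<epsilon>})
           \<ge> hausdorff_dim (lagrange_spectrum \<inter> {0..<2 * sqrt 2 + \<epsilon>})
       \<and> hausdorff_dim (lagrange_spectrum \<inter> {0..<2 * sqrt 2 + \<epsilon>}) > 0"
  using hausdorff_dim_mono[OF Int_mono[OF lagrange_spectrum_subset_markoff_spectrum order_refl]]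
    hausdorff_dim_lagrange_positive[OF assms] by blast

end
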